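(* For every positive integer $d$ and every $C>0$ there exists $n_0=n_0(d,C)$ with the following property. Let $\Gamma\subset\mathbb{R}^2$ be an irreducible algebraic curve of degree $d$, and let $\mathcal{H}\subset\Gamma$ be a set of $n>n_0$ points. Suppose the lines connecting pairs of distinct points of $\mathcal{H}$ determine at most $Cn$ distinct directions. Then $\Gamma$ is a conic. *)

theory Defs
  imports "HOL-Analysis.Analysis" "HOL-Computational_Algebra.Computational_Algebra"
begin

text \<open>
  The ring of bivariate real polynomials is represented as \<^typ>\<open>real poly poly\<close>: the outer
  variable is \<open>Y\<close>, the inner one is \<open>X\<close>, and \<open>coeff (coeff f i) j\<close> is the coefficient of
  \<open>X\<^sup>j Y\<^sup>i\<close>.  Irreducibility in this ring is irreducibility in \<open>\<real>[X, Y]\<close>.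
\<close>

definition eval2 :: "real poly poly \<Rightarrow> real \<times> real \<Rightarrow> real" where
  "eval2 f = (\<lambda>(x, y). poly (poly f [:y:]) x)"

lemma eval2_altdef:
  "eval2 f (x, y) = (\<Sum>i\<le>degree f. \<Sum>j\<le>degree (coeff f i). coeff (coeff f i) j * x ^ j * y ^ i)"
proof -
  have "poly (poly f [:y:]) x = (\<Sum>i\<le>degree f. poly (coeff f i) x * y ^ i)"
    by (simp add: poly_altdef[of f] poly_sum poly_power)
  thus ?thesis
    by (simp add: eval2_def poly_altdef sum_distrib_right)
qed

text \<open>The element \<open>0\<close> only serves to give the zero polynomial total degree \<open>0\<close>.\<close>

definition total_degree :: "real poly poly \<Rightarrow> nat" where
  "total_degree f = Max (insert 0 {i + j | i j. coeff (coeff f i) j \<noteq> 0})"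

lemma finite_exponent_sums: "finite {i + j | i j. coeff (coeff f i) j \<noteq> (0::real)}"
proof (rule finite_subset)
  show "{i + j | i j. coeff (coeff f i) j \<noteq> 0}
          \<subseteq> (\<Union>i\<le>degree f. \<Union>j\<le>degree (coeff f i). {i + j})"
  proof
    fix n assume "n \<in> {i + j | i j. coeff (coeff f i) j \<noteq> 0}"
    then obtain i j where ij: "n = i + j" "coeff (coeff f i) j \<noteq> 0" by blast
    have "coeff f i \<noteq> 0"
      using ij(2) by auto
    hence "i \<le> degree f"
      by (rule le_degree)
    moreover have "j \<le> degree (coeff f i)"
      using ij(2) by (rule le_degree)
    ultimately show "n \<in> (\<Union>i\<le>degree f. \<Union>j\<le>degree (coeff f i). {i + j})"
      using ij(1) by blast
  qed
qed simp

definition zero_locus :: "real poly poly \<Rightarrow> (real \<times> real) set" where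
  "zero_locus f = {p. eval2 f p = 0}"

definition irreducible_curve :: "nat \<Rightarrow> (real \<times> real) set \<Rightarrow> bool" where
  "irreducible_curve d \<Gamma> \<longleftrightarrow> (\<exists>f. irreducible f \<and> total_degree f = d \<and> \<Gamma> = zero_locus f)"

text \<open>
  Degenerate conics are included.  In particular a line is a conic, namely a double line, the zero
  locus of the square of its linear equation.
\<close>

definition conic_curve :: "(real \<times> real) set \<Rightarrow> bool" where
  "conic_curve \<Gamma> \<longleftrightarrow> (\<exists>q. total_degree q = 2 \<and> \<Gamma> = zero_locus q)"

definition connecting_lines :: "(real \<times> real) set \<Rightarrow> (real \<times> real) set set" where
  "connecting_lines H = {affine hull {p, q} | p q. p \<in> H \<and> q \<in> H \<and> p \<noteq> q}"

text \<open>
  The direction of a line is the one-dimensional linear subspace parallel to it, so two lines have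
  the same direction iff they are parallel or equal.
\<close>

definition direction :: "(real \<times> real) set \<Rightarrow> (real \<times> real) set" where
  "direction L = {b - a | a b. a \<in> L \<and> b \<in> L}"

lemma direction_affine_hull: "direction (affine hull {p, q}) = span {q - p}"
proof
  show "direction (affine hull {p, q}) \<subseteq> span {q - p}"
  proof
    fix v assume "v \<in> direction (affine hull {p, q})"
    then obtain a b where ab: "a \<in> affine hull {p, q}" "b \<in> affine hull {p, q}" "v = b - a"
      unfolding direction_def by blast
    from ab(1,2) obtain s t s' t' where
      st: "a = s *\<^sub>R p + t *\<^sub>R q" "s + t = 1" "b = s' *\<^sub>R p + t' *\<^sub>R q" "s' + t' = 1"
      unfolding affine_hull_2 by blast
    have s: "s = 1 - t" "s' = 1 - t'"
      using st(2,4) by simp_all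
    have "v = (t' - t) *\<^sub>R (q - p)"
      unfolding ab(3) st(1,3) s by (simp add: algebra_simps)
    thus "v \<in> span {q - p}"
      by (auto simp: span_singleton)
  qed
next
  show "span {q - p} \<subseteq> direction (affine hull {p, q})"
  proof
    fix v assume "v \<in> span {q - p}"
    then obtain k where k: "v = k *\<^sub>R (q - p)"
      by (auto simp: span_singleton)
    have "(1 - k) *\<^sub>R p + k *\<^sub>R q \<in> affine hull {p, q}"
      unfolding affine_hull_2 by (metis (mono_tags, lifting) diff_add_cancel mem_Collect_eq)
    moreover have "p \<in> affine hull {p, q}"
      by (simp add: hull_inc)
    moreover have "v = ((1 - k) *\<^sub>R p + k *\<^sub>R q) - p"
      by (simp add: k algebra_simps)
    ultimately show "v \<in> direction (affine hull {p, q})"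
      unfolding direction_def by blast
  qed
qed

definition directions :: "(real \<times> real) set \<Rightarrow> (real \<times> real) set set" where
  "directions H = direction ` connecting_lines H"

end

theory Submission
  imports Defs "HOL-Computational_Algebra.Field_as_Ring"
begin

text \<open>
  Suppose \<open>d \<ge> 3\<close>.  Two pairs of points \<open>(A, Q)\<close>, \<open>(A', Q')\<close> of \<open>H\<close> spanning parallel lines are regarded as
  an incidence between the ``point'' \<open>(A, A')\<close> and the ``curve'' \<open>(Q, Q')\<close>; few directions force about \<open>n\<^sup>3\<close>
  incidences.  Cutting \<open>\<Gamma>\<close> into about \<open>r\<close> connected blocks divides the \<open>n\<^sup>2\<close> points into \<open>r\<^sup>2\<close> cells, and a curve
  meets only \<open>O(r)\<close> of them, so Cauchy--Schwarz yields at least about \<open>n\<^sup>4 / r\<close> pairs of points in a common cell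
  on a common curve.  On the other hand, two points \<open>(A, A')\<close>, \<open>(B, B')\<close> lie on a bounded number of common
  curves unless the map sending \<open>Q\<close> to the intersection \<open>Q'\<close> of the parallels to \<open>AQ\<close> through \<open>A'\<close> and to
  \<open>BQ\<close> through \<open>B'\<close> preserves \<open>\<Gamma>\<close>.  For degree at least \<open>3\<close> this forces \<open>AB\<close> to be parallel to \<open>A'B'\<close>, so that
  the map is a homothety, hence the identity or the only point reflection preserving \<open>\<Gamma>\<close>.  The exceptional
  pairs are thus too few to matter and the number of pairs is only \<open>O(n\<^sup>4 / r\<^sup>2) + O(n\<^sup>3)\<close>, a contradiction
  for a large constant \<open>r\<close>.
\<close>

section \<open>Bezout bound for plane curves\<close>

text \<open>The lower bound uses Cauchy-Schwarz twice. About n^2 pairs have at most C n slopes,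
  hence about n^3 / C coincidences of slope; these are spread over n^2 curves with O(r) cells each,
  and (n^3)^2 / (n^2 r) = n^4 / r. The obstacle in the upper bound is a map that preserves \<Gamma>:
  Bezout then says nothing, and conics do admit such maps, as regular polygons inscribed in a circle
  show. Moreover a real zero locus may be finite and need not determine \<open>f\<close>.
  Exceptional quadruples are therefore those whose pullback of \<open>f\<close> is a multiple of
  \<open>f\<close>, and the many points of \<open>H\<close> serve to pass from vanishing to
  divisibility. A nontrivial translation, or a homothety of ratio other than 1 and -1, would put
  infinitely many points of \<Gamma> on one line. Exceptional quadruples contribute O(n) for each of
  at most n^2 pairs (A, B), while the O(n) pairs (A, B) beyond the reach of the degree argument
  contribute O(n^2) each. All constants may depend on \<open>d\<close>, so crude Bezout bounds
  suffice.\<close>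

lemma homogeneous_system_nontrivial_solution:
  fixes c :: "'j \<Rightarrow> 'i \<Rightarrow> real"
  assumes "finite J" "finite I" "card J < card I"
  shows "\<exists>v. (\<exists>i\<in>I. v i \<noteq> 0) \<and> (\<forall>j\<in>J. (\<Sum>i\<in>I. c j i * v i) = 0)"
  using assms
proof (induction J arbitrary: I c rule: finite_induct)
  case empty
  then obtain i where "i \<in> I" by fastforce
  then show ?case by (intro exI[of _ "\<lambda>_. 1"]) auto
next
  case (insert j0 J)
  show ?case
  proof (cases "\<forall>i\<in>I. c j0 i = 0")
    case True
    obtain v where "\<exists>i\<in>I. v i \<noteq> 0" "\<forall>j\<in>J. (\<Sum>i\<in>I. c j i * v i) = 0"
      using insert.IH[of I c] insert.prems insert.hyps by auto
    then show ?thesis using True by (intro exI[of _ v]) auto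
  next
    case False
    then obtain i0 where i0: "i0 \<in> I" "c j0 i0 \<noteq> 0" by blast
    \<comment> \<open>Gaussian elimination: equation \<open>j0\<close> is solved for the unknown
      \<open>i0\<close>, and \<open>c'\<close> are the coefficients of the other equations after
      substitution.\<close>
    define c' where "c' = (\<lambda>j i. c j i - c j i0 * c j0 i / c j0 i0)"
    have "card J < card (I - {i0})"
      using insert.prems insert.hyps i0 by (simp add: card_Diff_singleton)
    then obtain v where v: "\<exists>i\<in>I-{i0}. v i \<noteq> 0" "\<forall>j\<in>J. (\<Sum>i\<in>I-{i0}. c' j i * v i) = 0"
      using insert.IH[of "I - {i0}" c'] insert.prems by blast
    define u where "u = v(i0 := - (\<Sum>i\<in>I-{i0}. c j0 i * v i) / c j0 i0)"
    have split: "(\<Sum>i\<in>I. c j i * u i) = c j i0 * u i0 + (\<Sum>i\<in>I-{i0}. c j i * v i)" for j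
      using i0 insert.prems by (subst sum.remove[of _ i0]) (auto simp: u_def intro!: sum.cong)
    have "(\<Sum>i\<in>I. c j0 i * u i) = 0"
      unfolding split using i0 by (simp add: u_def)
    moreover have "(\<Sum>i\<in>I. c j i * u i) = 0" if "j \<in> J" for j
    proof -
      have "0 = (\<Sum>i\<in>I-{i0}. c' j i * v i)" using v that by simp
      also have "\<dots> = (\<Sum>i\<in>I-{i0}. c j i * v i) - (c j i0 / c j0 i0) * (\<Sum>i\<in>I-{i0}. c j0 i * v i)"
        by (simp add: c'_def sum_distrib_left algebra_simps sum_subtractf)
      finally show ?thesis unfolding split using i0 by (simp add: u_def)
    qed
    moreover have "\<exists>i\<in>I. u i \<noteq> 0" using v by (auto simp: u_def)
    ultimately show ?thesis by (intro exI[of _ u]) auto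
  qed
qed

text \<open>Bounding each exponent separately makes the possible monomials a square, convenient to
  count, and the bounds still add up under multiplication.\<close>

definition bideg_le :: "nat \<Rightarrow> real poly poly \<Rightarrow> bool" where
  "bideg_le e g \<longleftrightarrow> degree g \<le> e \<and> (\<forall>i. degree (coeff g i) \<le> e)"

lemma bideg_le_mono: "bideg_le e g \<Longrightarrow> e \<le> e' \<Longrightarrow> bideg_le e' g"
  unfolding bideg_le_def by (meson le_trans)

lemma bideg_le_add: "bideg_le e g \<Longrightarrow> bideg_le e h \<Longrightarrow> bideg_le e (g + h)"
  unfolding bideg_le_def by (auto intro: degree_add_le)

lemma bideg_le_mult:
  assumes "bideg_le a g" "bideg_le b h"
  shows "bideg_le (a + b) (g * h)"
proof -
  have "degree (coeff (g * h) i) \<le> a + b" for i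
    unfolding coeff_mult using assms
    by (intro degree_sum_le order.trans[OF degree_mult_le] add_mono) (auto simp: bideg_le_def)
  moreover have "degree (g * h) \<le> a + b"
    using assms by (intro order.trans[OF degree_mult_le] add_mono) (auto simp: bideg_le_def)
  ultimately show ?thesis by (simp add: bideg_le_def)
qed

lemma bideg_le_coeff:
  assumes "bideg_le e g" "i > e \<or> j > e"
  shows "coeff (coeff g i) j = 0"
  using assms by (metis bideg_le_def coeff_0 coeff_eq_0 le_less_trans)

lemma eval2_add [simp]: "eval2 (g + h) Z = eval2 g Z + eval2 h Z"
  by (cases Z) (simp add: eval2_def)

lemma eval2_mult [simp]: "eval2 (g * h) Z = eval2 g Z * eval2 h Z"
  by (cases Z) (simp add: eval2_def)

lemma eval2_const [simp]: "eval2 [:r:] (x, y) = poly r x"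
  by (simp add: eval2_def)

text \<open>The coefficients of \<open>a\<close>, \<open>b\<close> and \<open>r\<close> outnumber the linear equations expressing \<open>a f + b g = r\<close>.\<close>

lemma bivariate_elimination:
  assumes f: "irreducible f" "degree f > 0" "bideg_le d f" and g: "bideg_le e g" "\<not> f dvd g"
  shows "\<exists>a b r. r \<noteq> 0 \<and> degree r \<le> (d + e)^2 \<and> a * f + b * g = [:r:]"
proof -
  define p where "p = degree f"
  define D where "D = d + e"
  \<comment> \<open>With \<open>a\<close> of Y-degree below \<open>e\<close>, \<open>b\<close> of
    Y-degree below \<open>p\<close>, and X-degrees at most \<open>M\<close>, the unknowns exceed the
    equations by \<open>M + 1 - (p + e) * D\<close>, which is positive for \<open>M = D^2\<close>
    because \<open>p\<close> is at most \<open>d\<close>.\<close>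
  define M where "M = D^2"
  have pd: "p \<le> d" "p > 0" using f by (auto simp: p_def bideg_le_def)
  \<comment> \<open>The tags 0, 1 and 2 mark the unknown coefficients of \<open>a\<close>,
    \<open>b\<close> and \<open>r\<close>.\<close>
  define I where "I = ({0::nat} \<times> {..<e} \<times> {..M}) \<union> ({1} \<times> {..<p} \<times> {..M}) \<union> ({2} \<times> {0} \<times> {..M})"
  define J where "J = {..<p + e} \<times> {..M + D}"
  define bas :: "nat \<times> nat \<times> nat \<Rightarrow> real poly poly" where
    "bas = (\<lambda>(k,i,j). if k = 0 then monom (monom 1 j) i * f else
              if k = 1 then monom (monom 1 j) i * g else monom (monom (-1) j) i)"
  have "card I = (e + p + 1) * (M + 1)"
    unfolding I_def by (subst card_Un_disjoint; (subst card_Un_disjoint)?; force simp: card_cartesian_product algebra_simps)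
  moreover have "card J = (p + e) * (M + D + 1)" by (simp add: J_def card_cartesian_product)
  moreover have "(p + e) * D \<le> M" using pd by (simp add: M_def D_def power2_eq_square mult_right_mono)
  ultimately have less: "card J < card I" by (simp add: algebra_simps)
  have finI: "finite I" by (simp add: I_def)
  obtain v :: "nat \<times> nat \<times> nat \<Rightarrow> real" where v: "\<exists>i\<in>I. v i \<noteq> 0"
     "\<forall>j\<in>J. (\<Sum>i\<in>I. coeff (coeff (bas i) (fst j)) (snd j) * v i) = 0"
    using homogeneous_system_nontrivial_solution[OF _ _ less, of "\<lambda>j i. coeff (coeff (bas i) (fst j)) (snd j)"]
    by (auto simp: finI J_def)
  define a where "a = (\<Sum>i<e. \<Sum>j\<le>M. monom (monom (v (0,i,j)) j) i)"
  define b where "b = (\<Sum>i<p. \<Sum>j\<le>M. monom (monom (v (1,i,j)) j) i)"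
  define r where "r = (\<Sum>j\<le>M. monom (v (2,0,j)) j)"
  have block: "sum F ({k} \<times> A \<times> B) = (\<Sum>i\<in>A. \<Sum>j\<in>B. F (k, i, j))"
    for F :: "nat \<times> nat \<times> nat \<Rightarrow> real poly poly" and k A B
  proof -
    have "sum F ({k} \<times> A \<times> B) = (\<Sum>x\<in>{k}. \<Sum>i\<in>A. \<Sum>j\<in>B. F (x, i, j))"
      by (simp only: sum.cartesian_product split_def prod.collapse)
    then show ?thesis by simp
  qed
  have tot: "(\<Sum>i\<in>I. [:[:v i:]:] * bas i) = a * f + b * g - [:r:]"
  proof -
    have "(\<Sum>i\<in>I. [:[:v i:]:] * bas i) = (\<Sum>i\<in>{0::nat} \<times> {..<e} \<times> {..M}. [:[:v i:]:] * bas i) +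
        (\<Sum>i\<in>{1::nat} \<times> {..<p} \<times> {..M}. [:[:v i:]:] * bas i) + (\<Sum>i\<in>{2::nat} \<times> {0} \<times> {..M}. [:[:v i:]:] * bas i)"
      unfolding I_def by (subst sum.union_disjoint; (subst sum.union_disjoint)?; force)
    also have "(\<Sum>i\<in>{0::nat} \<times> {..<e} \<times> {..M}. [:[:v i:]:] * bas i) = a * f"
      unfolding a_def bas_def sum_distrib_right block
      by (simp add: smult_monom flip: mult_smult_left)
    also have "(\<Sum>i\<in>{1::nat} \<times> {..<p} \<times> {..M}. [:[:v i:]:] * bas i) = b * g"
      unfolding b_def bas_def sum_distrib_right block
      by (simp add: smult_monom flip: mult_smult_left)
    also have "(\<Sum>i\<in>{2::nat} \<times> {0} \<times> {..M}. [:[:v i:]:] * bas i) = - [:r:]"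
    proof -
      have "- [:r:] = (\<Sum>j\<le>M. [:monom (- v (2,0,j)) j:])"
        by (intro poly_eqI) (simp add: r_def coeff_sum coeff_pCons sum_negf flip: minus_monom split: nat.split)
      then show ?thesis
        unfolding bas_def block by (simp add: smult_monom monom_0)
    qed
    finally show ?thesis by simp
  qed
  have bas0: "coeff (coeff (bas k) i') j' = 0" if "k \<in> I" "(i', j') \<notin> J" for k i' j'
  proof -
    obtain x i j where k: "k = (x, i, j)" by (cases k)
    have "bideg_le d f" "bideg_le e g" by fact+
    then have *: "coeff (coeff f i1) j1 = 0" if "i1 > p \<or> j1 > D" for i1 j1
      using that pd by (auto simp: p_def D_def coeff_eq_0 intro: bideg_le_coeff)
    have **: "coeff (coeff g i1) j1 = 0" if "i1 > e \<or> j1 > D" for i1 j1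
      using that bideg_le_coeff[OF g(1)] by (auto simp: D_def)
    show ?thesis
      using that pd unfolding bas_def k
      by (auto simp: I_def J_def coeff_monom_mult intro!: * **)
  qed
  have zero: "a * f + b * g - [:r:] = 0"
  proof (intro poly_eqI)
    fix i' j'
    have "coeff (coeff (a * f + b * g - [:r:]) i') j' = (\<Sum>i\<in>I. coeff (coeff (bas i) i') j' * v i)"
      unfolding tot[symmetric] by (simp add: coeff_sum mult.commute)
    also have "\<dots> = 0"
    proof (cases "(i', j') \<in> J")
      case True
      then show ?thesis using v(2) by auto
    next
      case False
      then show ?thesis by (simp add: bas0)
    qed
    finally show "coeff (coeff (a * f + b * g - [:r:]) i') j' = coeff (coeff 0 i') j'" by simp
  qed
  have coeffs: "coeff (coeff (\<Sum>i<m. \<Sum>j\<le>M. monom (monom (w i j) j) i) i') j' =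
      (if i' < m \<and> j' \<le> M then w i' j' else 0)" for w :: "nat \<Rightarrow> nat \<Rightarrow> real" and m i' j'
  proof -
    have "coeff (coeff (\<Sum>j\<le>M. monom (monom (w i j) j) i) i') j' = (if i = i' then if j' \<le> M then w i' j' else 0 else 0)"
      for i by (auto simp: coeff_sum)
    then show ?thesis by (simp only: coeff_sum[of _ "{..<m}"]) simp
  qed
  have "degree r \<le> (d + e)^2"
    unfolding r_def M_def D_def by (intro degree_sum_le) (auto intro: order.trans[OF degree_monom_le])
  moreover have "r \<noteq> 0"
  proof
    \<comment> \<open>If \<open>r\<close> were zero, the prime \<open>f\<close> would divide
      \<open>b\<close>, whose degree in Y is below that of \<open>f\<close>; then \<open>b\<close>,
      hence \<open>a\<close>, hence all of \<open>v\<close> would vanish.\<close>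
    assume "r = 0"
    have "prime_elem f" using f(1) by (rule irreducible_imp_prime_elem)
    have eq: "b * g = - (a * f)" using zero \<open>r = 0\<close> by (simp add: eq_neg_iff_add_eq_0 add.commute)
    then have "f dvd b * g" by simp
    then have "f dvd b" using \<open>prime_elem f\<close> g(2) by (simp add: prime_elem_dvd_mult_iff)
    have "degree b < p"
    proof -
      have "degree b \<le> p - 1" by (intro degree_le) (use pd in \<open>auto simp: poly_eq_iff b_def coeffs\<close>)
      then show ?thesis using pd by linarith
    qed
    then have "b = 0" using \<open>f dvd b\<close> by (metis dvd_imp_degree_le leD p_def)
    then have "a = 0" using eq f(2) by auto
    have "v i = 0" if "i \<in> I" for i
    proof -
      have "v (0, i, j) = 0" if "i < e" "j \<le> M" for i j
        using coeffs[where m = e and w = "\<lambda>i j. v (0, i, j)" and i' = i and j' = j] that \<open>a = 0\<close> by (simp add: a_def)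
      moreover have "v (1, i, j) = 0" if "i < p" "j \<le> M" for i j
        using coeffs[where m = p and w = "\<lambda>i j. v (1, i, j)" and i' = i and j' = j] that \<open>b = 0\<close> by (simp add: b_def)
      moreover have "v (2, 0, j) = 0" if "j \<le> M" for j
      proof -
        have "coeff r j = v (2, 0, j)" using that by (simp add: r_def coeff_sum)
        then show ?thesis using \<open>r = 0\<close> by simp
      qed
      ultimately show ?thesis using that by (auto simp: I_def)
    qed
    then show False using v(1) by blast
  qed
  ultimately show ?thesis using zero by (intro exI[of _ a] exI[of _ b] exI[of _ r]) simp
qed


lemma poly_map_poly_eval: "poly (map_poly (\<lambda>c. poly c x) f) y = eval2 f (x, y)"
proof -
  have "eval2 f (x, y) = (\<Sum>i\<le>degree f. poly (coeff f i) x * y ^ i)"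
    by (simp add: eval2_def poly_altdef[of f] poly_sum poly_power)
  also have "\<dots> = (\<Sum>i\<le>degree (map_poly (\<lambda>c. poly c x) f). poly (coeff f i) x * y ^ i)"
    by (rule sum.mono_neutral_right) (auto simp: map_poly_degree_leq coeff_map_poly intro!: le_degree)
  also have "\<dots> = poly (map_poly (\<lambda>c. poly c x) f) y"
    by (simp add: poly_altdef coeff_map_poly)
  finally show ?thesis ..
qed

text \<open>Elimination leaves at most \<open>(d + e)^2\<close> abscissas for the common zeros, the
  roots of \<open>r\<close>. Over each of them there are at most \<open>d\<close> zeros of
  \<open>f\<close>: an irreducible \<open>f\<close> of positive degree in Y is not divisible by X -
  x, so it does not vanish on a whole vertical line.\<close>

lemma bezout_bound:
  assumes f: "irreducible f" "degree f > 0" "bideg_le d f" and g: "bideg_le e g" "\<not> f dvd g"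
  shows "finite {Z. eval2 f Z = 0 \<and> eval2 g Z = 0} \<and>
    card {Z. eval2 f Z = 0 \<and> eval2 g Z = 0} \<le> d * (d + e)^2"
proof -
  obtain a b r where r: "r \<noteq> 0" "degree r \<le> (d + e)^2" "a * f + b * g = [:r:]"
    using bivariate_elimination[OF assms] by blast
  define X where "X = {x. poly r x = 0}"
  define Y where "Y = (\<lambda>x. {y. poly (map_poly (\<lambda>c. poly c x) f) y = 0})"
  have X: "finite X" "card X \<le> (d + e)^2"
    using r poly_roots_finite[of r] card_poly_roots_bound[of r] by (auto simp: X_def)
  have Y: "finite (Y x) \<and> card (Y x) \<le> d" for x
  proof -
    have "map_poly (\<lambda>c. poly c x) f \<noteq> 0"
    proof
      assume *: "map_poly (\<lambda>c. poly c x) f = 0"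
      have "[:-x, 1:] dvd coeff f i" for i
        using arg_cong[OF *, of "\<lambda>p. coeff p i"] by (simp add: coeff_map_poly poly_eq_0_iff_dvd)
      then have "[:[:-x, 1:]:] dvd f" by (simp add: const_poly_dvd_iff)
      then obtain h where h: "f = [:[:-x, 1:]:] * h" by (elim dvdE)
      then have "is_unit [:[:-x, 1:]:] \<or> is_unit h" using f(1) irreducibleD by blast
      then show False
      proof
        assume "is_unit [:[:-x, 1:]:]"
        then have "is_unit [:-x, 1:]" by (simp add: is_unit_const_poly_iff)
        then show False by (simp add: is_unit_iff_degree)
      next
        assume "is_unit h"
        then have "degree h = 0" by (auto simp: is_unit_poly_iff)
        then show False using f(2) h degree_mult_le[of "[:[:-x, 1:]:]" h] by simp
      qed
    qed
    then show ?thesis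
      using poly_roots_finite card_poly_roots_bound f(3) map_poly_degree_leq[of "\<lambda>c. poly c x" f]
      by (force simp: Y_def bideg_le_def)
  qed
  have "{Z. eval2 f Z = 0 \<and> eval2 g Z = 0} \<subseteq> Sigma X Y"
  proof (rule subsetI)
    fix Z assume "Z \<in> {Z. eval2 f Z = 0 \<and> eval2 g Z = 0}"
    then obtain x y where xy: "Z = (x, y)" and Z: "eval2 f (x, y) = 0" "eval2 g (x, y) = 0"
      by (cases Z) auto
    have "poly r x = eval2 (a * f + b * g) (x, y)" unfolding r(3) by simp
    then have "poly r x = 0" using Z by simp
    then show "Z \<in> Sigma X Y" using Z by (simp add: xy X_def Y_def poly_map_poly_eval)
  qed
  moreover have "finite (Sigma X Y)" using X Y by auto
  moreover have "card (Sigma X Y) \<le> d * (d + e)^2"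
  proof -
    have "card (Sigma X Y) = (\<Sum>x\<in>X. card (Y x))" using X Y by (simp add: card_SigmaI)
    also have "\<dots> \<le> card X * d" using Y sum_bounded_above[of X "\<lambda>x. card (Y x)" d] by simp
    also have "\<dots> \<le> (d + e)^2 * d" using X by (intro mult_right_mono) auto
    finally show ?thesis by (simp add: mult.commute)
  qed
  ultimately show ?thesis using card_mono[of "Sigma X Y"] by (meson finite_subset order.trans)
qed

section \<open>Total degree and restriction to lines\<close>

lemma coeff_le_total_degree: "coeff (coeff f i) j \<noteq> 0 \<Longrightarrow> i + j \<le> total_degree f"
  unfolding total_degree_def using finite_exponent_sums[of f] by (intro Max_ge) auto

lemma total_degree_le: "(\<And>i j. coeff (coeff f i) j \<noteq> 0 \<Longrightarrow> i + j \<le> k) \<Longrightarrow> total_degree f \<le> k"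
  unfolding total_degree_def using finite_exponent_sums[of f] by (subst Max_le_iff) auto

lemma bideg_le_total_degree: "bideg_le (total_degree f) f"
proof -
  have "degree f \<le> total_degree f"
  proof (rule degree_le, safe)
    fix i assume "total_degree f < i"
    then show "coeff f i = 0" using coeff_le_total_degree[of f i] by (intro poly_eqI) fastforce
  qed
  moreover have "degree (coeff f i) \<le> total_degree f" for i
  proof (rule degree_le, safe)
    fix j assume "total_degree f < j"
    then have "\<not> i + j \<le> total_degree f" by linarith
    then show "coeff (coeff f i) j = 0" using coeff_le_total_degree by blast
  qed
  ultimately show ?thesis by (simp add: bideg_le_def)
qed

lemma total_degree_attained:
  assumes "f \<noteq> 0"
  obtains i where "i \<le> total_degree f" "coeff (coeff f i) (total_degree f - i) \<noteq> 0"
proof -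
  let ?S = "{i + j | i j. coeff (coeff f i) j \<noteq> 0}"
  obtain i j where ij: "coeff (coeff f i) j \<noteq> 0" using assms by (metis coeff_0 poly_eqI)
  have "total_degree f \<in> insert 0 ?S"
    unfolding total_degree_def by (rule Max_in) (auto simp: finite_exponent_sums)
  then have "total_degree f \<in> ?S"
  proof
    assume "total_degree f = 0"
    then show ?thesis using ij coeff_le_total_degree[OF ij] by auto
  qed
  then obtain i j where "total_degree f = i + j" "coeff (coeff f i) j \<noteq> 0" by blast
  then show ?thesis using that[of i] by simp
qed

text \<open>The homogeneous part of highest degree; its zeros are the directions in which a line
  meets the curve at infinity.\<close>

definition top_form :: "real poly poly \<Rightarrow> real \<Rightarrow> real \<Rightarrow> real" where
  "top_form f v w = (\<Sum>i\<le>total_degree f. coeff (coeff f i) (total_degree f - i) * v ^ (total_degree f - i) * w ^ i)"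

lemma eval2_triangle_sum:
  "eval2 f (x, y) = (\<Sum>i\<le>total_degree f. \<Sum>j\<le>total_degree f - i. coeff (coeff f i) j * x ^ j * y ^ i)"
proof -
  let ?d = "total_degree f"
  have "poly (coeff f i) x = (\<Sum>j\<le>?d - i. coeff (coeff f i) j * x ^ j)" for i
  proof -
    have "degree (coeff f i) \<le> ?d - i"
    proof (rule degree_le, safe)
      fix j assume "?d - i < j"
      then have "\<not> i + j \<le> ?d" by linarith
      then show "coeff (coeff f i) j = 0" using coeff_le_total_degree by blast
    qed
    then show ?thesis
      unfolding poly_altdef by (intro sum.mono_neutral_left) (auto intro: le_degree)
  qed
  moreover have "eval2 f (x, y) = (\<Sum>i\<le>?d. poly (coeff f i) x * y ^ i)"
  proof -
    have "eval2 f (x, y) = (\<Sum>i\<le>degree f. poly (coeff f i) x * y ^ i)"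
      by (simp add: eval2_def poly_altdef[of f] poly_sum poly_power)
    also have "\<dots> = (\<Sum>i\<le>?d. poly (coeff f i) x * y ^ i)"
      using bideg_le_total_degree[of f]
      by (intro sum.mono_neutral_left) (auto simp: bideg_le_def coeff_eq_0)
    finally show ?thesis .
  qed
  ultimately show ?thesis by (simp add: sum_distrib_right)
qed

lemma coeff_mult_at_degree_bound:
  fixes p q :: "'a :: comm_semiring_0 poly"
  assumes "degree p \<le> m" "degree q \<le> n"
  shows "coeff (p * q) (m + n) = coeff p m * coeff q n"
proof -
  have "coeff (p * q) (m + n) = (\<Sum>i\<le>m + n. if i = m then coeff p m * coeff q n else 0)"
    unfolding coeff_mult
  proof (intro sum.cong refl)
    fix i assume "i \<in> {..m + n}"
    then show "coeff p i * coeff q (m + n - i) = (if i = m then coeff p m * coeff q n else 0)"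
      using assms by (cases i m rule: linorder_cases) (auto simp: coeff_eq_0)
  qed
  then show ?thesis by simp
qed

lemma degree_linear_power: "degree ([:a, v:] ^ n) \<le> n"
  for a v :: "'a :: comm_semiring_1"
proof -
  have "degree [:a, v:] * n \<le> 1 * n" by (intro mult_right_mono) auto
  then show ?thesis using degree_power_le[of "[:a, v:]" n] by linarith
qed

lemma coeff_linear_power: "coeff ([:a, v:] ^ n) n = v ^ n"
  for a v :: "'a :: comm_semiring_1"
proof (induction n)
  case (Suc n)
  have "coeff ([:a, v:] * [:a, v:] ^ n) (1 + n) = coeff [:a, v:] 1 * coeff ([:a, v:] ^ n) n"
    by (rule coeff_mult_at_degree_bound) (simp, rule degree_linear_power)
  then show ?case unfolding Suc by (simp only: power_Suc) simp
qed simp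

lemma degree_linear_powers_mult:
  "degree ([:a, v:] ^ j * [:b, w:] ^ i) \<le> i + j" for a v b w :: "'a :: comm_semiring_1"
  using degree_mult_le[of "[:a, v:] ^ j" "[:b, w:] ^ i"] degree_linear_power[of a v j]
    degree_linear_power[of b w i] by linarith

text \<open>The restriction of \<open>f\<close> to the line z |-> A + z v. Expanding it monomial by
  monomial bounds its degree and exhibits the coefficient at \<open>total_degree f\<close>.\<close>

definition line_poly :: "real poly poly \<Rightarrow> real \<times> real \<Rightarrow> real \<times> real \<Rightarrow> real poly" where
  "line_poly f A v = (\<Sum>i\<le>total_degree f. \<Sum>j\<le>total_degree f - i.
     smult (coeff (coeff f i) j) ([:fst A, fst v:] ^ j * [:snd A, snd v:] ^ i))"

lemma poly_line_poly: "poly (line_poly f A v) z = eval2 f (fst A + z * fst v, snd A + z * snd v)"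
  unfolding line_poly_def eval2_triangle_sum by (simp add: poly_sum poly_power mult_ac)

lemma degree_line_poly: "degree (line_poly f A v) \<le> total_degree f"
  unfolding line_poly_def
proof (intro degree_sum_le finite_atMost order.trans[OF degree_smult_le])
  fix i j assume "i \<in> {..total_degree f}" "j \<in> {..total_degree f - i}"
  then have "i + j \<le> total_degree f" by auto
  then show "degree ([:fst A, fst v:] ^ j * [:snd A, snd v:] ^ i) \<le> total_degree f"
    by (rule order.trans[OF degree_linear_powers_mult])
qed

lemma coeff_line_poly: "coeff (line_poly f A v) (total_degree f) = top_form f (fst v) (snd v)"
proof -
  let ?d = "total_degree f"
  have *: "coeff ([:fst A, fst v:] ^ j * [:snd A, snd v:] ^ i) ?d = (if j = ?d - i then fst v ^ j * snd v ^ i else 0)"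
    if "i \<le> ?d" "j \<le> ?d - i" for i j
  proof (cases "j = ?d - i")
    case True
    have "coeff ([:fst A, fst v:] ^ j * [:snd A, snd v:] ^ i) (j + i) = fst v ^ j * snd v ^ i"
      by (simp only: coeff_mult_at_degree_bound[OF degree_linear_power degree_linear_power] coeff_linear_power)
    then show ?thesis using True that by simp
  next
    case False
    then have "i + j < ?d" using that by linarith
    then have "degree ([:fst A, fst v:] ^ j * [:snd A, snd v:] ^ i) < ?d"
      by (rule le_less_trans[OF degree_linear_powers_mult])
    then show ?thesis using False by (simp only: coeff_eq_0 if_False)
  qed
  show ?thesis
    unfolding line_poly_def top_form_def
  proof (simp only: coeff_sum coeff_smult, rule sum.cong[OF refl])
    fix i assume "i \<in> {..?d}"
    then have "(\<Sum>j\<le>?d - i. coeff (coeff f i) j * coeff ([:fst A, fst v:] ^ j * [:snd A, snd v:] ^ i) ?d) =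
        (\<Sum>j\<le>?d - i. if j = ?d - i then coeff (coeff f i) (?d - i) * (fst v ^ (?d - i) * snd v ^ i) else 0)"
      by (intro sum.cong refl) (simp add: *)
    then show "(\<Sum>j\<le>?d - i. coeff (coeff f i) j * coeff ([:fst A, fst v:] ^ j * [:snd A, snd v:] ^ i) ?d) =
        coeff (coeff f i) (?d - i) * fst v ^ (?d - i) * snd v ^ i"
      by (simp add: mult.assoc)
  qed
qed

lemma top_form_roots:
  assumes "f \<noteq> 0"
  shows "finite {m. top_form f 1 m = 0} \<and> card {m. top_form f 1 m = 0} \<le> total_degree f"
proof -
  define p where "p = (\<Sum>i\<le>total_degree f. monom (coeff (coeff f i) (total_degree f - i)) i)"
  have "poly p m = top_form f 1 m" for m
    by (simp add: p_def top_form_def poly_sum poly_monom)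
  moreover have "p \<noteq> 0"
  proof -
    obtain i where i: "i \<le> total_degree f" "coeff (coeff f i) (total_degree f - i) \<noteq> 0"
      using total_degree_attained[OF assms] .
    then have "coeff p i \<noteq> 0" by (simp add: p_def coeff_sum)
    then show ?thesis by auto
  qed
  moreover have "degree p \<le> total_degree f"
    unfolding p_def by (intro degree_sum_le) (auto intro: order.trans[OF degree_monom_le])
  ultimately show ?thesis using poly_roots_finite[of p] card_poly_roots_bound[of p] by simp
qed

text \<open>On a line through the origin whose slope is a zero of neither leading form, total
  degrees become degrees of univariate polynomials, which add. Such a slope exists since only
  finitely many are excluded.\<close>

lemma total_degree_mult_ge:
  assumes "f \<noteq> 0" "h \<noteq> 0"
  shows "total_degree f + total_degree h \<le> total_degree (f * h)"
proof -
  have "finite ({m. top_form f 1 m = 0} \<union> {m. top_form h 1 m = 0})" using top_form_roots assms by simp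
  then obtain m where m: "top_form f 1 m \<noteq> 0" "top_form h 1 m \<noteq> 0"
    using ex_new_if_finite[OF infinite_UNIV_char_0] by blast
  have deg: "degree (line_poly g 0 (1, m)) = total_degree g" if "top_form g 1 m \<noteq> 0" for g
    using that degree_line_poly[of g 0 "(1, m)"] coeff_line_poly[of g 0 "(1, m)"]
    by (metis fst_conv le_antisym le_degree snd_conv)
  have "line_poly (f * h) 0 (1, m) = line_poly f 0 (1, m) * line_poly h 0 (1, m)"
    by (simp add: poly_line_poly flip: poly_eq_poly_eq_iff) (simp add: fun_eq_iff poly_line_poly)
  moreover have "line_poly f 0 (1, m) \<noteq> 0" "line_poly h 0 (1, m) \<noteq> 0"
    using m coeff_line_poly[of _ 0 "(1, m)"] by (metis coeff_0 fst_conv snd_conv)+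
  ultimately show ?thesis
    using degree_line_poly[of "f * h" 0 "(1, m)"] deg m by (simp add: degree_mult_eq)
qed

lemma dvd_total_degree_le: "f dvd g \<Longrightarrow> g \<noteq> 0 \<Longrightarrow> total_degree f \<le> total_degree g"
  using total_degree_mult_ge by (metis add_leD1 dvdE mult_zero_left mult_zero_right)


lemma total_degree_pderiv_less:
  assumes "total_degree f > 0"
  shows "total_degree (pderiv f) < total_degree f"
proof -
  have "total_degree (pderiv f) \<le> total_degree f - 1"
  proof (rule total_degree_le)
    fix i j assume "coeff (coeff (pderiv f) i) j \<noteq> 0"
    then have "coeff (coeff f (Suc i)) j \<noteq> 0"
      by (auto simp: coeff_pderiv of_nat_poly simp del: of_nat_Suc)
    then show "i + j \<le> total_degree f - 1" using coeff_le_total_degree by fastforce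
  qed
  then show ?thesis using assms by linarith
qed

text \<open>A real zero of an irreducible univariate polynomial makes that polynomial linear.\<close>

lemma irreducible_degree_pos:
  assumes "irreducible f" "total_degree f \<ge> 2" "eval2 f Z = 0"
  shows "degree f > 0"
proof (rule ccontr)
  assume "\<not> degree f > 0"
  then obtain c where c: "f = [:c:]" by (auto elim: degree_eq_zeroE)
  obtain x y where "Z = (x, y)" by (cases Z)
  then have "poly c x = 0" using assms(3) by (simp add: c)
  then have "[:-x, 1:] dvd c" by (simp add: poly_eq_0_iff_dvd)
  then obtain e where e: "c = [:-x, 1:] * e" by (elim dvdE)
  have "irreducible c" using assms(1) by (simp add: c irreducible_const_poly_iff)
  then have "is_unit [:-x, 1:] \<or> is_unit e" using e irreducibleD by blast
  then have "is_unit e" by (auto simp: is_unit_iff_degree)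
  then have "degree e = 0" by (auto simp: is_unit_poly_iff)
  then have "degree c \<le> 1" unfolding e using degree_mult_le[of "[:-x, 1:]" e] by (simp del: mult_pCons_left)
  then have "total_degree f \<le> 1"
    by (intro total_degree_le) (auto simp: c coeff_pCons split: nat.splits dest: le_degree)
  then show False using assms(2) by simp
qed

lemma not_dvd_pderiv:
  assumes "total_degree f \<ge> 2" "degree f > 0"
  shows "\<not> f dvd pderiv f"
proof
  assume "f dvd pderiv f"
  moreover have "pderiv f \<noteq> 0" using assms(2) by (auto simp: pderiv_eq_0_iff)
  ultimately show False
    using dvd_total_degree_le total_degree_pderiv_less[of f] assms by fastforce
qed

lemma bideg_le_pderiv: "total_degree f > 0 \<Longrightarrow> bideg_le (total_degree f) (pderiv f)"
  using total_degree_pderiv_less[of f] bideg_le_total_degree[of "pderiv f"]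
  by (auto elim: bideg_le_mono)

section \<open>Intersection of the curve with lines\<close>

lemma line_poly_nonzero:
  assumes "irreducible f" "total_degree f \<ge> 2" "degree f > 0" "v \<noteq> 0"
  shows "line_poly f A v \<noteq> 0"
proof
  \<comment> \<open>Otherwise the curve contains a whole line. The equation \<open>L\<close> of that
    line has total degree at most 1, hence is not a multiple of \<open>f\<close>, and the Bezout
    bound makes the common zeros finite.\<close>
  assume *: "line_poly f A v = 0"
  define L where "L = [:[:snd v * (- fst A) + fst v * snd A, snd v:], [:- fst v:]:]"
  have L: "eval2 L (x, y) = snd v * (x - fst A) - fst v * (y - snd A)" for x y
    by (simp add: L_def eval2_def algebra_simps)
  have "L \<noteq> 0" using \<open>v \<noteq> 0\<close> by (auto simp: L_def prod_eq_iff)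
  have "total_degree L \<le> 1"
    by (intro total_degree_le) (auto simp: L_def coeff_pCons split: nat.splits)
  then have "\<not> f dvd L" using dvd_total_degree_le[of f L] assms \<open>L \<noteq> 0\<close> by linarith
  then have "finite {Z. eval2 f Z = 0 \<and> eval2 L Z = 0}"
    using bezout_bound[OF assms(1,3) bideg_le_total_degree bideg_le_total_degree[of L]] by blast
  moreover have "range (\<lambda>z. (fst A + z * fst v, snd A + z * snd v)) \<subseteq> {Z. eval2 f Z = 0 \<and> eval2 L Z = 0}"
    using poly_line_poly[of f A v] by (auto simp: * L)
  ultimately have "finite (range (\<lambda>z. (fst A + z * fst v, snd A + z * snd v)))"
    by (rule finite_subset[rotated])
  moreover have "inj (\<lambda>z. (fst A + z * fst v, snd A + z * snd v))"
    using \<open>v \<noteq> 0\<close> by (auto simp: inj_on_def prod_eq_iff)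
  ultimately show False
    using finite_imageD infinite_UNIV_char_0 by blast
qed

definition det2 :: "real \<times> real \<Rightarrow> real \<times> real \<Rightarrow> real" where
  "det2 u v = fst u * snd v - snd u * fst v"

lemma det2_eq_0D:
  assumes "det2 v u = 0" "v \<noteq> 0"
  obtains z where "u = z *\<^sub>R v"
proof (cases "fst v = 0")
  case True
  then have "snd v \<noteq> 0" using assms(2) by (auto simp: prod_eq_iff)
  then show ?thesis using assms(1) True
    by (intro that[of "snd u / snd v"]) (auto simp: det2_def prod_eq_iff field_simps)
next
  case False
  then show ?thesis using assms(1)
    by (intro that[of "fst u / fst v"]) (auto simp: det2_def prod_eq_iff field_simps)
qed

lemma line_bound:
  assumes "irreducible f" "total_degree f \<ge> 2" "degree f > 0" "v \<noteq> 0"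
  shows "finite {Z \<in> zero_locus f. det2 v (Z - A) = 0} \<and>
     card {Z \<in> zero_locus f. det2 v (Z - A) = 0} \<le> total_degree f"
proof -
  let ?R = "{z. poly (line_poly f A v) z = 0}"
  have nz: "line_poly f A v \<noteq> 0" by (rule line_poly_nonzero[OF assms])
  have R: "finite ?R" "card ?R \<le> total_degree f"
    using poly_roots_finite[OF nz] card_poly_roots_bound[OF nz] degree_line_poly[of f A v] by auto
  have "{Z \<in> zero_locus f. det2 v (Z - A) = 0} \<subseteq> (\<lambda>z. A + z *\<^sub>R v) ` ?R"
  proof clarify
    fix x y assume Z: "(x, y) \<in> zero_locus f" "det2 v ((x, y) - A) = 0"
    then obtain z where "(x, y) - A = z *\<^sub>R v" using det2_eq_0D assms(4) by blast
    then have "(x, y) = A + z *\<^sub>R v" by (simp add: algebra_simps)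
    moreover have "z \<in> ?R"
      using Z(1) unfolding calculation by (simp add: zero_locus_def poly_line_poly plus_prod_def)
    ultimately show "(x, y) \<in> (\<lambda>z. A + z *\<^sub>R v) ` ?R" by blast
  qed
  then show ?thesis
    using R by (meson card_image_le card_mono finite_imageI finite_subset order.trans)
qed

section \<open>Local parametrisation\<close>

lemma continuous_on_eval2 [continuous_intros]:
  "continuous_on S g \<Longrightarrow> continuous_on S (\<lambda>x. eval2 f (g x))"
proof -
  assume "continuous_on S g"
  moreover have "eval2 f Z = (\<Sum>i\<le>total_degree f. \<Sum>j\<le>total_degree f - i. coeff (coeff f i) j * fst Z ^ j * snd Z ^ i)" for Z
    by (cases Z) (simp add: eval2_triangle_sum)
  ultimately show ?thesis by (auto intro!: continuous_intros)
qed

lemma eval2_has_derivative_snd: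
  "((\<lambda>y. eval2 f (x, y)) has_real_derivative eval2 (pderiv f) (x, y)) (at y)"
proof -
  have "map_poly (\<lambda>c. poly c x) (pderiv f) = pderiv (map_poly (\<lambda>c. poly c x) f)"
    by (intro poly_eqI) (simp add: coeff_map_poly coeff_pderiv of_nat_poly)
  then show ?thesis
    unfolding poly_map_poly_eval[symmetric] by (simp add: poly_DERIV)
qed

text \<open>A continuous branch is what the connectedness arguments require. In a small box the zero
  set is compact; strict monotonicity in y makes its projection injective, the intermediate value
  theorem makes it surjective, and a continuous injection of a compact set has a continuous
  inverse.\<close>

lemma implicit_function_pos:
  fixes F F' :: "real \<times> real \<Rightarrow> real"
  assumes F: "continuous_on UNIV F" and F': "continuous_on UNIV F'"
    and deriv: "\<And>x y. ((\<lambda>y. F (x, y)) has_real_derivative F' (x, y)) (at y)"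
    and zero: "F (c, b) = 0" and pos: "F' (c, b) > 0"
  obtains \<delta> g where "\<delta> > 0" "continuous_on {c - \<delta>..c + \<delta>} g" "g c = b"
    "\<And>x. x \<in> {c - \<delta>..c + \<delta>} \<Longrightarrow> F (x, g x) = 0"
proof -
  have "open {Z. F' Z > 0}" using F' by (simp add: open_Collect_less)
  then obtain r where r: "r > 0" "ball (c, b) r \<subseteq> {Z. F' Z > 0}"
    using pos openE by blast
  \<comment> \<open>A box of half-width r / 3 lies in the ball: the distance is at most the sum of
    the coordinate differences, 2 r / 3.\<close>
  define \<epsilon> where "\<epsilon> = r / 3"
  have \<epsilon>: "\<epsilon> > 0" using r by (simp add: \<epsilon>_def)
  have F'pos: "F' (x, y) > 0" if "\<bar>x - c\<bar> \<le> \<epsilon>" "\<bar>y - b\<bar> \<le> \<epsilon>" for x y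
  proof -
    have "dist (c, b) (x, y) \<le> \<bar>x - c\<bar> + \<bar>y - b\<bar>"
      using sqrt_sum_squares_le_sum_abs[of "c - x" "b - y"] by (simp add: dist_Pair_Pair dist_real_def)
    also have "\<dots> < r" using that r(1) by (simp add: \<epsilon>_def)
    finally show ?thesis using r(2) by auto
  qed
  have mono: "F (x, y) < F (x, y')" if "\<bar>x - c\<bar> \<le> \<epsilon>" "b - \<epsilon> \<le> y" "y < y'" "y' \<le> b + \<epsilon>" for x y y'
    using that by (intro DERIV_pos_imp_increasing[of y y' "\<lambda>y. F (x, y)"])
      (auto intro!: exI[of _ "F' (x, _)"] deriv F'pos)
  have lo: "F (c, b - \<epsilon>) < 0" and hi: "F (c, b + \<epsilon>) > 0"
    using mono[of c "b - \<epsilon>" b] mono[of c b "b + \<epsilon>"] \<epsilon> zero by auto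
  have "open {x. F (x, b - \<epsilon>) < 0 \<and> F (x, b + \<epsilon>) > 0}"
    unfolding Collect_conj_eq using F
    by (intro open_Int open_Collect_less continuous_intros continuous_on_compose2[OF F]) auto
  then obtain \<delta>' where \<delta>': "\<delta>' > 0" "ball c \<delta>' \<subseteq> {x. F (x, b - \<epsilon>) < 0 \<and> F (x, b + \<epsilon>) > 0}"
    using lo hi by (auto elim: openE)
  define \<delta> where "\<delta> = min \<epsilon> (\<delta>' / 2)"
  have \<delta>: "\<delta> > 0" "\<delta> \<le> \<epsilon>" "\<delta> < \<delta>'" using \<epsilon> \<delta>' by (auto simp: \<delta>_def)
  define K where "K = {Z. F Z = 0} \<inter> ({c - \<delta>..c + \<delta>} \<times> {b - \<epsilon>..b + \<epsilon>})"
  have "compact K"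
    unfolding K_def using F
    by (intro closed_Int_compact compact_Times closed_Collect_eq) auto
  have inj: "inj_on fst K"
  proof (rule inj_onI)
    fix Z W assume ZW: "Z \<in> K" "W \<in> K" "fst Z = fst W"
    then have "\<bar>fst Z - c\<bar> \<le> \<epsilon>" using \<delta> by (auto simp: K_def abs_le_iff)
    then have "\<not> snd Z < snd W" "\<not> snd W < snd Z"
      using mono[of "fst Z" "snd Z" "snd W"] mono[of "fst W" "snd W" "snd Z"] ZW by (auto simp: K_def)
    then show "Z = W" using ZW by (auto simp: prod_eq_iff)
  qed
  have img: "fst ` K = {c - \<delta>..c + \<delta>}"
  proof (intro equalityI subsetI)
    fix x assume x: "x \<in> {c - \<delta>..c + \<delta>}"
    then have "x \<in> ball c \<delta>'" using \<delta> by (auto simp: dist_real_def)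
    then have "F (x, b - \<epsilon>) < 0" "F (x, b + \<epsilon>) > 0" using \<delta>' by auto
    moreover have "continuous_on {b - \<epsilon>..b + \<epsilon>} (\<lambda>y. F (x, y))"
      by (intro continuous_on_compose2[OF F] continuous_intros) auto
    ultimately obtain y where "b - \<epsilon> \<le> y" "y \<le> b + \<epsilon>" "F (x, y) = 0"
      using IVT'[of "\<lambda>y. F (x, y)" "b - \<epsilon>" 0 "b + \<epsilon>"] \<epsilon> by auto
    then have "(x, y) \<in> K" using x by (simp add: K_def)
    then show "x \<in> fst ` K" by force
  qed (auto simp: K_def)
  define g where "g = (\<lambda>x. snd (the_inv_into K fst x))"
  have "continuous_on (fst ` K) (the_inv_into K fst)"
    by (rule continuous_on_inv[OF _ \<open>compact K\<close>]) (auto intro!: continuous_intros the_inv_into_f_f inj)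
  then have "continuous_on {c - \<delta>..c + \<delta>} g"
    unfolding g_def img by (intro continuous_intros)
  moreover have gK: "(x, g x) \<in> K" if "x \<in> {c - \<delta>..c + \<delta>}" for x
  proof -
    have "x \<in> fst ` K" using that img by simp
    then have "fst (the_inv_into K fst x) = x" "the_inv_into K fst x \<in> K"
      using f_the_inv_into_f[OF inj] the_inv_into_into[OF inj] by auto
    then show ?thesis unfolding g_def by (metis prod.collapse)
  qed
  moreover have "(c, b) \<in> K" using zero \<epsilon> \<delta> by (simp add: K_def)
  then have "g c = b"
    using the_inv_into_f_f[OF inj, of "(c, b)"] by (simp add: g_def)
  ultimately show ?thesis using that \<delta>(1) by (auto simp: K_def)
qed

lemma eval2_implicit_function:
  assumes "eval2 f (c, b) = 0" "eval2 (pderiv f) (c, b) \<noteq> 0"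
  obtains \<delta> g where "\<delta> > 0" "continuous_on {c - \<delta>..c + \<delta>} g" "g c = b"
    "\<And>x. x \<in> {c - \<delta>..c + \<delta>} \<Longrightarrow> eval2 f (x, g x) = 0"
proof -
  define \<sigma> where "\<sigma> = sgn (eval2 (pderiv f) (c, b))"
  have "\<sigma> \<noteq> 0" "\<sigma> * eval2 (pderiv f) (c, b) > 0" using assms(2) by (auto simp: \<sigma>_def sgn_if)
  moreover have "((\<lambda>y. \<sigma> * eval2 f (x, y)) has_real_derivative \<sigma> * eval2 (pderiv f) (x, y)) (at y)" for x y
    by (intro DERIV_cmult eval2_has_derivative_snd)
  moreover have "continuous_on UNIV (\<lambda>Z. \<sigma> * eval2 h Z)" for h by (intro continuous_intros)
  moreover have "\<sigma> * eval2 f (c, b) = 0" using assms(1) by simp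
  ultimately obtain \<delta> g where "\<delta> > 0" "continuous_on {c - \<delta>..c + \<delta>} g" "g c = b"
      "\<And>x. x \<in> {c - \<delta>..c + \<delta>} \<Longrightarrow> \<sigma> * eval2 f (x, g x) = 0"
    using implicit_function_pos[of "\<lambda>Z. \<sigma> * eval2 f Z" "\<lambda>Z. \<sigma> * eval2 (pderiv f) Z" c b] by metis
  then show ?thesis using that \<open>\<sigma> \<noteq> 0\<close> by auto
qed

text \<open>A form of Cauchy's root bound. It depends continuously on the coefficients while the
  leading one is nonzero, which makes the bound uniform over a compact interval.\<close>

lemma abs_root_le:
  fixes p :: "real poly"
  assumes "poly p y = 0" "degree p = n" "p \<noteq> 0"
  shows "\<bar>y\<bar> \<le> 1 + (\<Sum>i<n. \<bar>coeff p i\<bar>) / \<bar>coeff p n\<bar>"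
proof (cases "\<bar>y\<bar> \<le> 1")
  case True
  moreover have "(\<Sum>i<n. \<bar>coeff p i\<bar>) / \<bar>coeff p n\<bar> \<ge> 0" by (simp add: sum_nonneg)
  ultimately show ?thesis by linarith
next
  case False
  have nz: "coeff p n \<noteq> 0" using assms by auto
  have "n > 0" using assms nz by (cases n) (auto elim!: degree_eq_zeroE)
  then obtain m where m: "n = Suc m" using gr0_implies_Suc by blast
  have "poly p y = (\<Sum>i<n. coeff p i * y ^ i) + coeff p n * y ^ n"
    using assms(2) by (simp add: poly_altdef lessThan_Suc_atMost[symmetric])
  then have eq: "coeff p n * y ^ n = - (\<Sum>i<n. coeff p i * y ^ i)" using assms(1) by linarith
  have "\<bar>coeff p n\<bar> * \<bar>y\<bar> ^ n = \<bar>coeff p n * y ^ n\<bar>" by (simp add: abs_mult power_abs)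
  also have "\<dots> = \<bar>\<Sum>i<n. coeff p i * y ^ i\<bar>" unfolding eq by simp
  also have "\<dots> \<le> (\<Sum>i<n. \<bar>coeff p i * y ^ i\<bar>)" by (rule sum_abs)
  also have "\<dots> \<le> (\<Sum>i<n. \<bar>coeff p i\<bar> * \<bar>y\<bar> ^ m)"
    using False m by (intro sum_mono) (auto simp: abs_mult power_abs intro!: mult_left_mono power_increasing)
  also have "\<dots> = (\<Sum>i<n. \<bar>coeff p i\<bar>) * \<bar>y\<bar> ^ m" by (simp add: sum_distrib_right)
  finally have "(\<bar>coeff p n\<bar> * \<bar>y\<bar>) * \<bar>y\<bar> ^ m \<le> (\<Sum>i<n. \<bar>coeff p i\<bar>) * \<bar>y\<bar> ^ m"
    by (simp add: m mult.assoc)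
  then have "\<bar>coeff p n\<bar> * \<bar>y\<bar> \<le> (\<Sum>i<n. \<bar>coeff p i\<bar>)"
    by (rule mult_right_le_imp_le) (use False in simp)
  then show ?thesis using nz by (simp add: field_simps)
qed

text \<open>Without zeros of the leading coefficient there are no vertical asymptotes: the root
  bound \<open>B\<close> is continuous on the interval, so the ordinates stay bounded.\<close>

lemma compact_curve_over_interval:
  assumes "\<And>x. x \<in> {\<alpha>..\<beta>} \<Longrightarrow> poly (lead_coeff f) x \<noteq> 0"
  shows "compact {Z. eval2 f Z = 0 \<and> fst Z \<in> {\<alpha>..\<beta>}}"
proof -
  define B where "B = (\<lambda>x. 1 + (\<Sum>i<degree f. \<bar>poly (coeff f i) x\<bar>) / \<bar>poly (lead_coeff f) x\<bar>)"
  have "continuous_on {\<alpha>..\<beta>} B"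
    unfolding B_def by (intro continuous_intros) (use assms in auto)
  then have "compact (B ` {\<alpha>..\<beta>})" by (intro compact_continuous_image) auto
  then have "bdd_above (B ` {\<alpha>..\<beta>})" by (intro bounded_imp_bdd_above compact_imp_bounded)
  then obtain M where M: "\<And>x. x \<in> {\<alpha>..\<beta>} \<Longrightarrow> B x \<le> M"
    unfolding bdd_above_def by blast
  have "{Z. eval2 f Z = 0 \<and> fst Z \<in> {\<alpha>..\<beta>}} = {Z. eval2 f Z = 0} \<inter> ({\<alpha>..\<beta>} \<times> {-M..M})"
  proof -
    have "\<bar>y\<bar> \<le> M" if "eval2 f (x, y) = 0" "x \<in> {\<alpha>..\<beta>}" for x y
    proof -
      let ?p = "map_poly (\<lambda>c. poly c x) f"
      have lc: "coeff ?p (degree f) \<noteq> 0" using assms[OF that(2)] by (simp add: coeff_map_poly)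
      then have "degree ?p = degree f" using map_poly_degree_leq[of "\<lambda>c. poly c x" f] le_degree by fastforce
      moreover have "?p \<noteq> 0" using lc by auto
      ultimately have "\<bar>y\<bar> \<le> B x"
        using abs_root_le[of ?p y "degree f"] that(1) unfolding B_def
        by (simp add: poly_map_poly_eval coeff_map_poly)
      then show ?thesis using M[OF that(2)] by simp
    qed
    then have "Z \<in> {-M..M}" if "eval2 f (x, Z) = 0" "x \<in> {\<alpha>..\<beta>}" for x Z
      using that by (fastforce simp: abs_le_iff)
    then show ?thesis by (intro set_eqI) (simp add: mem_Times_iff split: prod.split, metis prod.collapse)
  qed
  moreover have "closed {Z. eval2 f Z = 0}"
    by (intro closed_Collect_eq continuous_intros)
  ultimately show ?thesis by (simp add: closed_Int_compact compact_Times)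
qed

text \<open>The projection of the component is closed by compactness, and open in the interval
  because the implicit function continues the curve past every point; a nonempty clopen subset of an
  interval is everything.\<close>

lemma component_over_interval:
  assumes noncrit: "\<And>x. x \<in> {\<alpha>..\<beta>} \<Longrightarrow> poly (lead_coeff f) x \<noteq> 0"
      "\<And>x y. x \<in> {\<alpha>..\<beta>} \<Longrightarrow> eval2 f (x, y) = 0 \<Longrightarrow> eval2 (pderiv f) (x, y) \<noteq> 0"
    and K: "K = {Z. eval2 f Z = 0 \<and> fst Z \<in> {\<alpha>..\<beta>}}" and "p \<in> K"
  shows "fst ` connected_component_set K p = {\<alpha>..\<beta>}"
proof -
  define C where "C = connected_component_set K p"
  have "compact K" unfolding K using noncrit(1) by (rule compact_curve_over_interval)
  then have "compact C"
  proof -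
    have "C = K \<inter> C" using connected_component_subset[of K p] by (auto simp: C_def)
    moreover have "closed C"
      unfolding C_def by (rule closed_connected_component[OF compact_imp_closed[OF \<open>compact K\<close>]])
    ultimately show "compact C" using compact_Int_closed[OF \<open>compact K\<close>] by metis
  qed
  then have "compact (fst ` C)" by (intro compact_continuous_image continuous_on_fst continuous_on_id)
  have CK: "C \<subseteq> K" "p \<in> C" unfolding C_def
    by (rule connected_component_subset) (simp add: \<open>p \<in> K\<close> connected_component_refl)
  have sub: "fst ` C \<subseteq> {\<alpha>..\<beta>}" using CK(1) unfolding K by blast
  have "\<exists>\<delta>>0. \<forall>x\<in>{\<alpha>..\<beta>}. dist x c < \<delta> \<longrightarrow> x \<in> fst ` C" if "c \<in> fst ` C" for c
  proof -
    from that obtain Z where "Z \<in> C" "c = fst Z" by (rule imageE)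
    then obtain b where b: "(c, b) \<in> C" by (cases Z) simp
    then have "(c, b) \<in> K" using CK(1) by blast
    then have cb: "eval2 f (c, b) = 0" "c \<in> {\<alpha>..\<beta>}" unfolding K by simp_all
    obtain \<delta> g where g: "\<delta> > 0" "continuous_on {c - \<delta>..c + \<delta>} g" "g c = b"
        "\<And>x. x \<in> {c - \<delta>..c + \<delta>} \<Longrightarrow> eval2 f (x, g x) = 0"
      by (rule eval2_implicit_function[OF cb(1) noncrit(2)[OF cb(2) cb(1)]], rule that)
    define I where "I = {c - \<delta>..c + \<delta>} \<inter> {\<alpha>..\<beta>}"
    define G where "G = (\<lambda>x. (x, g x)) ` I"
    have "connected I" unfolding I_def Int_atLeastAtMost by (rule connected_Icc)
    moreover have "continuous_on I g" by (rule continuous_on_subset[OF g(2)]) (auto simp: I_def)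
    ultimately have "connected G"
      unfolding G_def by (intro connected_continuous_image continuous_on_Pair continuous_on_id)
    moreover have "G \<subseteq> K"
      unfolding G_def K using g(4) by (simp add: image_subset_iff I_def)
    moreover have "c \<in> I" using g(1) cb(2) by (simp add: I_def)
    then have "(c, b) \<in> G" unfolding G_def using g(3) by (intro image_eqI[of _ _ c]) simp_all
    ultimately have "G \<subseteq> connected_component_set K (c, b)" by (simp add: connected_component_maximal)
    also have "\<dots> = C" using b connected_component_eq[of "(c, b)" K p] by (simp add: C_def)
    finally have "G \<subseteq> C" .
    have "x \<in> fst ` C" if "x \<in> {\<alpha>..\<beta>}" "dist x c < \<delta>" for x
    proof -
      have "x \<in> I" using that by (auto simp: I_def dist_real_def)
      then have "(x, g x) \<in> C" using \<open>G \<subseteq> C\<close> by (auto simp: G_def)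
      then show ?thesis by (metis fst_conv imageI)
    qed
    then show ?thesis using g(1) by blast
  qed
  then have "openin (top_of_set {\<alpha>..\<beta>}) (fst ` C)" using sub by (auto simp: openin_euclidean_subtopology_iff)
  moreover have "closedin (top_of_set {\<alpha>..\<beta>}) (fst ` C)"
    using \<open>compact (fst ` C)\<close> sub by (simp add: closed_subset compact_imp_closed)
  moreover have "fst ` C \<noteq> {}" using CK by blast
  ultimately show ?thesis
    using connected_Icc[of \<alpha> \<beta>, unfolded connected_clopen, rule_format, of "fst ` C"]
    unfolding C_def[symmetric] by blast
qed

section \<open>Decomposition into connected blocks\<close>

text \<open>One representative for each gap that \<open>S\<close> leaves on the real line: a point
  left of all of \<open>S\<close>, and a point close behind each element of
  \<open>S\<close>.\<close>

lemma finite_gap_representatives: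
  fixes S :: "real set"
  assumes "finite S"
  obtains T where "finite T" "card T \<le> card S + 1"
    "\<And>x. x \<notin> S \<Longrightarrow> \<exists>t\<in>T. S \<inter> {min x t..max x t} = {}"
proof -
  have "\<exists>t>s. S \<inter> {s<..t} = {}" for s
  proof (cases "S \<inter> {s<..} = {}")
    case True
    then show ?thesis by (intro exI[of _ "s + 1"]) auto
  next
    case False
    define m where "m = Min (S \<inter> {s<..})"
    have "m \<in> S \<inter> {s<..}" unfolding m_def using False assms by (intro Min_in) auto
    then obtain t where t: "s < t" "t < m" using dense[of s m] by auto
    have "S \<inter> {s<..t} = {}"
    proof (rule ccontr)
      assume "S \<inter> {s<..t} \<noteq> {}"
      then obtain u where "u \<in> S" "s < u" "u \<le> t" by auto
      then have "m \<le> u" unfolding m_def using assms by (intro Min_le) auto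
      then show False using t \<open>u \<le> t\<close> by simp
    qed
    then show ?thesis using t by blast
  qed
  then obtain t where t: "\<And>s. t s > s" "\<And>s. S \<inter> {s<..t s} = {}" by metis
  obtain b' where "\<And>s. s \<in> S \<Longrightarrow> b' \<le> s"
    using bdd_below_finite[OF assms] unfolding bdd_below_def by blast
  then have b: "b' - 1 < s" if "s \<in> S" for s using that by fastforce
  define b where "b = b' - 1"
  define T where "T = insert b (t ` S)"
  have "finite T" using assms by (simp add: T_def)
  moreover have "card T \<le> card S + 1"
    unfolding T_def using card_image_le[OF assms, of t] assms by (simp add: card_insert_if)
  moreover have "\<exists>t\<in>T. S \<inter> {min x t..max x t} = {}" if "x \<notin> S" for x
  proof (cases "S \<inter> {..<x} = {}")
    case True
    have "u \<notin> {min x b..max x b}" if "u \<in> S" for u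
    proof -
      have "x < u" using True that \<open>x \<notin> S\<close> by (cases x u rule: linorder_cases) auto
      then show ?thesis using b[OF that] by (auto simp: b_def)
    qed
    then have "S \<inter> {min x b..max x b} = {}" by blast
    then show ?thesis by (auto simp: T_def)
  next
    case False
    define s where "s = Max (S \<inter> {..<x})"
    have s: "s \<in> S" "s < x" using Max_in[of "S \<inter> {..<x}"] False assms by (auto simp: s_def)
    have "S \<inter> {s<..x} = {}"
    proof (rule ccontr)
      assume "S \<inter> {s<..x} \<noteq> {}"
      then obtain u where "u \<in> S" "s < u" "u \<le> x" by auto
      moreover from this that have "u < x" by (cases "u = x") auto
      ultimately have "u \<le> s" unfolding s_def using assms by (intro Max_ge) auto
      then show False using \<open>s < u\<close> by simp
    qed
    then have "S \<inter> {min x (t s)..max x (t s)} = {}"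
      using s(2) t[of s] by (auto simp: disjoint_iff min_le_iff_disj le_max_iff_disj)
    then show ?thesis using s(1) by (auto simp: T_def)
  qed
  ultimately show ?thesis using that by blast
qed

text \<open>Marking every \<open>k\<close>-th point from the left leaves fewer than \<open>k\<close>
  points between consecutive marks.\<close>

lemma separating_subset:
  fixes V :: "real set"
  assumes "finite V" "k > 0"
  obtains S where "S \<subseteq> V" "card S * k \<le> card V"
    "\<And>J. is_interval J \<Longrightarrow> J \<inter> S = {} \<Longrightarrow> card (V \<inter> J) < k"
proof -
  \<comment> \<open>The middle conjuncts keep track of the points after the last mark. When a new
    maximum is added, an interval that contains it and avoids \<open>S\<close> can contain only
    these besides the maximum itself.\<close>
  have "\<exists>S\<subseteq>V. card S * k + card {v\<in>V. \<forall>s\<in>S. s < v} \<le> card V \<and> card {v\<in>V. \<forall>s\<in>S. s < v} < k \<and>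
     (\<forall>J. is_interval J \<longrightarrow> J \<inter> S = {} \<longrightarrow> card (V \<inter> J) < k)"
    using assms(1)
  proof (induction V rule: finite_linorder_max_induct)
    case empty
    then show ?case using assms(2) by simp
  next
    case (insert b A)
    from insert.IH obtain S where S: "S \<subseteq> A" and
        1: "card S * k + card {v\<in>A. \<forall>s\<in>S. s < v} \<le> card A" and 2: "card {v\<in>A. \<forall>s\<in>S. s < v} < k" and
        3: "\<And>J. is_interval J \<Longrightarrow> J \<inter> S = {} \<Longrightarrow> card (A \<inter> J) < k"
      by (elim exE conjE) blast
    let ?t = "{v\<in>A. \<forall>s\<in>S. s < v}"
    have fin: "finite ?t" "finite S" using insert.hyps(1) S finite_subset by auto
    have bA: "b \<notin> A" using insert.hyps(2) by blast
    have t': "{v\<in>insert b A. \<forall>s\<in>S. s < v} = insert b ?t" using insert.hyps(2) S by auto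
    have Jt: "insert b A \<inter> J \<subseteq> insert b ?t" if J: "is_interval J" "J \<inter> S = {}" "b \<in> J" for J
    proof
      fix v assume v: "v \<in> insert b A \<inter> J"
      have "s < v" if "s \<in> S" for s
      proof (rule ccontr)
        assume "\<not> s < v"
        moreover have "s < b" using insert.hyps(2) S that by blast
        ultimately have "s \<in> J"
          using J(1)[unfolded is_interval_1, rule_format, of v b s] J(3) v by auto
        then show False using J(2) that by blast
      qed
      then show "v \<in> insert b ?t" using v by auto
    qed
    have Jnot: "card (insert b A \<inter> J) < k" if "is_interval J" "J \<inter> S = {}" "b \<notin> J" for J
      using 3[OF that(1,2)] that(3) by simp
    show ?case
    proof (cases "card ?t + 1 < k")
      case True
      have "card (insert b A \<inter> J) < k" if "is_interval J" "J \<inter> S = {}" for J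
      proof (cases "b \<in> J")
        case True
        have "card (insert b A \<inter> J) \<le> card (insert b ?t)"
          using Jt[OF that True] fin(1) by (intro card_mono) auto
        also have "\<dots> < k" using \<open>card ?t + 1 < k\<close> fin bA by simp
        finally show ?thesis .
      qed (rule Jnot[OF that])
      moreover have "card S * k + card (insert b ?t) \<le> card (insert b A)" "card (insert b ?t) < k"
        using 1 True fin bA insert.hyps(1) by auto
      moreover have "S \<subseteq> insert b A" using S by blast
      ultimately show ?thesis
        by (intro exI[of _ S] conjI allI impI) (simp_all only: t')
    next
      case False
      then have k: "k = card ?t + 1" using 2 by linarith
      have bS: "b \<notin> S" using S bA by blast
      have t0: "{v\<in>insert b A. \<forall>s\<in>insert b S. s < v} = {}" using insert.hyps(2) by fastforce
      have "card (insert b S) * k + 0 \<le> card (insert b A)"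
        using 1 k bS bA fin insert.hyps(1) by simp
      moreover have "card (insert b A \<inter> J) < k" if "is_interval J" "J \<inter> insert b S = {}" for J
        using that Jnot[of J] by blast
      moreover have "insert b S \<subseteq> insert b A" using S by blast
      ultimately show ?thesis
        using assms(2) by (intro exI[of _ "insert b S"] conjI allI impI) (simp_all only: t0 card.empty)
    qed
  qed
  then obtain S where "S \<subseteq> V" "card S * k + card {v\<in>V. \<forall>s\<in>S. s < v} \<le> card V"
     "\<And>J. is_interval J \<Longrightarrow> J \<inter> S = {} \<Longrightarrow> card (V \<inter> J) < k" by blast
  then show ?thesis using that[of S] by simp
qed


lemma vertical_fibres_bound:
  assumes "irreducible f" "total_degree f \<ge> 2" "degree f > 0" "finite W"
  shows "finite {Z \<in> zero_locus f. fst Z \<in> W}" "card {Z \<in> zero_locus f. fst Z \<in> W} \<le> total_degree f * card W"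
proof -
  let ?L = "\<lambda>x. {Z \<in> zero_locus f. det2 (0, 1) (Z - (x, 0)) = 0}"
  have L: "finite (?L x)" "card (?L x) \<le> total_degree f" for x
    using line_bound[OF assms(1-3), of "(0, 1)" "(x, 0)"] by (simp_all add: zero_prod_def)
  have eq: "{Z \<in> zero_locus f. fst Z \<in> W} = (\<Union>x\<in>W. ?L x)"
    by (auto simp: det2_def)
  show "finite {Z \<in> zero_locus f. fst Z \<in> W}" unfolding eq using L assms(4) by blast
  have "card (\<Union>x\<in>W. ?L x) \<le> (\<Sum>x\<in>W. card (?L x))" by (rule card_UN_le[OF assms(4)])
  also have "\<dots> \<le> card W * total_degree f" using L sum_bounded_above[of W "\<lambda>x. card (?L x)" "total_degree f"] by simp
  finally show "card {Z \<in> zero_locus f. fst Z \<in> W} \<le> total_degree f * card W"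
    unfolding eq by (simp add: mult.commute)
qed

text \<open>Over a gap free of critical abscissas a component projects onto everything between one
  of its points and the representative \<open>t\<close> of the gap, so it contains a zero over
  \<open>t\<close>. Distinct components are disjoint, and there are at most
  \<open>card S + 1\<close> representatives with at most \<open>total_degree f\<close> zeros over
  each.\<close>

lemma card_components_off_vertical_lines:
  assumes f: "irreducible f" "total_degree f \<ge> 2" "degree f > 0" and S: "finite S"
    and noncrit: "\<And>x. x \<notin> S \<Longrightarrow> poly (lead_coeff f) x \<noteq> 0"
      "\<And>x y. x \<notin> S \<Longrightarrow> eval2 f (x, y) = 0 \<Longrightarrow> eval2 (pderiv f) (x, y) \<noteq> 0"
  defines "CC \<equiv> components {Z \<in> zero_locus f. fst Z \<notin> S}"
  shows "finite CC" "card CC \<le> total_degree f * (card S + 1)"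
proof -
  obtain T where T: "finite T" "card T \<le> card S + 1"
    "\<And>x. x \<notin> S \<Longrightarrow> \<exists>t\<in>T. S \<inter> {min x t..max x t} = {}"
    using finite_gap_representatives[OF S] by blast
  let ?P = "{Z \<in> zero_locus f. fst Z \<in> T}"
  have P: "finite ?P" "card ?P \<le> total_degree f * card T"
    using vertical_fibres_bound[OF f T(1)] by auto
  have "\<exists>Z. Z \<in> C \<inter> ?P" if C: "C \<in> CC" for C
  proof -
    obtain p where p: "p \<in> C" using C in_components_nonempty unfolding CC_def by blast
    have sub: "C \<subseteq> {Z \<in> zero_locus f. fst Z \<notin> S}" using C in_components_subset unfolding CC_def by blast
    then have "fst p \<notin> S" "eval2 f p = 0" using p by (auto simp: zero_locus_def)
    then obtain t where t: "t \<in> T" "S \<inter> {min (fst p) t..max (fst p) t} = {}" using T(3) by blast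
    define K where "K = {Z. eval2 f Z = 0 \<and> fst Z \<in> {min (fst p) t..max (fst p) t}}"
    have pK: "p \<in> K" using \<open>eval2 f p = 0\<close> by (simp add: K_def)
    have img: "fst ` connected_component_set K p = {min (fst p) t..max (fst p) t}"
      by (rule component_over_interval[OF _ _ K_def pK]) (use noncrit t(2) in blast)+
    have "connected_component_set K p \<subseteq> C"
    proof (rule components_maximal)
      show "C \<in> components {Z \<in> zero_locus f. fst Z \<notin> S}" using C by (simp add: CC_def)
      show "connected (connected_component_set K p)" by simp
      have "K \<subseteq> {Z \<in> zero_locus f. fst Z \<notin> S}" using t(2) by (auto simp: K_def zero_locus_def)
      then show "connected_component_set K p \<subseteq> {Z \<in> zero_locus f. fst Z \<notin> S}"
        by (rule order.trans[OF connected_component_subset])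
      have "p \<in> connected_component_set K p" using pK by (simp add: connected_component_refl)
      then show "C \<inter> connected_component_set K p \<noteq> {}" using p by blast
    qed
    moreover have "t \<in> fst ` connected_component_set K p" unfolding img by simp
    then obtain Z where "Z \<in> connected_component_set K p" "fst Z = t" by (rule imageE) simp
    ultimately show ?thesis using sub t(1) by blast
  qed
  then obtain z where z: "\<And>C. C \<in> CC \<Longrightarrow> z C \<in> C \<inter> ?P" by metis
  have inj: "inj_on z CC"
  proof (rule inj_onI)
    fix C D assume CD: "C \<in> CC" "D \<in> CC" "z C = z D"
    then have "z C \<in> C \<inter> D" using z[of C] z[of D] by simp
    then show "C = D" using CD components_nonoverlap unfolding CC_def by blast
  qed
  have zP: "z ` CC \<subseteq> ?P" using z by blast
  show "finite CC" using inj zP P(1) finite_imageD finite_subset by blast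
  have "card CC \<le> card ?P" using inj zP P(1) by (rule card_inj_on_le)
  also have "\<dots> \<le> total_degree f * (card S + 1)"
    using P(2) T(2) by (meson le_trans mult_le_mono2)
  finally show "card CC \<le> total_degree f * (card S + 1)" .
qed

text \<open>The vertical lines over the critical abscissas \<open>X\<close> and over the separators
  \<open>S\<close> are removed. \<open>X\<close> comes from at most d zeros of the leading
  coefficient and d (2 d)^2 = 4 d^3 common zeros of \<open>f\<close> and its Y-derivative, and each
  removed line costs at most \<open>d\<close> points of \<open>H\<close>. The blocks are the
  components of what is left; each lies over an interval without separators.\<close>

lemma block_decomposition:
  assumes f: "irreducible f" "total_degree f = d" "d \<ge> 2" "degree f > 0"
    and H: "finite H" "H \<subseteq> zero_locus f" and "r > 0"
  obtains H' \<C> where "H' \<subseteq> H" "card H \<le> card H' + d * (d + 4 * d ^ 3 + r)"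
    "\<And>p. p \<in> H' \<Longrightarrow> eval2 (pderiv f) p \<noteq> 0"
    "finite \<C>" "disjoint \<C>" "\<And>C. C \<in> \<C> \<Longrightarrow> connected C" "\<Union>\<C> \<subseteq> zero_locus f" "H' \<subseteq> \<Union>\<C>"
    "card \<C> \<le> d * (d + 4 * d ^ 3 + r + 1)" "\<And>C. C \<in> \<C> \<Longrightarrow> card (C \<inter> H') \<le> d * (card H div r)"
proof -
  note f' = f(1) f(3)[folded f(2)] f(4)
  define X where "X = {x. poly (lead_coeff f) x = 0} \<union> fst ` {Z. eval2 f Z = 0 \<and> eval2 (pderiv f) Z = 0}"
  have X: "finite X" "card X \<le> d + 4 * d ^ 3"
  proof -
    have nz: "lead_coeff f \<noteq> 0" using f(4) by auto
    have "degree (lead_coeff f) \<le> d"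
      using bideg_le_total_degree[of f] f(2) by (simp add: bideg_le_def)
    then have 1: "finite {x. poly (lead_coeff f) x = 0}" "card {x. poly (lead_coeff f) x = 0} \<le> d"
      using poly_roots_finite[OF nz] card_poly_roots_bound[OF nz] by linarith+
    have "finite {Z. eval2 f Z = 0 \<and> eval2 (pderiv f) Z = 0} \<and> card {Z. eval2 f Z = 0 \<and> eval2 (pderiv f) Z = 0} \<le> d * (d + d)^2"
      unfolding f(2)[symmetric]
      by (rule bezout_bound[OF f(1,4) bideg_le_total_degree bideg_le_pderiv not_dvd_pderiv[OF f'(2) f(4)]])
        (use f in simp)
    then have 2: "finite (fst ` {Z. eval2 f Z = 0 \<and> eval2 (pderiv f) Z = 0})"
       "card (fst ` {Z. eval2 f Z = 0 \<and> eval2 (pderiv f) Z = 0}) \<le> 4 * d ^ 3"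
      using card_image_le[of "{Z. eval2 f Z = 0 \<and> eval2 (pderiv f) Z = 0}" fst]
      by (auto simp: power2_eq_square power3_eq_cube algebra_simps)
    show "finite X" using 1 2 by (simp add: X_def)
    show "card X \<le> d + 4 * d ^ 3"
      unfolding X_def by (rule order.trans[OF card_Un_le add_mono[OF 1(2) 2(2)]])
  qed
  \<comment> \<open>\<open>k\<close> exceeds card H / r, so there are at most \<open>r\<close>
    separators; the fewer than \<open>k\<close> abscissas of \<open>H\<close> below a block number
    at most \<open>card H div r\<close>, with at most \<open>d\<close> points each.\<close>
  define k where "k = card H div r + 1"
  obtain S where S: "S \<subseteq> fst ` H" "card S * k \<le> card (fst ` H)"
      "\<And>J. is_interval J \<Longrightarrow> J \<inter> S = {} \<Longrightarrow> card (fst ` H \<inter> J) < k"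
    using separating_subset[of "fst ` H" k] H(1) by (auto simp: k_def)
  have finS: "finite S" using S(1) H(1) finite_subset by blast
  have cardS: "card S \<le> r"
  proof (rule ccontr)
    assume "\<not> card S \<le> r"
    then have "r * k \<le> card S * k" by simp
    also have "\<dots> \<le> card H" using S(2) card_image_le[OF H(1), of fst] by linarith
    finally show False
      using dividend_less_times_div[OF \<open>r > 0\<close>, of "card H"] unfolding k_def distrib_left by linarith
  qed
  define SX where "SX = X \<union> S"
  have SX: "finite SX" "card SX \<le> d + 4 * d ^ 3 + r"
    unfolding SX_def using X finS cardS card_Un_le[of X S] by (blast, linarith)
  define \<C> where "\<C> = components {Z \<in> zero_locus f. fst Z \<notin> SX}"
  define H' where "H' = {p \<in> H. fst p \<notin> SX}"
  show ?thesis
  proof (rule that[of H' \<C>])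
    show "H' \<subseteq> H" unfolding H'_def by blast
    have "card H \<le> card (H' \<union> {Z \<in> zero_locus f. fst Z \<in> SX})"
    proof (rule card_mono)
      show "finite (H' \<union> {Z \<in> zero_locus f. fst Z \<in> SX})"
        using H(1) vertical_fibres_bound(1)[OF f' SX(1)] by (simp add: H'_def)
      show "H \<subseteq> H' \<union> {Z \<in> zero_locus f. fst Z \<in> SX}" using H(2) unfolding H'_def by blast
    qed
    also have "\<dots> \<le> card H' + card {Z \<in> zero_locus f. fst Z \<in> SX}" by (rule card_Un_le)
    also have "card {Z \<in> zero_locus f. fst Z \<in> SX} \<le> d * card SX"
      using vertical_fibres_bound(2)[OF f' SX(1)] f(2) by simp
    also have "\<dots> \<le> d * (d + 4 * d ^ 3 + r)" using SX(2) by (rule mult_le_mono2)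
    finally show "card H \<le> card H' + d * (d + 4 * d ^ 3 + r)" by simp
    show "eval2 (pderiv f) p \<noteq> 0" if "p \<in> H'" for p
    proof
      assume "eval2 (pderiv f) p = 0"
      moreover have "p \<in> zero_locus f" using that H(2) unfolding H'_def by blast
      then have "eval2 f p = 0" by (simp add: zero_locus_def)
      ultimately have "p \<in> {Z. eval2 f Z = 0 \<and> eval2 (pderiv f) Z = 0}" by simp
      then have "fst p \<in> X" unfolding X_def by (intro UnI2 imageI)
      then show False using that by (simp add: H'_def SX_def)
    qed
    have noncrit: "poly (lead_coeff f) x \<noteq> 0" if "x \<notin> SX" for x
      using that unfolding SX_def X_def Un_iff mem_Collect_eq by blast
    have noncrit': "eval2 (pderiv f) (x, y) \<noteq> 0" if "x \<notin> SX" "eval2 f (x, y) = 0" for x y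
    proof
      assume "eval2 (pderiv f) (x, y) = 0"
      then have "(x, y) \<in> {Z. eval2 f Z = 0 \<and> eval2 (pderiv f) Z = 0}" using that(2) by simp
      then have "fst (x, y) \<in> X" unfolding X_def by (intro UnI2 imageI)
      then show False using that(1) by (simp add: SX_def)
    qed
    show "finite \<C>"
      unfolding \<C>_def by (rule card_components_off_vertical_lines(1)[OF f' SX(1)]) (fact noncrit noncrit')+
    have "card \<C> \<le> d * (card SX + 1)"
      unfolding \<C>_def f(2)[symmetric]
      by (rule card_components_off_vertical_lines(2)[OF f' SX(1)]) (fact noncrit noncrit')+
    also have "\<dots> \<le> d * (d + 4 * d ^ 3 + r + 1)" using SX(2) by (intro mult_le_mono2) simp
    finally show "card \<C> \<le> d * (d + 4 * d ^ 3 + r + 1)" .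
    show "disjoint \<C>" unfolding \<C>_def disjoint_def using components_nonoverlap by blast
    show "connected C" if "C \<in> \<C>" for C using that in_components_connected unfolding \<C>_def by blast
    have Un: "\<Union>\<C> = {Z \<in> zero_locus f. fst Z \<notin> SX}" unfolding \<C>_def by (rule Union_components)
    then show "\<Union>\<C> \<subseteq> zero_locus f" by blast
    show "H' \<subseteq> \<Union>\<C>" unfolding Un using H(2) by (auto simp: H'_def)
    show "card (C \<inter> H') \<le> d * (card H div r)" if "C \<in> \<C>" for C
    proof -
      have "C \<subseteq> {Z \<in> zero_locus f. fst Z \<notin> SX}" using that Un by blast
      then have avoid: "fst ` C \<inter> S = {}" by (auto simp: SX_def)
      have "connected (fst ` C)"
        using that in_components_connected unfolding \<C>_def
        by (intro connected_continuous_image continuous_on_fst continuous_on_id) blast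
      then have "is_interval (fst ` C)" by (simp add: is_interval_connected_1)
      then have less: "card (fst ` H \<inter> fst ` C) < k" using S(3) avoid by blast
      have "C \<inter> H' \<subseteq> {Z \<in> zero_locus f. fst Z \<in> fst ` H \<inter> fst ` C}"
        using H(2) by (auto simp: H'_def)
      then have "card (C \<inter> H') \<le> card {Z \<in> zero_locus f. fst Z \<in> fst ` H \<inter> fst ` C}"
        using vertical_fibres_bound(1)[OF f', of "fst ` H \<inter> fst ` C"] H(1) by (intro card_mono) auto
      also have "\<dots> \<le> d * card (fst ` H \<inter> fst ` C)"
        using vertical_fibres_bound(2)[OF f', of "fst ` H \<inter> fst ` C"] H(1) f(2) by auto
      also have "\<dots> \<le> d * (card H div r)" using less by (intro mult_le_mono2) (simp add: k_def)
      finally show ?thesis .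
    qed
  qed
qed

section \<open>The pullback polynomial\<close>

text \<open>Working with functions lets polynomials be substituted pointwise; a representing
  polynomial is taken only when the Bezout bound is applied.\<close>

definition polyfun :: "nat \<Rightarrow> (real \<times> real \<Rightarrow> real) \<Rightarrow> bool" where
  "polyfun e F \<longleftrightarrow> (\<exists>g. bideg_le e g \<and> (\<forall>Z. eval2 g Z = F Z))"

lemma polyfun_mono: "polyfun e F \<Longrightarrow> e \<le> e' \<Longrightarrow> polyfun e' F"
  unfolding polyfun_def using bideg_le_mono by blast

lemma polyfun_const: "polyfun 0 (\<lambda>_. c)"
  unfolding polyfun_def by (intro exI[of _ "[:[:c:]:]"]) (auto simp: bideg_le_def coeff_pCons split: nat.split)

lemma polyfun_fst: "polyfun 1 fst"
  unfolding polyfun_def by (intro exI[of _ "[:[:0, 1:]:]"]) (auto simp: bideg_le_def coeff_pCons split: nat.split)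

lemma polyfun_snd: "polyfun 1 snd"
  unfolding polyfun_def by (intro exI[of _ "[:0, 1:]"]) (auto simp: bideg_le_def coeff_pCons eval2_def split: nat.split)

lemma polyfun_add: "polyfun a F \<Longrightarrow> polyfun a G \<Longrightarrow> polyfun a (\<lambda>Z. F Z + G Z)"
  unfolding polyfun_def by (metis bideg_le_add eval2_add)

lemma polyfun_mult: "polyfun a F \<Longrightarrow> polyfun b G \<Longrightarrow> polyfun (a + b) (\<lambda>Z. F Z * G Z)"
  unfolding polyfun_def by (metis bideg_le_mult eval2_mult)

lemma polyfun_cmult: "polyfun a F \<Longrightarrow> polyfun a (\<lambda>Z. c * F Z)"
  using polyfun_mult[OF polyfun_const] by simp

lemma polyfun_diff: "polyfun a F \<Longrightarrow> polyfun a G \<Longrightarrow> polyfun a (\<lambda>Z. F Z - G Z)"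
  using polyfun_add[of a F "\<lambda>Z. (-1) * G Z"] polyfun_cmult[of a G "-1"] by simp

lemma polyfun_power: "polyfun a F \<Longrightarrow> polyfun (k * a) (\<lambda>Z. F Z ^ k)"
proof (induction k)
  case 0
  then show ?case using polyfun_const[of 1] by simp
next
  case (Suc k)
  then show ?case using polyfun_mult[of a F "k * a" "\<lambda>Z. F Z ^ k"] by simp
qed

lemma polyfun_sum: "finite I \<Longrightarrow> (\<And>i. i \<in> I \<Longrightarrow> polyfun a (F i)) \<Longrightarrow> polyfun a (\<lambda>Z. \<Sum>i\<in>I. F i Z)"
proof (induction I rule: finite_induct)
  case empty
  then show ?case using polyfun_mono[OF polyfun_const] by simp
qed (simp add: polyfun_add)

lemma bezout_polyfun:
  assumes "irreducible f" "degree f > 0" "polyfun e F" "total_degree f = d"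
    and "\<nexists>h. \<forall>Z. F Z = eval2 f Z * eval2 h Z"
  shows "finite {Z \<in> zero_locus f. F Z = 0}" "card {Z \<in> zero_locus f. F Z = 0} \<le> d * (d + e)^2"
proof -
  obtain g where g: "bideg_le e g" "\<And>Z. eval2 g Z = F Z" using assms(3) unfolding polyfun_def by blast
  have "\<not> f dvd g"
  proof
    assume "f dvd g"
    then obtain h where "g = f * h" by (elim dvdE)
    then have "\<forall>Z. F Z = eval2 f Z * eval2 h Z" using g(2) by (metis eval2_mult)
    then show False using assms(5) by blast
  qed
  moreover have "{Z \<in> zero_locus f. F Z = 0} = {Z. eval2 f Z = 0 \<and> eval2 g Z = 0}"
    by (simp add: zero_locus_def g(2))
  ultimately show "finite {Z \<in> zero_locus f. F Z = 0}" "card {Z \<in> zero_locus f. F Z = 0} \<le> d * (d + e)^2"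
    using bezout_bound[OF assms(1,2) bideg_le_total_degree g(1)] assms(4) by simp_all
qed

section \<open>Homogenisation and clearing of denominators\<close>

definition homogenized :: "real poly poly \<Rightarrow> real \<Rightarrow> real \<Rightarrow> real \<Rightarrow> real" where
  "homogenized f X Y W = (\<Sum>i\<le>total_degree f. \<Sum>j\<le>total_degree f - i.
     coeff (coeff f i) j * X ^ j * Y ^ i * W ^ (total_degree f - i - j))"

lemma homogenized_eq:
  "homogenized f (W * x) (W * y) W = W ^ total_degree f * eval2 f (x, y)"
  unfolding homogenized_def eval2_triangle_sum sum_distrib_left
proof (intro sum.cong refl)
  fix i j assume "i \<in> {..total_degree f}" "j \<in> {..total_degree f - i}"
  then have "total_degree f = j + i + (total_degree f - i - j)" by auto
  then have "W ^ total_degree f = W ^ j * W ^ i * W ^ (total_degree f - i - j)" by (metis power_add)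
  then show "coeff (coeff f i) j * (W * x) ^ j * (W * y) ^ i * W ^ (total_degree f - i - j) =
      W ^ total_degree f * (coeff (coeff f i) j * x ^ j * y ^ i)"
    by (simp add: power_mult_distrib)
qed

lemma homogenized_0: "homogenized f X Y 0 = top_form f X Y"
  unfolding homogenized_def top_form_def
proof (intro sum.cong refl)
  fix i assume "i \<in> {..total_degree f}"
  have "(\<Sum>j\<le>total_degree f - i. coeff (coeff f i) j * X ^ j * Y ^ i * 0 ^ (total_degree f - i - j)) =
      (\<Sum>j\<le>total_degree f - i. if j = total_degree f - i then coeff (coeff f i) j * X ^ j * Y ^ i else 0)"
    by (intro sum.cong refl) auto
  then show "(\<Sum>j\<le>total_degree f - i. coeff (coeff f i) j * X ^ j * Y ^ i * 0 ^ (total_degree f - i - j)) =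
      coeff (coeff f i) (total_degree f - i) * X ^ (total_degree f - i) * Y ^ i" by simp
qed

lemma top_form_scale: "top_form f (c * v) (c * w) = c ^ total_degree f * top_form f v w"
  unfolding top_form_def sum_distrib_left
proof (intro sum.cong refl)
  fix i assume "i \<in> {..total_degree f}"
  then have "c ^ total_degree f = c ^ (total_degree f - i) * c ^ i" by (simp flip: power_add)
  then show "coeff (coeff f i) (total_degree f - i) * (c * v) ^ (total_degree f - i) * (c * w) ^ i =
     c ^ total_degree f * (coeff (coeff f i) (total_degree f - i) * v ^ (total_degree f - i) * w ^ i)"
    by (simp add: power_mult_distrib)
qed

lemma polyfun_det2: "polyfun 1 (\<lambda>Z. det2 u (Z - A))"
  unfolding det2_def fst_diff snd_diff
  by (intro polyfun_diff polyfun_cmult polyfun_fst polyfun_snd polyfun_mono[OF polyfun_const]) auto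

text \<open>If \<open>Q - A\<close> is parallel to \<open>Q' - A'\<close> and \<open>Q - B\<close> to \<open>Q' - B'\<close>, then
  \<open>Q' = A' + (N / \<delta>) (Q - A)\<close> with \<open>N = det2 (B' - A') (Q - B)\<close> and \<open>\<delta> = det2 (B - A) (Q - A)\<close>.
  The following is \<open>f Q'\<close> with denominators cleared.\<close>

definition pullback :: "real poly poly \<Rightarrow> real \<times> real \<Rightarrow> real \<times> real \<Rightarrow> real \<times> real \<Rightarrow> real \<times> real \<Rightarrow> real \<times> real \<Rightarrow> real"
  where "pullback f A B A' B' Z = homogenized f
    (det2 (B - A) (Z - A) * fst A' + det2 (B' - A') (Z - B) * (fst Z - fst A))
    (det2 (B - A) (Z - A) * snd A' + det2 (B' - A') (Z - B) * (snd Z - snd A))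
    (det2 (B - A) (Z - A))"

text \<open>The first two arguments of \<open>homogenized\<close> have bidegree at most 2 and the
  last has 1, so a monomial contributes at most
  \<open>2 * j + 2 * i + (total_degree f - i - j)\<close>.\<close>

lemma polyfun_pullback: "polyfun (2 * total_degree f) (pullback f A B A' B')"
proof -
  let ?\<delta> = "\<lambda>Z. det2 (B - A) (Z - A)" and ?N = "\<lambda>Z. det2 (B' - A') (Z - B)"
  have "polyfun 1 (\<lambda>Z. c * ?\<delta> Z)" for c by (intro polyfun_cmult polyfun_det2)
  then have \<delta>: "polyfun 2 (\<lambda>Z. ?\<delta> Z * c)" for c using polyfun_mono[of 1 _ 2] by (simp add: mult.commute)
  have "polyfun 1 (\<lambda>Z. fst Z - fst A)" "polyfun 1 (\<lambda>Z. snd Z - snd A)"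
    by (intro polyfun_diff polyfun_fst polyfun_snd polyfun_mono[OF polyfun_const]; simp)+
  from this[THEN polyfun_mult[OF polyfun_det2[of "B' - A'" B]]]
  have N: "polyfun 2 (\<lambda>Z. ?N Z * (fst Z - fst A))" "polyfun 2 (\<lambda>Z. ?N Z * (snd Z - snd A))"
    by (simp_all add: numeral_2_eq_2)
  show ?thesis
    unfolding pullback_def homogenized_def
  proof (intro polyfun_sum finite_atMost)
    fix i j assume ij: "i \<in> {..total_degree f}" "j \<in> {..total_degree f - i}"
    have "polyfun (0 + j * 2 + i * 2 + (total_degree f - i - j) * 1) (\<lambda>Z. coeff (coeff f i) j *
       (?\<delta> Z * fst A' + ?N Z * (fst Z - fst A)) ^ j * (?\<delta> Z * snd A' + ?N Z * (snd Z - snd A)) ^ i *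
       ?\<delta> Z ^ (total_degree f - i - j))"
      by (intro polyfun_mult polyfun_const polyfun_power polyfun_add \<delta> N polyfun_det2)
    moreover have "0 + j * 2 + i * 2 + (total_degree f - i - j) * 1 \<le> 2 * total_degree f" using ij by auto
    ultimately show "polyfun (2 * total_degree f) (\<lambda>Z. coeff (coeff f i) j *
       (?\<delta> Z * fst A' + ?N Z * (fst Z - fst A)) ^ j * (?\<delta> Z * snd A' + ?N Z * (snd Z - snd A)) ^ i *
       ?\<delta> Z ^ (total_degree f - i - j))"
      by (rule polyfun_mono)
  qed
qed

lemma pullback_off_line:
  assumes "det2 (B - A) (Z - A) \<noteq> 0"
  shows "pullback f A B A' B' Z = det2 (B - A) (Z - A) ^ total_degree f *
     eval2 f (A' + (det2 (B' - A') (Z - B) / det2 (B - A) (Z - A)) *\<^sub>R (Z - A))"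
proof -
  let ?\<delta> = "det2 (B - A) (Z - A)" and ?N = "det2 (B' - A') (Z - B)"
  let ?Z' = "A' + (?N / ?\<delta>) *\<^sub>R (Z - A)"
  have "?\<delta> * fst A' + ?N * (fst Z - fst A) = ?\<delta> * fst ?Z'"
    "?\<delta> * snd A' + ?N * (snd Z - snd A) = ?\<delta> * snd ?Z'"
    using assms by (simp_all add: distrib_left)
  then have "pullback f A B A' B' Z = homogenized f (?\<delta> * fst ?Z') (?\<delta> * snd ?Z') ?\<delta>"
    unfolding pullback_def by simp
  also have "\<dots> = ?\<delta> ^ total_degree f * eval2 f ?Z'" by (simp only: homogenized_eq prod.collapse)
  finally show ?thesis .
qed

text \<open>On AB the denominator vanishes and both numerators become coordinates of a multiple of
  \<open>B - A\<close>, so only the leading form remains; the factors \<open>z\<close> and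
  \<open>z - 1\<close> come from \<open>Z - A\<close> and \<open>Z - B\<close>.\<close>

lemma pullback_on_line:
  "pullback f A B A' B' (A + z *\<^sub>R (B - A)) =
     ((z - 1) * z * det2 (B' - A') (B - A)) ^ total_degree f * top_form f (fst (B - A)) (snd (B - A))"
proof -
  let ?Z = "A + z *\<^sub>R (B - A)" and ?c = "(z - 1) * z * det2 (B' - A') (B - A)"
  have "det2 (B - A) (?Z - A) = 0" by (simp add: det2_def)
  moreover have "det2 (B' - A') (?Z - B) * (fst ?Z - fst A) = ?c * fst (B - A)"
     "det2 (B' - A') (?Z - B) * (snd ?Z - snd A) = ?c * snd (B - A)"
    by (simp_all add: det2_def algebra_simps)
  ultimately have "pullback f A B A' B' ?Z = top_form f (?c * fst (B - A)) (?c * snd (B - A))"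
    unfolding pullback_def by (simp only: mult_zero_left add_0_left homogenized_0)
  then show ?thesis by (simp only: top_form_scale)
qed

text \<open>Expanding \<open>B' - A'\<close> in \<open>Q - A\<close> and \<open>Q - B\<close> and
  taking the determinant with \<open>Q - B\<close> eliminates \<open>u\<close>, which determines
  \<open>t\<close>.\<close>

lemma fourth_vertex:
  assumes "Q' - A' = t *\<^sub>R (Q - A)" "Q' - B' = u *\<^sub>R (Q - B)" "det2 (B - A) (Q - A) \<noteq> 0"
  shows "Q' = A' + (det2 (B' - A') (Q - B) / det2 (B - A) (Q - A)) *\<^sub>R (Q - A)"
proof -
  have "B' - A' = (Q' - A') - (Q' - B')" by simp
  also have "\<dots> = t *\<^sub>R (Q - A) - u *\<^sub>R (Q - B)" by (simp only: assms(1,2))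
  finally have w: "B' - A' = t *\<^sub>R (Q - A) - u *\<^sub>R (Q - B)" .
  have "det2 (B' - A') (Q - B) = t * det2 (B - A) (Q - A)"
    unfolding w by (simp add: det2_def algebra_simps)
  then have "det2 (B' - A') (Q - B) / det2 (B - A) (Q - A) = t" using assms(3) by simp
  then show ?thesis by (simp flip: assms(1))
qed

section \<open>Common parallel pairs\<close>

text \<open>Vertical and degenerate pairs are excluded, so that directions can be compared as real
  slopes.\<close>

definition parallel :: "real \<times> real \<Rightarrow> real \<times> real \<Rightarrow> real \<times> real \<Rightarrow> real \<times> real \<Rightarrow> bool" where
  "parallel A Q A' Q' \<longleftrightarrow> fst A \<noteq> fst Q \<and> fst A' \<noteq> fst Q' \<and>
     (snd Q - snd A) / (fst Q - fst A) = (snd Q' - snd A') / (fst Q' - fst A')"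

lemma parallelD:
  assumes "parallel A Q A' Q'"
  obtains t where "t \<noteq> 0" "Q' - A' = t *\<^sub>R (Q - A)"
proof -
  define t where "t = (fst Q' - fst A') / (fst Q - fst A)"
  have nz: "fst Q - fst A \<noteq> 0" "fst Q' - fst A' \<noteq> 0" using assms by (auto simp: parallel_def)
  have "(snd Q - snd A) / (fst Q - fst A) = (snd Q' - snd A') / (fst Q' - fst A')"
    using assms by (simp add: parallel_def)
  then have "snd Q' - snd A' = t * (snd Q - snd A)" using nz by (simp add: t_def frac_eq_eq divide_simps mult_ac)
  moreover have "fst Q' - fst A' = t * (fst Q - fst A)" using nz by (simp add: t_def)
  ultimately have "Q' - A' = t *\<^sub>R (Q - A)" by (simp add: prod_eq_iff)
  moreover have "t \<noteq> 0" using nz by (simp add: t_def)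
  ultimately show ?thesis using that by blast
qed

lemma parallel_det2:
  assumes "parallel A Q A' Q'"
  shows "det2 (Q - A) (Q' - A') = 0"
proof -
  obtain t where "Q' - A' = t *\<^sub>R (Q - A)" using parallelD[OF assms] .
  then show ?thesis by (simp add: det2_def)
qed

definition common_pairs where
  "common_pairs \<Gamma> A B A' B' = {(Q, Q') \<in> \<Gamma> \<times> \<Gamma>. parallel A Q A' Q' \<and> parallel B Q B' Q'}"

lemma common_pairs_on_line:
  assumes f: "irreducible f" "total_degree f = d" "d \<ge> 2" "degree f > 0" and "A \<noteq> B"
  shows "finite {(Q, Q') \<in> common_pairs (zero_locus f) A B A' B'. det2 (B - A) (Q - A) = 0} \<and>
    card {(Q, Q') \<in> common_pairs (zero_locus f) A B A' B'. det2 (B - A) (Q - A) = 0} \<le> d * d"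
proof -
  let ?L = "\<lambda>P. {Z \<in> zero_locus f. det2 (B - A) (Z - P) = 0}"
  have L: "finite (?L P)" "card (?L P) \<le> d" for P
    using line_bound[OF f(1) f(3)[folded f(2)] f(4), of "B - A" P] f(2) \<open>A \<noteq> B\<close> by auto
  have sub: "{(Q, Q') \<in> common_pairs (zero_locus f) A B A' B'. det2 (B - A) (Q - A) = 0} \<subseteq> ?L A \<times> ?L A'"
  proof (safe; simp add: common_pairs_def; (elim conjE)?)
    fix a b c e
    assume *: "parallel A (a, b) A' (c, e)" "det2 (B - A) ((a, b) - A) = 0"
    obtain t where "(c, e) - A' = t *\<^sub>R ((a, b) - A)" using parallelD[OF *(1)] .
    then have "det2 (B - A) ((c, e) - A') = t * det2 (B - A) ((a, b) - A)"
      by (simp only: det2_def fst_scaleR snd_scaleR) (simp add: algebra_simps)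
    then show "det2 (B - A) ((c, e) - A') = 0" using *(2) by simp
  qed
  have "card (?L A \<times> ?L A') \<le> d * d"
    unfolding card_cartesian_product using L by (intro mult_le_mono) auto
  moreover have "finite (?L A \<times> ?L A')" using L by blast
  ultimately show ?thesis using sub card_mono finite_subset by (meson order.trans)
qed

text \<open>For \<open>A' = B'\<close> the numerator is zero, so off AB the construction would give
  \<open>Q' = A'\<close>, which \<open>parallel\<close> forbids. Only pairs with \<open>Q\<close> on
  AB remain.\<close>

lemma card_common_pairs_same_point:
  assumes f: "irreducible f" "total_degree f = d" "d \<ge> 2" "degree f > 0" and "A \<noteq> B"
  shows "finite (common_pairs (zero_locus f) A B A' A') \<and>
    card (common_pairs (zero_locus f) A B A' A') \<le> d * d"
proof -
  have "det2 (B - A) (Q - A) = 0" if "(Q, Q') \<in> common_pairs (zero_locus f) A B A' A'" for Q Q'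
  proof (rule ccontr)
    assume nz: "det2 (B - A) (Q - A) \<noteq> 0"
    have par: "parallel A Q A' Q'" "parallel B Q A' Q'" using that by (auto simp: common_pairs_def)
    obtain t where t: "Q' - A' = t *\<^sub>R (Q - A)" using parallelD[OF par(1)] .
    obtain u where u: "Q' - A' = u *\<^sub>R (Q - B)" using parallelD[OF par(2)] .
    have "Q' = A'" using fourth_vertex[OF t u nz] by (simp add: det2_def)
    then show False using par by (simp add: parallel_def)
  qed
  then have "common_pairs (zero_locus f) A B A' A' =
     {(Q, Q') \<in> common_pairs (zero_locus f) A B A' A'. det2 (B - A) (Q - A) = 0}" by blast
  then show ?thesis using common_pairs_on_line[OF assms, of A' A'] by simp
qed

text \<open>Off AB, \<open>Q'\<close> is determined by \<open>Q\<close>, and \<open>Q\<close> is a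
  common zero of \<open>f\<close> and the pullback, which has bidegree at most 2 d; the Bezout bound
  is d (d + 2 d)^2 = 9 d^3. The pairs with \<open>Q\<close> on AB add d * d.\<close>

lemma card_common_pairs_le:
  assumes f: "irreducible f" "total_degree f = d" "d \<ge> 2" "degree f > 0" and "A \<noteq> B"
    and "\<nexists>h. \<forall>Z. pullback f A B A' B' Z = eval2 f Z * eval2 h Z"
  shows "finite (common_pairs (zero_locus f) A B A' B') \<and>
    card (common_pairs (zero_locus f) A B A' B') \<le> 9 * d ^ 3 + d * d"
proof -
  let ?C = "common_pairs (zero_locus f) A B A' B'"
  let ?R = "{Z \<in> zero_locus f. pullback f A B A' B' Z = 0}"
  let ?q = "\<lambda>Q. (Q, A' + (det2 (B' - A') (Q - B) / det2 (B - A) (Q - A)) *\<^sub>R (Q - A))"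
  let ?E = "{(Q, Q') \<in> ?C. det2 (B - A) (Q - A) = 0}"
  have R: "finite ?R" "card ?R \<le> d * (d + 2 * d)^2"
    using bezout_polyfun[OF f(1,4) polyfun_pullback f(2) assms(6)] f(2) by simp_all
  have E: "finite ?E" "card ?E \<le> d * d" using common_pairs_on_line[OF assms(1-5)] by blast+
  have "x \<in> ?q ` ?R \<union> ?E" if x: "x \<in> ?C" for x
  proof -
    obtain Q Q' where xe: "x = (Q, Q')" by (cases x)
    have par: "Q \<in> zero_locus f" "Q' \<in> zero_locus f" "parallel A Q A' Q'" "parallel B Q B' Q'"
      using x by (auto simp: common_pairs_def xe)
    show ?thesis
    proof (cases "det2 (B - A) (Q - A) = 0")
      case True
      then show ?thesis using x by (simp add: xe)
    next
      case False
      obtain t where t: "Q' - A' = t *\<^sub>R (Q - A)" using parallelD[OF par(3)] .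
      obtain u where u: "Q' - B' = u *\<^sub>R (Q - B)" using parallelD[OF par(4)] .
      note q = fourth_vertex[OF t u False]
      then have "pullback f A B A' B' Q = det2 (B - A) (Q - A) ^ total_degree f * eval2 f Q'"
        using pullback_off_line[OF False] by metis
      then have "Q \<in> ?R" using par(1,2) by (simp add: zero_locus_def)
      moreover have "x = ?q Q" using q xe by simp
      ultimately show ?thesis by blast
    qed
  qed
  then have sub: "?C \<subseteq> ?q ` ?R \<union> ?E" by blast
  then have "card ?C \<le> card (?q ` ?R \<union> ?E)" using R E by (intro card_mono) auto
  also have "\<dots> \<le> card (?q ` ?R) + card ?E" by (rule card_Un_le)
  also have "\<dots> \<le> card ?R + card ?E" using card_image_le[OF R(1), of ?q] by simp
  also have "\<dots> \<le> d * (d + 2 * d)^2 + d * d" using R E by linarith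
  also have "\<dots> = 9 * d ^ 3 + d * d" by (simp add: power2_eq_square power3_eq_cube algebra_simps)
  finally show ?thesis using sub R(1) E(1) by (meson finite_UnI finite_imageI finite_subset)
qed

text \<open>As a divisor of a power of z (z - 1) up to a constant, \<open>p\<close> has no prime
  factors other than z and z - 1; it has both, and each only once because its derivative does not
  vanish there.\<close>

lemma root_multiplicity_bound:
  fixes p q :: "real poly"
  assumes "p * q = smult c ([:0, 1:] ^ k * [:-1, 1:] ^ k)" "c \<noteq> 0" "poly p 0 = 0" "poly p 1 = 0"
    and "poly (pderiv p) 0 \<noteq> 0" "poly (pderiv p) 1 \<noteq> 0"
  shows "degree p = 2"
proof -
  obtain p1 where p1: "p = [:0, 1:] * p1" using assms(3) by (metis dvdE minus_zero poly_eq_0_iff_dvd)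
  then have "poly p1 1 = 0" using assms(4) by simp
  then obtain p2 where p2: "p1 = [:-1, 1:] * p2" by (metis dvdE poly_eq_0_iff_dvd)
  have pe: "p = [:0, -1, 1:] * p2" by (simp add: p1 p2)
  have "poly p2 0 \<noteq> 0" "poly p2 1 \<noteq> 0"
    using assms(5,6) unfolding pe by (auto simp: pderiv_mult pderiv_pCons simp del: mult_pCons_left)
  then have "\<not> [:0, 1:] dvd p2" "\<not> [:-1, 1:] dvd p2"
    using poly_eq_0_iff_dvd[of p2 0] poly_eq_0_iff_dvd[of p2 1] by auto
  then have "coprime [:0, 1:] p2" "coprime [:-1, 1:] p2"
    using prime_elem_linear_field_poly[of "1 :: real" 0] prime_elem_linear_field_poly[of "1 :: real" "-1"]
    by (auto intro: prime_elem_imp_coprime)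
  then have cop: "coprime ([:0, 1:] ^ k * [:-1, 1:] ^ k) p2" by simp
  have "p2 dvd smult c ([:0, 1:] ^ k * [:-1, 1:] ^ k)"
    unfolding assms(1)[symmetric] pe by (metis dvd_mult2 dvd_triv_right)
  then have "p2 dvd [:0, 1:] ^ k * [:-1, 1:] ^ k" using assms(2) by (simp add: dvd_smult_iff)
  then have "is_unit p2" using cop by (meson coprime_common_divisor dvd_refl)
  then have "degree p2 = 0" "p2 \<noteq> 0" by (auto simp: is_unit_poly_iff)
  then show ?thesis unfolding pe by (subst degree_mult_eq) auto
qed

text \<open>For points of the curve: AB has no asymptotic direction and is tangent at neither
  \<open>A\<close> nor \<open>B\<close>, so that \<open>f\<close> restricted to AB has full degree
  and simple zeros at both points.\<close>

definition tame_pair :: "real poly poly \<Rightarrow> real \<times> real \<Rightarrow> real \<times> real \<Rightarrow> bool" where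
  "tame_pair f A B \<longleftrightarrow> A \<noteq> B \<and> top_form f (fst (B - A)) (snd (B - A)) \<noteq> 0 \<and>
     poly (pderiv (line_poly f A (B - A))) 0 \<noteq> 0 \<and> poly (pderiv (line_poly f A (B - A))) 1 \<noteq> 0"

text \<open>On the line \<open>AB\<close> the pullback only vanishes at \<open>A\<close> and \<open>B\<close>, whereas \<open>f\<close> has a further zero
  there (possibly complex or at infinity) when the degree is at least \<open>3\<close>.\<close>

lemma exceptional_imp_parallel:
  assumes "tame_pair f A B" "total_degree f \<ge> 3" "A \<in> zero_locus f" "B \<in> zero_locus f"
    and h: "\<And>Z. pullback f A B A' B' Z = eval2 f Z * eval2 h Z"
  shows "det2 (B' - A') (B - A) = 0"
proof (rule ccontr)
  let ?d = "total_degree f" and ?p = "line_poly f A (B - A)" and ?q = "line_poly h A (B - A)"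
  let ?\<kappa> = "det2 (B' - A') (B - A)" and ?\<tau> = "top_form f (fst (B - A)) (snd (B - A))"
  assume "?\<kappa> \<noteq> 0"
  have at: "eval2 g (A + z *\<^sub>R (B - A)) = poly (line_poly g A (B - A)) z" for g z
    by (simp add: poly_line_poly plus_prod_def)
  have "poly (?p * ?q) z = poly (smult (?\<kappa> ^ ?d * ?\<tau>) ([:0, 1:] ^ ?d * [:-1, 1:] ^ ?d)) z" for z
  proof -
    have "poly (?p * ?q) z = pullback f A B A' B' (A + z *\<^sub>R (B - A))" unfolding h by (simp add: at)
    also have "\<dots> = ((z - 1) * z * ?\<kappa>) ^ ?d * ?\<tau>" by (rule pullback_on_line)
    finally show ?thesis by (simp add: power_mult_distrib)
  qed
  then have "?p * ?q = smult (?\<kappa> ^ ?d * ?\<tau>) ([:0, 1:] ^ ?d * [:-1, 1:] ^ ?d)"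
    by (intro poly_ext)
  moreover have "poly ?p 0 = 0" "poly ?p 1 = 0"
    using at[of f 0] at[of f 1] assms(3,4) by (simp_all add: zero_locus_def)
  ultimately have "degree ?p = 2"
    using root_multiplicity_bound[of ?p ?q] assms(1) \<open>?\<kappa> \<noteq> 0\<close> by (auto simp: tame_pair_def)
  \<comment> \<open>The direction is not asymptotic, so the restriction to AB has full degree, at
    least 3, contrary to the degree 2 just found.\<close>
  moreover have "coeff ?p ?d \<noteq> 0" using assms(1) by (simp add: coeff_line_poly tame_pair_def)
  then have "?d \<le> degree ?p" by (rule le_degree)
  ultimately show False using assms(2) by linarith
qed

section \<open>Rigidity of exceptional quadruples\<close>

text \<open>With AB parallel to A'B' the quotient of determinants is the constant \<mu>, and the map
  is a homothety when \<mu> is nonzero. It sends zeros off AB to zeros, so \<open>f\<close> after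
  the map shares more than 4 d^3 = d (d + d)^2 zeros with \<open>f\<close>, is therefore a multiple
  of \<open>f\<close>, and vanishes at the zeros on AB as well.\<close>

lemma exceptional_imp_homothety:
  assumes f: "irreducible f" "total_degree f = d" "d \<ge> 2" "degree f > 0" and "A \<noteq> B"
    and \<mu>: "B' - A' = \<mu> *\<^sub>R (B - A)"
    and h: "\<And>Z. pullback f A B A' B' Z = eval2 f Z * eval2 h Z"
    and large: "H \<subseteq> zero_locus f" "card H > 4 * d ^ 3 + d"
    and Z: "Z \<in> zero_locus f"
  shows "A' + \<mu> *\<^sub>R (Z - A) \<in> zero_locus f"
proof -
  let ?\<delta> = "\<lambda>Z. det2 (B - A) (Z - A)"
  \<comment> \<open>This is \<open>f\<close> after the map, written as a homogenisation with last
    argument 1, whose expansion shows a bidegree of at most \<open>d\<close>.\<close>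
  let ?F = "\<lambda>Z. homogenized f (fst A' + \<mu> * (fst Z - fst A)) (snd A' + \<mu> * (snd Z - snd A)) 1"
  have F: "?F Z = eval2 f (A' + \<mu> *\<^sub>R (Z - A))" for Z
  proof -
    have "?F Z = homogenized f (1 * fst (A' + \<mu> *\<^sub>R (Z - A))) (1 * snd (A' + \<mu> *\<^sub>R (Z - A))) 1" by simp
    also have "\<dots> = eval2 f (A' + \<mu> *\<^sub>R (Z - A))"
      unfolding homogenized_eq prod.collapse by simp
    finally show ?thesis .
  qed
  have off: "?F Z = 0" if "Z \<in> zero_locus f" "?\<delta> Z \<noteq> 0" for Z
  proof -
    have "det2 (B' - A') (Z - B) = \<mu> * ?\<delta> Z" unfolding \<mu> by (simp add: det2_def algebra_simps)
    then have "det2 (B' - A') (Z - B) / ?\<delta> Z = \<mu>" using that(2) by simp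
    then have "?\<delta> Z ^ total_degree f * eval2 f (A' + \<mu> *\<^sub>R (Z - A)) = 0"
      using pullback_off_line[OF that(2), of f A' B'] h[of Z] that(1) by (simp add: zero_locus_def)
    then show ?thesis using that(2) by (simp add: F)
  qed
  have "polyfun d ?F"
    unfolding homogenized_def
  proof (intro polyfun_sum finite_atMost)
    fix i j assume ij: "i \<in> {..total_degree f}" "j \<in> {..total_degree f - i}"
    have "polyfun (0 + j * 1 + i * 1 + 0) (\<lambda>Z. coeff (coeff f i) j * (fst A' + \<mu> * (fst Z - fst A)) ^ j *
        (snd A' + \<mu> * (snd Z - snd A)) ^ i * 1 ^ (total_degree f - i - j))"
      by (intro polyfun_mult polyfun_const polyfun_power polyfun_add polyfun_cmult polyfun_diff polyfun_fst polyfun_snd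
          polyfun_mono[OF polyfun_const, of 1]) auto
    then show "polyfun d (\<lambda>Z. coeff (coeff f i) j * (fst A' + \<mu> * (fst Z - fst A)) ^ j *
        (snd A' + \<mu> * (snd Z - snd A)) ^ i * 1 ^ (total_degree f - i - j))"
      using ij f(2) by (elim polyfun_mono) auto
  qed
  have "\<exists>h. \<forall>Z. ?F Z = eval2 f Z * eval2 h Z"
  proof (rule ccontr)
    assume no: "\<nexists>h. \<forall>Z. ?F Z = eval2 f Z * eval2 h Z"
    let ?R = "{Z \<in> zero_locus f. ?F Z = 0}" and ?L = "{Z \<in> zero_locus f. det2 (B - A) (Z - A) = 0}"
    have R: "finite ?R" "card ?R \<le> d * (d + d)^2"
      using bezout_polyfun[OF f(1,4) \<open>polyfun d ?F\<close> f(2) no] by simp_all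
    have L: "finite ?L" "card ?L \<le> d"
      using line_bound[OF f(1) f(3)[folded f(2)] f(4), of "B - A" A] f(2) \<open>A \<noteq> B\<close> by auto
    have "H \<subseteq> ?R \<union> ?L" using large(1) off by blast
    then have "card H \<le> card (?R \<union> ?L)" using R L by (intro card_mono) auto
    also have "\<dots> \<le> card ?R + card ?L" by (rule card_Un_le)
    also have "\<dots> \<le> d * (d + d)^2 + d" using R L by linarith
    also have "\<dots> = 4 * d ^ 3 + d" by (simp add: power2_eq_square power3_eq_cube algebra_simps)
    finally show False using large(2) by simp
  qed
  then obtain h' where "?F Z = eval2 f Z * eval2 h' Z" by blast
  then have "?F Z = 0" using Z by (simp add: zero_locus_def)
  then show ?thesis unfolding F by (simp add: zero_locus_def)
qed

lemma no_infinite_collinear: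
  assumes f: "irreducible f" "total_degree f \<ge> 2" "degree f > 0" and "v \<noteq> 0"
    and "infinite I" "inj_on c I" "\<And>i. i \<in> I \<Longrightarrow> P + c i *\<^sub>R v \<in> zero_locus f"
  shows False
proof -
  have "(\<lambda>i. P + c i *\<^sub>R v) ` I \<subseteq> {Z \<in> zero_locus f. det2 v (Z - P) = 0}"
    using assms(7) by (auto simp: det2_def)
  then have "finite ((\<lambda>i. P + c i *\<^sub>R v) ` I)"
    using line_bound[OF f \<open>v \<noteq> 0\<close>] finite_subset by blast
  moreover have "inj_on (\<lambda>i. P + c i *\<^sub>R v) I"
    using assms(4,6) by (auto simp: inj_on_def)
  ultimately show False using \<open>infinite I\<close> finite_imageD by blast
qed

lemma translation_invariant_imp_trivial:
  assumes f: "irreducible f" "total_degree f \<ge> 2" "degree f > 0" and "A \<in> zero_locus f"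
    and inv: "\<And>Z. Z \<in> zero_locus f \<Longrightarrow> Z + s \<in> zero_locus f"
  shows "s = 0"
proof (rule ccontr)
  assume "s \<noteq> 0"
  have "A + real k *\<^sub>R s \<in> zero_locus f" for k
  proof (induction k)
    case (Suc k)
    then show ?case using inv[OF Suc] by (simp add: algebra_simps)
  qed (use assms(4) in simp)
  then show False
    using no_infinite_collinear[OF f \<open>s \<noteq> 0\<close> infinite_UNIV_nat, of real A] by (simp add: inj_on_def)
qed

lemma inj_power_abs_neq_1:
  fixes a :: real
  assumes "a \<noteq> 0" "\<bar>a\<bar> \<noteq> 1"
  shows "inj (\<lambda>k :: nat. a ^ k)"
proof (rule injI)
  fix m n :: nat assume "a ^ m = a ^ n"
  then have eq: "\<bar>a\<bar> ^ m = \<bar>a\<bar> ^ n" by (metis power_abs)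
  show "m = n"
  proof (cases "\<bar>a\<bar> > 1")
    case True
    then show ?thesis using eq by (simp add: power_inject_exp)
  next
    case False
    then have "\<bar>a\<bar> < 1" "\<bar>a\<bar> > 0" using assms by auto
    then show ?thesis
      using eq power_strict_decreasing[of m n "\<bar>a\<bar>"] power_strict_decreasing[of n m "\<bar>a\<bar>"]
      by (cases m n rule: linorder_cases) auto
  qed
qed

text \<open>The orbit of a point under a translation or a homothety lies on one line, which carries
  finitely many points of the curve. It is infinite for a nonzero translation, and for a nonzero
  ratio of absolute value other than 1 unless the point is the centre.\<close>

lemma homothety_invariant_imp:
  assumes f: "irreducible f" "total_degree f \<ge> 2" "degree f > 0"
    and AB: "A \<in> zero_locus f" "B \<in> zero_locus f" "A \<noteq> B" and "\<mu> \<noteq> 0"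
    and inv: "\<And>Z. Z \<in> zero_locus f \<Longrightarrow> A' + \<mu> *\<^sub>R (Z - A) \<in> zero_locus f"
  shows "\<mu> = 1 \<and> A' = A \<or> \<mu> = -1"
proof (cases "\<mu> = 1")
  case True
  have "Z + (A' - A) \<in> zero_locus f" if "Z \<in> zero_locus f" for Z
    using inv[OF that] True by (simp add: algebra_simps)
  then have "A' - A = 0" by (rule translation_invariant_imp_trivial[OF f AB(1)])
  then show ?thesis using True by simp
next
  case False
  show ?thesis
  proof (rule ccontr)
    assume "\<not> ?thesis"
    with False \<open>\<mu> \<noteq> 0\<close> have "inj (\<lambda>k :: nat. \<mu> ^ k)" by (intro inj_power_abs_neq_1) auto
    \<comment> \<open>The fixed point of the homothety; at least one of \<open>A\<close> and
      \<open>B\<close> differs from it.\<close>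
    define c where "c = (1 / (1 - \<mu>)) *\<^sub>R (A' - \<mu> *\<^sub>R A)"
    have "(1 - \<mu>) *\<^sub>R c = A' - \<mu> *\<^sub>R A" using False by (simp add: c_def)
    then have c: "A' + \<mu> *\<^sub>R (Z - A) = c + \<mu> *\<^sub>R (Z - c)" for Z by (simp add: algebra_simps)
    obtain Z where Z: "Z \<in> zero_locus f" "Z \<noteq> c" using AB by metis
    have "c + \<mu> ^ k *\<^sub>R (Z - c) \<in> zero_locus f" for k :: nat
    proof (induction k)
      case (Suc k)
      then show ?case using inv[OF Suc] unfolding c by simp
    qed (use Z in simp)
    then show False
      using no_infinite_collinear[OF f _ infinite_UNIV_nat \<open>inj (\<lambda>k :: nat. \<mu> ^ k)\<close>, of "Z - c" c] Z(2) by simp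
  qed
qed

text \<open>By rigidity the map is the identity, which gives \<open>(A, B)\<close>, or the point
  reflection Z |-> A' + A - Z. Two such reflections preserving the curve compose to a translation
  preserving it, so at most one centre occurs, and it determines \<open>A'\<close> and
  \<open>B'\<close>.\<close>

lemma card_exceptional_le_2:
  assumes f: "irreducible f" "total_degree f = d" "d \<ge> 3" "degree f > 0"
    and tame: "tame_pair f A B" "A \<in> zero_locus f" "B \<in> zero_locus f"
    and large: "H \<subseteq> zero_locus f" "card H > 4 * d ^ 3 + d"
  defines "Exc \<equiv> {(A', B'). A' \<noteq> B' \<and> (\<exists>h. \<forall>Z. pullback f A B A' B' Z = eval2 f Z * eval2 h Z)}"
  shows "finite Exc \<and> card Exc \<le> 2"
proof -
  have d2: "d \<ge> 2" "total_degree f \<ge> 2" using f by auto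
  have "A \<noteq> B" using tame by (simp add: tame_pair_def)
  have hom: "(A', B') = (A, B) \<or> (B' = A' - (B - A) \<and> (\<forall>Z\<in>zero_locus f. A' + A - Z \<in> zero_locus f))"
    if "(A', B') \<in> Exc" for A' B'
  proof -
    obtain h where h: "A' \<noteq> B'" "\<And>Z. pullback f A B A' B' Z = eval2 f Z * eval2 h Z"
      using \<open>(A', B') \<in> Exc\<close> by (auto simp: Exc_def)
    have "det2 (B' - A') (B - A) = 0"
      by (rule exceptional_imp_parallel[OF tame(1) _ tame(2,3) h(2)]) (use f in simp)
    then have "det2 (B - A) (B' - A') = 0" by (simp add: det2_def algebra_simps)
    then obtain \<mu> where \<mu>: "B' - A' = \<mu> *\<^sub>R (B - A)" by (rule det2_eq_0D) (use \<open>A \<noteq> B\<close> in simp)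
    then have "\<mu> \<noteq> 0" using h(1) by auto
    have inv: "A' + \<mu> *\<^sub>R (Z - A) \<in> zero_locus f" if "Z \<in> zero_locus f" for Z
      by (rule exceptional_imp_homothety[OF f(1,2) d2(1) f(4) \<open>A \<noteq> B\<close> \<mu> h(2) large that])
    have "\<mu> = 1 \<and> A' = A \<or> \<mu> = -1"
      by (rule homothety_invariant_imp[OF f(1) d2(2) f(4) tame(2,3) \<open>A \<noteq> B\<close> \<open>\<mu> \<noteq> 0\<close> inv])
    then show ?thesis
    proof
      assume "\<mu> = 1 \<and> A' = A"
      then show ?thesis using \<mu> by simp
    next
      assume m: "\<mu> = -1"
      have "A' + A - Z \<in> zero_locus f" if "Z \<in> zero_locus f" for Z
        using inv[OF that] m by (simp add: algebra_simps)
      moreover have "B' = A' - (B - A)" using \<mu> m by (simp add: algebra_simps)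
      ultimately show ?thesis by blast
    qed
  qed
  have uniq: "A1 = A2" if "\<forall>Z\<in>zero_locus f. A1 + A - Z \<in> zero_locus f" "\<forall>Z\<in>zero_locus f. A2 + A - Z \<in> zero_locus f"
    for A1 A2
  proof -
    have "Z + (A2 - A1) \<in> zero_locus f" if "Z \<in> zero_locus f" for Z
    proof -
      have "A2 + A - (A1 + A - Z) \<in> zero_locus f" using \<open>\<forall>Z\<in>zero_locus f. A1 + A - Z \<in> _\<close> \<open>\<forall>Z\<in>zero_locus f. A2 + A - Z \<in> _\<close> that by blast
      then show ?thesis by (simp add: algebra_simps)
    qed
    then have "A2 - A1 = 0" by (rule translation_invariant_imp_trivial[OF f(1) d2(2) f(4) tame(2)])
    then show ?thesis by simp
  qed
  have "\<exists>x. Exc \<subseteq> {(A, B), x}"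
  proof (cases "Exc \<subseteq> {(A, B)}")
    case False
    then obtain A1 B1 where 1: "(A1, B1) \<in> Exc" "(A1, B1) \<noteq> (A, B)" by auto
    have "y = (A1, B1)" if "y \<in> Exc" "y \<noteq> (A, B)" for y
    proof -
      obtain A2 B2 where y: "y = (A2, B2)" by (cases y)
      then have "A1 = A2" using hom[OF 1(1)] hom[of A2 B2] 1(2) that uniq[of A1 A2] by blast
      then show ?thesis using hom[OF 1(1)] hom[of A2 B2] 1(2) that y by auto
    qed
    then show ?thesis by blast
  qed blast
  then obtain x where x: "Exc \<subseteq> {(A, B), x}" by blast
  then have "card Exc \<le> card {(A, B), x}" by (intro card_mono) auto
  also have "\<dots> \<le> 2" by (simp add: card_insert_if)
  finally show ?thesis using x finite_subset by blast
qed

section \<open>Pairs in special position\<close>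

lemma pderiv_sum: "pderiv (\<Sum>i\<in>I. p i) = (\<Sum>i\<in>I. pderiv (p i))"
  by (induction I rule: infinite_finite_induct) (simp_all add: pderiv_add)

text \<open>The chain rule along a line. \<alpha> is the partial derivative in x; it depends on the
  point alone, so the tangency condition at a point is one linear equation for the direction
  \<open>v\<close>.\<close>

lemma line_poly_gradient:
  obtains \<alpha> where "\<And>A v z. poly (pderiv (line_poly f A v)) z =
    \<alpha> (A + z *\<^sub>R v) * fst v + eval2 (pderiv f) (A + z *\<^sub>R v) * snd v"
proof -
  let ?d = "total_degree f"
  define \<alpha> where "\<alpha> = (\<lambda>P :: real \<times> real. \<Sum>i\<le>?d. \<Sum>j\<le>?d - i.
     coeff (coeff f i) j * (of_nat j * fst P ^ (j - 1) * snd P ^ i))"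
  define \<beta> where "\<beta> = (\<lambda>P :: real \<times> real. \<Sum>i\<le>?d. \<Sum>j\<le>?d - i.
     coeff (coeff f i) j * (fst P ^ j * (of_nat i * snd P ^ (i - 1))))"
  have *: "poly (pderiv (line_poly f A v)) z = \<alpha> (A + z *\<^sub>R v) * fst v + \<beta> (A + z *\<^sub>R v) * snd v" for A v z
    unfolding line_poly_def \<alpha>_def \<beta>_def sum_distrib_right sum.distrib[symmetric]
      pderiv_sum poly_sum pderiv_smult poly_smult
    by (intro sum.cong refl)
       (simp add: pderiv_mult pderiv_power pderiv_pCons poly_power algebra_simps)
  \<comment> \<open>The vertical line through \<open>P\<close> identifies \<beta> with the
    derivative in Y, by uniqueness of derivatives.\<close>
  have "\<beta> P = eval2 (pderiv f) P" for P
  proof -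
    have "((\<lambda>z. poly (line_poly f P (0, 1)) z) has_real_derivative poly (pderiv (line_poly f P (0, 1))) 0) (at 0)"
      by (rule poly_DERIV)
    moreover have "((\<lambda>y. eval2 f (fst P, y)) has_real_derivative eval2 (pderiv f) P) (at (0 + snd P))"
      using eval2_has_derivative_snd[of f "fst P" "snd P"] by simp
    then have "((\<lambda>z. eval2 f (fst P, z + snd P)) has_real_derivative eval2 (pderiv f) P) (at 0)"
      by (simp only: DERIV_shift)
    then have "((\<lambda>z. poly (line_poly f P (0, 1)) z) has_real_derivative eval2 (pderiv f) P) (at 0)"
      by (simp add: poly_line_poly add.commute)
    ultimately have "poly (pderiv (line_poly f P (0, 1))) 0 = eval2 (pderiv f) P" by (rule DERIV_unique)
    then show ?thesis by (simp add: * flip: zero_prod_def)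
  qed
  then show ?thesis using that[of \<alpha>] * by simp
qed

lemma card_pairs_le:
  assumes "finite X" "\<And>a. a \<in> X \<Longrightarrow> finite (Y a) \<and> card (Y a) \<le> m"
  shows "finite (Sigma X Y) \<and> card (Sigma X Y) \<le> card X * m"
proof -
  have "card (Sigma X Y) = (\<Sum>a\<in>X. card (Y a))" using assms by (simp add: card_SigmaI)
  also have "\<dots> \<le> card X * m" using assms(2) sum_bounded_above[of X "\<lambda>a. card (Y a)" m] by simp
  finally show ?thesis using assms by (auto intro: finite_SigmaI)
qed

lemma card_zero_locus_line_le:
  assumes f: "irreducible f" "total_degree f = d" "d \<ge> 2" "degree f > 0"
    and "H \<subseteq> zero_locus f" "v \<noteq> 0"
  shows "finite {B \<in> H. det2 v (B - A) = 0} \<and> card {B \<in> H. det2 v (B - A) = 0} \<le> d"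
proof -
  have sub: "{B \<in> H. det2 v (B - A) = 0} \<subseteq> {Z \<in> zero_locus f. det2 v (Z - A) = 0}" using assms(5) by blast
  have "finite {Z \<in> zero_locus f. det2 v (Z - A) = 0} \<and> card {Z \<in> zero_locus f. det2 v (Z - A) = 0} \<le> d"
    using line_bound[OF f(1) f(3)[folded f(2)] f(4) assms(6), of A] f(2) by simp
  then show ?thesis using sub by (meson card_mono finite_subset order.trans)
qed

text \<open>\<open>B\<close> lies on the vertical line through \<open>A\<close> or on a line through
  \<open>A\<close> with one of the at most \<open>d\<close> slopes that annihilate the leading form;
  each line carries at most \<open>d\<close> points.\<close>

lemma card_asymptotic_le:
  assumes f: "irreducible f" "total_degree f = d" "d \<ge> 2" "degree f > 0"
    and H: "H \<subseteq> zero_locus f" "finite H"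
  shows "card {B \<in> H. top_form f (fst (B - A)) (snd (B - A)) = 0} \<le> d + d * d"
proof -
  let ?M = "{m. top_form f 1 m = 0}" and ?L = "\<lambda>v. {B \<in> H. det2 v (B - A) = 0}"
  have "f \<noteq> 0" using f(4) by auto
  then have M: "finite ?M" "card ?M \<le> d" using top_form_roots[of f] f(2) by simp_all
  have L: "card (?L v) \<le> d" if "v \<noteq> 0" for v
    using card_zero_locus_line_le[OF f H(1) that] by simp
  have "B \<in> ?L (0, 1) \<union> (\<Union>m\<in>?M. ?L (1, m))" if B: "B \<in> H" "top_form f (fst (B - A)) (snd (B - A)) = 0" for B
  proof (cases "fst (B - A) = 0")
    case True
    then show ?thesis using B by (simp add: det2_def)
  next
    case False
    define m where "m = snd (B - A) / fst (B - A)"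
    have "top_form f (fst (B - A)) (snd (B - A)) = fst (B - A) ^ total_degree f * top_form f 1 m"
      using top_form_scale[of f "fst (B - A)" 1 m] False by (simp add: m_def)
    then have "m \<in> ?M" using B(2) False by simp
    moreover have "B \<in> ?L (1, m)" using False B(1) by (simp add: det2_def m_def)
    ultimately show ?thesis by blast
  qed
  then have "{B \<in> H. top_form f (fst (B - A)) (snd (B - A)) = 0} \<subseteq> ?L (0, 1) \<union> (\<Union>m\<in>?M. ?L (1, m))" by blast
  then have "card {B \<in> H. top_form f (fst (B - A)) (snd (B - A)) = 0} \<le> card (?L (0, 1) \<union> (\<Union>m\<in>?M. ?L (1, m)))"
    using H(2) by (intro card_mono) (auto intro: finite_subset)
  also have "\<dots> \<le> card (?L (0, 1)) + card (\<Union>m\<in>?M. ?L (1, m))" by (rule card_Un_le)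
  also have "card (?L (0, 1)) \<le> d" by (rule L) (simp add: zero_prod_def)
  also have "card (\<Union>m\<in>?M. ?L (1, m)) \<le> (\<Sum>m\<in>?M. card (?L (1, m)))" by (rule card_UN_le[OF M(1)])
  also have "\<dots> \<le> card ?M * d"
    using sum_bounded_above[of ?M "\<lambda>m. card (?L (1, m))" d] L by (simp add: zero_prod_def)
  also have "\<dots> \<le> d * d" using M(2) by (rule mult_le_mono1)
  finally show ?thesis by simp
qed

text \<open>A pair fails to be tame when \<open>B = A\<close>, when AB has an asymptotic direction,
  or when AB is tangent at \<open>A\<close> or at \<open>B\<close>. For fixed \<open>A\<close> the
  causes other than tangency at \<open>B\<close> leave at most 1 + (d + d * d) + d points
  \<open>B\<close>; tangency at \<open>B\<close> leaves, for fixed \<open>B\<close>, at most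
  \<open>d\<close> points \<open>A\<close>.\<close>

lemma card_not_tame_le:
  assumes f: "irreducible f" "total_degree f = d" "d \<ge> 2" "degree f > 0"
    and H: "H \<subseteq> zero_locus f" "finite H" "\<And>p. p \<in> H \<Longrightarrow> eval2 (pderiv f) p \<noteq> 0"
  shows "card {(A, B) \<in> H \<times> H. \<not> tame_pair f A B} \<le> card H * (d * d + 3 * d + 1)"
proof -
  obtain \<alpha> where \<alpha>: "\<And>A v z. poly (pderiv (line_poly f A v)) z =
    \<alpha> (A + z *\<^sub>R v) * fst v + eval2 (pderiv f) (A + z *\<^sub>R v) * snd v" using line_poly_gradient[of f] by blast
  \<comment> \<open>A tangent vector, orthogonal to the gradient; it is nonzero because the
    derivative in Y does not vanish on \<open>H\<close>.\<close>
  let ?v = "\<lambda>P. (eval2 (pderiv f) P, - \<alpha> P)"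
  let ?Y = "\<lambda>A. {A} \<union> {B \<in> H. top_form f (fst (B - A)) (snd (B - A)) = 0} \<union> {B \<in> H. det2 (?v A) (B - A) = 0}"
  let ?Z = "\<lambda>B. {A \<in> H. det2 (?v B) (A - B) = 0}"
  have nz: "?v P \<noteq> 0" if "P \<in> H" for P using H(3)[OF that] by (simp add: zero_prod_def)
  have sub: "{(A, B) \<in> H \<times> H. \<not> tame_pair f A B} \<subseteq> Sigma H ?Y \<union> prod.swap ` Sigma H ?Z"
  proof (rule subsetI, rule UnCI)
    fix x assume x: "x \<in> {(A, B) \<in> H \<times> H. \<not> tame_pair f A B}" and notin: "x \<notin> prod.swap ` Sigma H ?Z"
    obtain A B where xe: "x = (A, B)" by (cases x)
    have AB': "A \<in> H" "B \<in> H" "\<not> tame_pair f A B" using x by (simp_all add: xe)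
    have "(B, A) \<notin> Sigma H ?Z"
    proof
      assume "(B, A) \<in> Sigma H ?Z"
      then have "prod.swap (B, A) \<in> prod.swap ` Sigma H ?Z" by (rule imageI)
      then show False using notin unfolding xe swap_simp by (rule notE[rotated])
    qed
    then have 1: "det2 (?v B) (A - B) \<noteq> 0" using AB' by simp
    have "poly (pderiv (line_poly f A (B - A))) 1 = - det2 (?v B) (A - B)"
      by (simp add: \<alpha> det2_def algebra_simps)
    moreover have "poly (pderiv (line_poly f A (B - A))) 0 = det2 (?v A) (B - A)"
      by (simp add: \<alpha> det2_def algebra_simps)
    ultimately have "B \<in> ?Y A" using AB' 1 unfolding tame_pair_def by auto
    then have "(A, B) \<in> Sigma H ?Y" using AB'(1) by blast
    then show "x \<in> Sigma H ?Y" by (simp only: xe)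
  qed
  have "finite (?Y A) \<and> card (?Y A) \<le> d * d + 2 * d + 1" if "A \<in> H" for A
  proof -
    have "card (?Y A) \<le> card {A} + card {B \<in> H. top_form f (fst (B - A)) (snd (B - A)) = 0} + card {B \<in> H. det2 (?v A) (B - A) = 0}"
      using card_Un_le[of "{A}" "{B \<in> H. top_form f (fst (B - A)) (snd (B - A)) = 0}"]
        card_Un_le[of "{A} \<union> {B \<in> H. top_form f (fst (B - A)) (snd (B - A)) = 0}" "{B \<in> H. det2 (?v A) (B - A) = 0}"]
      by linarith
    also have "\<dots> \<le> 1 + (d + d * d) + d"
      using card_asymptotic_le[OF f H(1,2), of A] card_zero_locus_line_le[OF f H(1) nz[OF that], of A] by simp
    finally show ?thesis using H(2) by simp
  qed
  then have Y: "finite (Sigma H ?Y) \<and> card (Sigma H ?Y) \<le> card H * (d * d + 2 * d + 1)"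
    by (rule card_pairs_le[OF H(2)])
  have Z: "finite (Sigma H ?Z) \<and> card (Sigma H ?Z) \<le> card H * d"
    using card_zero_locus_line_le[OF f H(1) nz] by (intro card_pairs_le[OF H(2)]) blast
  have "card {(A, B) \<in> H \<times> H. \<not> tame_pair f A B} \<le> card (Sigma H ?Y \<union> prod.swap ` Sigma H ?Z)"
    using sub Y Z by (intro card_mono) auto
  also have "\<dots> \<le> card (Sigma H ?Y) + card (prod.swap ` Sigma H ?Z)" by (rule card_Un_le)
  also have "\<dots> \<le> card (Sigma H ?Y) + card (Sigma H ?Z)" using Z card_image_le[of "Sigma H ?Z" prod.swap] by linarith
  also have "\<dots> \<le> card H * (d * d + 2 * d + 1) + card H * d" using Y Z by linarith
  also have "\<dots> = card H * (d * d + 3 * d + 1)" by (simp add: algebra_simps)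
  finally show ?thesis .
qed

section \<open>Upper bound for the incidences in a common cell\<close>

lemma card_parallel_le:
  assumes f: "irreducible f" "total_degree f = d" "d \<ge> 2" "degree f > 0" and H: "H \<subseteq> zero_locus f" "finite H"
  shows "card {Q' \<in> H. parallel A Q A' Q'} \<le> d" "card {A' \<in> H. parallel A Q A' Q'} \<le> d"
proof -
  have "card {Q' \<in> H. parallel A Q A' Q'} \<le> d \<and> card {A' \<in> H. parallel A Q A' Q'} \<le> d"
  proof (cases "Q = A")
    case True
    then show ?thesis by (simp add: parallel_def)
  next
    case False
    then have L: "card {B \<in> H. det2 (Q - A) (B - P) = 0} \<le> d" for P
      using card_zero_locus_line_le[OF f H(1), of "Q - A" P] by simp
    have "{Q' \<in> H. parallel A Q A' Q'} \<subseteq> {B \<in> H. det2 (Q - A) (B - A') = 0}"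
      using parallel_det2 by blast
    then have "card {Q' \<in> H. parallel A Q A' Q'} \<le> card {B \<in> H. det2 (Q - A) (B - A') = 0}"
      using H(2) by (intro card_mono) auto
    moreover have "det2 (Q - A) (B - Q') = - det2 (Q - A) (Q' - B)" for B
      by (simp add: det2_def algebra_simps)
    then have "det2 (Q - A) (B - Q') = 0" if "parallel A Q B Q'" for B
      using parallel_det2[OF that] by simp
    then have "{A' \<in> H. parallel A Q A' Q'} \<subseteq> {B \<in> H. det2 (Q - A) (B - Q') = 0}" by blast
    then have "card {A' \<in> H. parallel A Q A' Q'} \<le> card {B \<in> H. det2 (Q - A) (B - Q') = 0}"
      using H(2) by (intro card_mono) auto
    ultimately show ?thesis using L order.trans by blast
  qed
  then show "card {Q' \<in> H. parallel A Q A' Q'} \<le> d" "card {A' \<in> H. parallel A Q A' Q'} \<le> d" by auto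
qed

lemma card_common_pairs_crude:
  assumes f: "irreducible f" "total_degree f = d" "d \<ge> 2" "degree f > 0" and H: "H \<subseteq> zero_locus f" "finite H"
  shows "card (common_pairs H A B A' B') \<le> card H * d"
proof -
  let ?S = "Sigma H (\<lambda>Q. {Q' \<in> H. parallel A Q A' Q'})"
  have S: "finite ?S \<and> card ?S \<le> card H * d"
    using card_parallel_le(1)[OF f H] H(2) by (intro card_pairs_le) auto
  have "common_pairs H A B A' B' \<subseteq> ?S" by (auto simp: common_pairs_def)
  then show ?thesis using S by (meson card_mono order.trans)
qed

lemma finite_common_pairs: "finite H \<Longrightarrow> finite (common_pairs H A B A' B')"
  unfolding common_pairs_def by (rule finite_subset[of _ "H \<times> H"]) auto

text \<open>Counted in another order: \<open>A'\<close> and \<open>Q\<close> are arbitrary in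
  \<open>H\<close>, then \<open>Q'\<close> lies on a fixed line through \<open>A'\<close>, then
  \<open>B'\<close> on a fixed line through \<open>Q'\<close>.\<close>

lemma sum_common_pairs_crude:
  assumes f: "irreducible f" "total_degree f = d" "d \<ge> 2" "degree f > 0" and H: "H \<subseteq> zero_locus f" "finite H"
  shows "(\<Sum>q\<in>H \<times> H. card (common_pairs H A B (fst q) (snd q))) \<le> card H * card H * (d * d)"
proof -
  let ?U = "Sigma (H \<times> H) (\<lambda>q. common_pairs H A B (fst q) (snd q))"
  let ?V = "Sigma (H \<times> H) (\<lambda>p. Sigma {Q' \<in> H. parallel A (snd p) (fst p) Q'} (\<lambda>Q'. {B' \<in> H. parallel B (snd p) B' Q'}))"
  let ?\<phi> = "\<lambda>u. ((fst (fst u), fst (snd u)), (snd (snd u), snd (fst u)))"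
  have inner: "finite (Sigma {Q' \<in> H. parallel A (snd p) (fst p) Q'} (\<lambda>Q'. {B' \<in> H. parallel B (snd p) B' Q'})) \<and>
     card (Sigma {Q' \<in> H. parallel A (snd p) (fst p) Q'} (\<lambda>Q'. {B' \<in> H. parallel B (snd p) B' Q'})) \<le> d * d" for p
  proof -
    have "finite (Sigma {Q' \<in> H. parallel A (snd p) (fst p) Q'} (\<lambda>Q'. {B' \<in> H. parallel B (snd p) B' Q'})) \<and>
      card (Sigma {Q' \<in> H. parallel A (snd p) (fst p) Q'} (\<lambda>Q'. {B' \<in> H. parallel B (snd p) B' Q'})) \<le>
      card {Q' \<in> H. parallel A (snd p) (fst p) Q'} * d"
      using card_parallel_le(2)[OF f H] H(2) by (intro card_pairs_le) auto
    moreover have "card {Q' \<in> H. parallel A (snd p) (fst p) Q'} * d \<le> d * d"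
      using card_parallel_le(1)[OF f H] by (intro mult_le_mono1)
    ultimately show ?thesis by linarith
  qed
  then have V: "finite ?V \<and> card ?V \<le> card (H \<times> H) * (d * d)"
    using H(2) by (intro card_pairs_le) auto
  have "inj_on ?\<phi> ?U" by (auto simp: inj_on_def)
  moreover have "?\<phi> ` ?U \<subseteq> ?V"
  proof (rule image_subsetI)
    fix u assume u: "u \<in> ?U"
    obtain A' B' Q Q' where ue: "u = ((A', B'), (Q, Q'))" by (metis prod.collapse)
    then show "?\<phi> u \<in> ?V" using u by (simp add: common_pairs_def)
  qed
  ultimately have "card ?U \<le> card ?V" using V by (intro card_inj_on_le) auto
  also have "\<dots> \<le> card H * card H * (d * d)" using V by (simp add: card_cartesian_product)
  finally show ?thesis using H(2) by (simp add: card_SigmaI finite_common_pairs)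
qed

text \<open>For tame \<open>p\<close> at most two exceptional \<open>q\<close> contribute up to
  \<open>n * d\<close> each, and every other \<open>q\<close> a number depending on \<open>d\<close>
  alone. The O(n) pairs \<open>p\<close> that are not tame are covered by the crude sum over all
  \<open>q\<close>.\<close>

lemma sum_common_pairs_upper:
  assumes f: "irreducible f" "total_degree f = d" "d \<ge> 3" "degree f > 0"
    and H: "H \<subseteq> zero_locus f" "finite H" "\<And>p. p \<in> H \<Longrightarrow> eval2 (pderiv f) p \<noteq> 0"
    and large: "card H = n" "n > 4 * d ^ 3 + d" and S: "S \<subseteq> H \<times> H" "card S \<le> n * t"
  shows "(\<Sum>p\<in>S. \<Sum>q\<in>S. card (common_pairs H (fst p) (snd p) (fst q) (snd q))) \<le>
    (n * t)^2 * (9 * d ^ 3 + d * d) + n ^ 3 * (2 * d + (d * d + 3 * d + 1) * (d * d))"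
proof -
  let ?c = "\<lambda>p q. card (common_pairs H (fst p) (snd p) (fst q) (snd q))"
  let ?s = "9 * d ^ 3 + d * d"
  have d2: "d \<ge> 2" using f by simp
  have finS: "finite S" using S(1) H(2) finite_subset by blast
  define Tm where "Tm = {p \<in> S. tame_pair f (fst p) (snd p)}"
  define Bd where "Bd = {p \<in> S. \<not> tame_pair f (fst p) (snd p)}"
  have tame: "(\<Sum>q\<in>S. ?c p q) \<le> 2 * (n * d) + n * t * ?s" if p: "p \<in> Tm" for p
  proof -
    define E where "E = {(A', B'). A' \<noteq> B' \<and> (\<exists>h. \<forall>Z. pullback f (fst p) (snd p) A' B' Z = eval2 f Z * eval2 h Z)}"
    have "p \<in> H \<times> H" using p S(1) unfolding Tm_def by blast
    then have pH: "fst p \<in> zero_locus f" "snd p \<in> zero_locus f" "tame_pair f (fst p) (snd p)"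
      using p H(1) by (auto simp: Tm_def mem_Times_iff)
    have ne: "fst p \<noteq> snd p" using pH(3) by (simp add: tame_pair_def)
    have E: "finite E \<and> card E \<le> 2"
      unfolding E_def by (rule card_exceptional_le_2[OF f pH(3,1,2) H(1)]) (use large in simp)
    have le: "?c p q \<le> ?s" if "q \<notin> E" for q
    proof -
      have "finite (common_pairs (zero_locus f) (fst p) (snd p) (fst q) (snd q)) \<and>
        card (common_pairs (zero_locus f) (fst p) (snd p) (fst q) (snd q)) \<le> ?s"
      proof (cases "fst q = snd q")
        case True
        then show ?thesis
          using card_common_pairs_same_point[OF f(1,2) d2 f(4) ne, of "snd q"] by auto
      next
        case False
        then have "\<nexists>h. \<forall>Z. pullback f (fst p) (snd p) (fst q) (snd q) Z = eval2 f Z * eval2 h Z"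
          using that by (cases q) (simp add: E_def)
        then show ?thesis by (rule card_common_pairs_le[OF f(1,2) d2 f(4) ne])
      qed
      moreover have "common_pairs H (fst p) (snd p) (fst q) (snd q) \<subseteq> common_pairs (zero_locus f) (fst p) (snd p) (fst q) (snd q)"
        using H(1) by (auto simp: common_pairs_def)
      ultimately show ?thesis by (meson card_mono order.trans)
    qed
    have "(\<Sum>q\<in>S. ?c p q) = (\<Sum>q\<in>S \<inter> E. ?c p q) + (\<Sum>q\<in>S - E. ?c p q)"
      by (rule sum.Int_Diff[OF finS])
    also have "(\<Sum>q\<in>S \<inter> E. ?c p q) \<le> card (S \<inter> E) * (n * d)"
      using sum_bounded_above[of "S \<inter> E" "?c p" "n * d"] card_common_pairs_crude[OF f(1,2) d2 f(4) H(1,2)] large(1)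
      by simp
    also have "\<dots> \<le> 2 * (n * d)"
      using E card_mono[of E "S \<inter> E"] by (intro mult_le_mono1) auto
    also have "(\<Sum>q\<in>S - E. ?c p q) \<le> card (S - E) * ?s"
      using sum_bounded_above[of "S - E" "?c p" ?s] le by simp
    also have "\<dots> \<le> n * t * ?s"
      using S(2) card_mono[OF finS, of "S - E"] by (intro mult_le_mono1) auto
    finally show ?thesis by simp
  qed
  have bad: "(\<Sum>q\<in>S. ?c p q) \<le> n * n * (d * d)" for p
  proof -
    have "(\<Sum>q\<in>S. ?c p q) \<le> (\<Sum>q\<in>H \<times> H. ?c p q)" using S(1) H(2) by (intro sum_mono2) auto
    also have "\<dots> \<le> n * n * (d * d)" using sum_common_pairs_crude[OF f(1,2) d2 f(4) H(1,2)] large(1) by simp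
    finally show ?thesis .
  qed
  have cardBd: "card Bd \<le> n * (d * d + 3 * d + 1)"
  proof -
    have "card Bd \<le> card {(A, B) \<in> H \<times> H. \<not> tame_pair f A B}"
      using S(1) H(2) by (intro card_mono) (auto simp: Bd_def intro: finite_subset[of _ "H \<times> H"])
    then show ?thesis using card_not_tame_le[OF f(1,2) d2 f(4) H] large(1) by simp
  qed
  have "card S \<le> n * n" using S(1) H(2) card_mono[of "H \<times> H" S] large(1) by (simp add: card_cartesian_product)
  \<comment> \<open>The bound n^2 goes with the exceptional \<open>q\<close>, the bound n t with the
    remaining ones.\<close>
  then have cardTm: "card Tm \<le> n * n" "card Tm \<le> n * t"
    using S(2) card_mono[OF finS, of Tm] by (auto simp: Tm_def)
  have "(\<Sum>p\<in>S. \<Sum>q\<in>S. ?c p q) = (\<Sum>p\<in>Tm. \<Sum>q\<in>S. ?c p q) + (\<Sum>p\<in>Bd. \<Sum>q\<in>S. ?c p q)"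
  proof -
    have "S = Tm \<union> Bd" "Tm \<inter> Bd = {}" "finite Tm" "finite Bd" using finS by (auto simp: Tm_def Bd_def)
    then show ?thesis using sum.union_disjoint[of Tm Bd "\<lambda>p. \<Sum>q\<in>S. ?c p q"] by simp
  qed
  also have "(\<Sum>p\<in>Tm. \<Sum>q\<in>S. ?c p q) \<le> card Tm * (2 * (n * d) + n * t * ?s)"
    using sum_bounded_above[of Tm "\<lambda>p. \<Sum>q\<in>S. ?c p q"] tame by simp
  also have "\<dots> = card Tm * (2 * (n * d)) + card Tm * (n * t * ?s)" by (simp only: distrib_left)
  also have "\<dots> \<le> n * n * (2 * (n * d)) + n * t * (n * t * ?s)"
    using cardTm by (intro add_mono mult_le_mono1)
  also have "(\<Sum>p\<in>Bd. \<Sum>q\<in>S. ?c p q) \<le> card Bd * (n * n * (d * d))"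
    using sum_bounded_above[of Bd "\<lambda>p. \<Sum>q\<in>S. ?c p q"] bad by simp
  also have "\<dots> \<le> n * (d * d + 3 * d + 1) * (n * n * (d * d))" using cardBd by (rule mult_le_mono1)
  finally show ?thesis by (simp add: power2_eq_square power3_eq_cube algebra_simps)
qed

section \<open>Lower bound and conclusion\<close>

text \<open>Cauchy-Schwarz for the fibre sizes of \<open>g\<close>.\<close>

lemma card_squared_le_coincidences:
  assumes "finite E"
  shows "card E ^ 2 \<le> card (g ` E) * card {(x, y) \<in> E \<times> E. g x = g y}"
proof -
  let ?F = "\<lambda>y. {x \<in> E. g x = y}"
  have 1: "card E = (\<Sum>y\<in>g ` E. card (?F y))"
    using sum.image_gen[OF assms, of "\<lambda>_. 1 :: nat" g] by simp
  have "{(x, y) \<in> E \<times> E. g x = g y} = (\<Union>y\<in>g ` E. ?F y \<times> ?F y)" by auto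
  then have "card {(x, y) \<in> E \<times> E. g x = g y} = (\<Sum>y\<in>g ` E. card (?F y \<times> ?F y))"
    using assms by (simp only:) (rule card_UN_disjoint, auto)
  then have 2: "card {(x, y) \<in> E \<times> E. g x = g y} = (\<Sum>y\<in>g ` E. card (?F y) ^ 2)"
    by (simp add: card_cartesian_product power2_eq_square)
  have "(\<Sum>y\<in>g ` E. real (card (?F y))) ^ 2 \<le> (\<Sum>y\<in>g ` E. real (card (?F y)) ^ 2) * real (card (g ` E))"
    by (rule sum_squared_le_sum_of_squares)
  then have "real (card E ^ 2) \<le> real (card (g ` E) * card {(x, y) \<in> E \<times> E. g x = g y})"
    unfolding 2 1 by (simp add: mult.commute)
  then show ?thesis by (simp only: of_nat_le_iff)
qed

lemma card_disjoint_family_meeting: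
  assumes "disjoint \<C>" "finite P"
  shows "card {C \<in> \<C>. C \<inter> P \<noteq> {}} \<le> card P"
proof -
  have "\<forall>C\<in>{C \<in> \<C>. C \<inter> P \<noteq> {}}. \<exists>p. p \<in> C \<inter> P" by blast
  then obtain c where c: "\<And>C. C \<in> {C \<in> \<C>. C \<inter> P \<noteq> {}} \<Longrightarrow> c C \<in> C \<inter> P" by metis
  have "inj_on c {C \<in> \<C>. C \<inter> P \<noteq> {}}"
  proof (rule inj_onI)
    fix C D assume CD: "C \<in> {C \<in> \<C>. C \<inter> P \<noteq> {}}" "D \<in> {C \<in> \<C>. C \<inter> P \<noteq> {}}" "c C = c D"
    then have "c C \<in> C \<inter> D" using c[OF CD(1)] c[OF CD(2)] by simp
    then show "C = D" using CD assms(1) unfolding disjoint_def by blast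
  qed
  moreover have "c ` {C \<in> \<C>. C \<inter> P \<noteq> {}} \<subseteq> P" using c by blast
  ultimately show ?thesis using assms(2) by (rule card_inj_on_le)
qed

section \<open>Slopes and the blocks seen from a point\<close>

definition slope :: "real \<times> real \<Rightarrow> real \<times> real \<Rightarrow> real" where
  "slope Q Z = (snd Q - snd Z) / (fst Q - fst Z)"

lemma parallel_slope: "parallel A Q A' Q' \<longleftrightarrow> fst A \<noteq> fst Q \<and> fst A' \<noteq> fst Q' \<and> slope Q A = slope Q' A'"
  by (simp add: parallel_def slope_def)

text \<open>Seen from \<open>Q\<close>, a connected piece that avoids the vertical line through \<open>Q\<close> occupies an interval of
  slopes, and every slope lies in at most \<open>d\<close> of these intervals.  If an interval seen from \<open>Q\<close>
  meets one seen from \<open>Q'\<close>, then one of them contains the left endpoint of the other.\<close>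

lemma card_parallel_blocks:
  assumes f: "irreducible f" "total_degree f = d" "d \<ge> 2" "degree f > 0" and H: "finite H"
    and \<C>: "finite \<C>" "disjoint \<C>" "\<And>C. C \<in> \<C> \<Longrightarrow> connected C" "\<Union>\<C> \<subseteq> zero_locus f"
  shows "card {(C, C') \<in> \<C> \<times> \<C>. \<exists>A\<in>H \<inter> C. \<exists>A'\<in>H \<inter> C'. parallel A Q A' Q'} \<le> card \<C> * (4 * d)"
proof -
  define V where "V = (\<lambda>Q :: real \<times> real. {C \<in> \<C>. \<exists>Z\<in>C. fst Z = fst Q})"
  define Thru where "Thru = (\<lambda>Q s. {C \<in> \<C>. \<exists>Z\<in>C. fst Z \<noteq> fst Q \<and> slope Q Z = s})"
  \<comment> \<open>The minimum is over the finite set \<open>H \<inter> C\<close>, since the slopes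
    of all of \<open>C\<close> may have no least element.\<close>
  define lo where "lo = (\<lambda>Q C. Min (slope Q ` (H \<inter> C)))"
  have L: "finite {Z \<in> zero_locus f. det2 v (Z - Q) = 0} \<and> card {Z \<in> zero_locus f. det2 v (Z - Q) = 0} \<le> d"
    if "v \<noteq> 0" for v Q
    using line_bound[OF f(1) f(3)[folded f(2)] f(4) that, of Q] f(2) by simp
  have meet: "card {C \<in> \<C>. C \<inter> {Z \<in> zero_locus f. det2 v (Z - Q) = 0} \<noteq> {}} \<le> d" if "v \<noteq> 0" for v Q
    using card_disjoint_family_meeting[OF \<C>(2), of "{Z \<in> zero_locus f. det2 v (Z - Q) = 0}"] L[OF that, of Q]
    by linarith
  have V: "card (V Q) \<le> d" for Q
  proof -
    have "V Q \<subseteq> {C \<in> \<C>. C \<inter> {Z \<in> zero_locus f. det2 (0, 1) (Z - Q) = 0} \<noteq> {}}"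
    proof
      fix C assume "C \<in> V Q"
      then obtain Z where Z: "C \<in> \<C>" "Z \<in> C" "fst Z = fst Q" by (auto simp: V_def)
      then have "Z \<in> C \<inter> {Z \<in> zero_locus f. det2 (0, 1) (Z - Q) = 0}" using \<C>(4) by (auto simp: det2_def)
      then show "C \<in> {C \<in> \<C>. C \<inter> {Z \<in> zero_locus f. det2 (0, 1) (Z - Q) = 0} \<noteq> {}}" using Z(1) by blast
    qed
    then have "card (V Q) \<le> card {C \<in> \<C>. C \<inter> {Z \<in> zero_locus f. det2 (0, 1) (Z - Q) = 0} \<noteq> {}}"
      using \<C>(1) by (intro card_mono) auto
    also have "\<dots> \<le> d" by (rule meet) (simp add: zero_prod_def)
    finally show ?thesis .
  qed
  have Thru: "card (Thru Q s) \<le> d" for Q s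
  proof -
    have "Thru Q s \<subseteq> {C \<in> \<C>. C \<inter> {Z \<in> zero_locus f. det2 (1, s) (Z - Q) = 0} \<noteq> {}}"
    proof
      fix C assume "C \<in> Thru Q s"
      then obtain Z where Z: "C \<in> \<C>" "Z \<in> C" "fst Z \<noteq> fst Q" "slope Q Z = s" by (auto simp: Thru_def)
      then have "snd Q - snd Z = s * (fst Q - fst Z)" by (auto simp: slope_def)
      then have "det2 (1, s) (Z - Q) = 0" by (simp add: det2_def algebra_simps)
      then have "Z \<in> C \<inter> {Z \<in> zero_locus f. det2 (1, s) (Z - Q) = 0}" using Z(1,2) \<C>(4) by blast
      then show "C \<in> {C \<in> \<C>. C \<inter> {Z \<in> zero_locus f. det2 (1, s) (Z - Q) = 0} \<noteq> {}}" using Z(1) by blast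
    qed
    then have "card (Thru Q s) \<le> card {C \<in> \<C>. C \<inter> {Z \<in> zero_locus f. det2 (1, s) (Z - Q) = 0} \<noteq> {}}"
      using \<C>(1) by (intro card_mono) auto
    also have "\<dots> \<le> d" by (rule meet) (simp add: zero_prod_def)
    finally show ?thesis .
  qed
  have lo: "lo Q C \<in> slope Q ` C" "lo Q C \<le> slope Q A" if "A \<in> H \<inter> C" for Q C A
  proof -
    have "lo Q C \<in> slope Q ` (H \<inter> C)" unfolding lo_def using that H by (intro Min_in) auto
    then show "lo Q C \<in> slope Q ` C" by blast
    show "lo Q C \<le> slope Q A" unfolding lo_def using that H by (intro Min_le) auto
  qed
  have through: "C \<in> Thru Q s" if C: "C \<in> \<C>" "C \<notin> V Q" and A: "A \<in> H \<inter> C" and s: "lo Q C \<le> s" "s \<le> slope Q A"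
    for C Q A s
  proof -
    have ne: "fst Z \<noteq> fst Q" if "Z \<in> C" for Z using C that by (auto simp: V_def)
    have "continuous_on C (slope Q)"
      unfolding slope_def by (intro continuous_intros) (use ne in force)
    then have "connected (slope Q ` C)" using \<C>(3)[OF C(1)] by (intro connected_continuous_image)
    then have "s \<in> slope Q ` C"
      using connectedD_interval[of "slope Q ` C" "lo Q C" "slope Q A" s] lo(1)[OF A, of Q] A s by blast
    then obtain Z where "Z \<in> C" "slope Q Z = s" by (rule imageE) simp
    then show ?thesis using C(1) ne unfolding Thru_def by blast
  qed
  let ?Hit = "{(C, C') \<in> \<C> \<times> \<C>. \<exists>A\<in>H \<inter> C. \<exists>A'\<in>H \<inter> C'. parallel A Q A' Q'}"
  \<comment> \<open>\<open>?S1\<close> and \<open>?S2\<close>: a block meets the vertical line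
    through its viewpoint. \<open>?S3\<close> and \<open>?S4\<close>: the larger of the two left
    endpoints is a slope of the other block. Each has at most \<open>card \<C> * d\<close> elements,
    whence the factor 4.\<close>
  let ?S1 = "V Q \<times> \<C>" and ?S2 = "\<C> \<times> V Q'"
  let ?S3 = "Sigma \<C> (\<lambda>C. Thru Q' (lo Q C))" and ?S4 = "prod.swap ` Sigma \<C> (\<lambda>C'. Thru Q (lo Q' C'))"
  have "x \<in> ?S1 \<union> ?S2 \<union> ?S3 \<union> ?S4" if x: "x \<in> ?Hit" for x
  proof -
    obtain C C' where xe: "x = (C, C')" by (cases x)
    obtain A A' where A: "C \<in> \<C>" "C' \<in> \<C>" "A \<in> H \<inter> C" "A' \<in> H \<inter> C'" "parallel A Q A' Q'"
      using x unfolding xe by blast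
    have eq: "slope Q A = slope Q' A'" using A(5) by (simp add: parallel_slope)
    consider "C \<in> V Q" | "C' \<in> V Q'" | "C \<notin> V Q" "C' \<notin> V Q'" by blast
    then show ?thesis
    proof cases
      case 3
      show ?thesis
      proof (cases "lo Q C \<le> lo Q' C'")
        case True
        have "C \<in> Thru Q (lo Q' C')"
          using through[OF A(1) 3(1) A(3) True] lo(2)[OF A(4), of Q'] eq by simp
        then have "(C', C) \<in> Sigma \<C> (\<lambda>C'. Thru Q (lo Q' C'))" using A(2) by blast
        from imageI[OF this, of prod.swap] show ?thesis unfolding xe swap_simp by blast
      next
        case False
        then have "C' \<in> Thru Q' (lo Q C)"
          using through[OF A(2) 3(2) A(4), of "lo Q C"] lo(2)[OF A(3), of Q] eq by simp
        then show ?thesis using A(1) xe by blast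
      qed
    qed (use A xe in auto)
  qed
  then have sub: "?Hit \<subseteq> ?S1 \<union> ?S2 \<union> ?S3 \<union> ?S4" by blast
  have finV: "finite (V Q)" "finite (Thru Q s)" for Q s using \<C>(1) by (auto simp: V_def Thru_def)
  have S3: "finite ?S3 \<and> card ?S3 \<le> card \<C> * d" using Thru finV by (intro card_pairs_le[OF \<C>(1)]) blast
  have S4': "finite (Sigma \<C> (\<lambda>C'. Thru Q (lo Q' C'))) \<and> card (Sigma \<C> (\<lambda>C'. Thru Q (lo Q' C'))) \<le> card \<C> * d"
    using Thru finV by (intro card_pairs_le[OF \<C>(1)]) blast
  then have S4: "finite ?S4" "card ?S4 \<le> card \<C> * d"
    using card_image_le[of "Sigma \<C> (\<lambda>C'. Thru Q (lo Q' C'))" prod.swap] by auto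
  have S1: "finite ?S1" "card ?S1 \<le> card \<C> * d" and S2: "finite ?S2" "card ?S2 \<le> card \<C> * d"
    using finV \<C>(1) V by (simp_all add: card_cartesian_product mult.commute)
  have "card ?Hit \<le> card (?S1 \<union> ?S2 \<union> ?S3 \<union> ?S4)"
    using sub S1(1) S2(1) S3 S4(1) by (intro card_mono finite_UnI) auto
  also have "\<dots> \<le> card ?S1 + card ?S2 + card ?S3 + card ?S4"
    using card_Un_le[of "?S1 \<union> ?S2 \<union> ?S3" ?S4] card_Un_le[of "?S1 \<union> ?S2" ?S3] card_Un_le[of ?S1 ?S2] by linarith
  also have "\<dots> \<le> card \<C> * (4 * d)" using S1 S2 S3 S4 by (simp add: distrib_left)
  finally show ?thesis .
qed

lemma finite_directions:
  assumes "finite H"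
  shows "finite (directions H)"
proof -
  have "connecting_lines H \<subseteq> (\<lambda>(p, q). affine hull {p, q}) ` (H \<times> H)"
    unfolding connecting_lines_def by auto
  then have "finite (connecting_lines H)" by (rule finite_subset) (simp add: assms)
  then show ?thesis by (simp add: directions_def)
qed

lemma card_slopes_le_card_directions:
  assumes "finite H"
  shows "card ((\<lambda>(A, Q). slope Q A) ` {(A, Q) \<in> H \<times> H. fst A \<noteq> fst Q}) \<le> card (directions H)"
proof -
  let ?sp = "\<lambda>m :: real. span {(1 :: real, m)}"
  have fin: "finite (directions H)" by (rule finite_directions[OF assms])
  have inj: "inj_on ?sp X" for X
  proof (rule inj_onI)
    fix m m' assume eq: "?sp m = ?sp m'"
    have "(1, m) \<in> ?sp m'" unfolding eq[symmetric] by (simp add: span_base)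
    then show "m = m'" by (auto simp: span_singleton)
  qed
  have "?sp (slope Q A) \<in> directions H" if AQ: "A \<in> H" "Q \<in> H" "fst A \<noteq> fst Q" for A Q
  proof -
    define c where "c = fst Q - fst A"
    have "c \<noteq> 0" using AQ(3) by (simp add: c_def)
    have QA: "Q - A = c *\<^sub>R (1, slope Q A)" using AQ(3) by (simp add: c_def slope_def prod_eq_iff)
    have "range (\<lambda>k. k *\<^sub>R (Q - A)) = range (\<lambda>k. k *\<^sub>R (1, slope Q A))"
    proof (intro equalityI image_subsetI)
      fix k :: real
      show "k *\<^sub>R (Q - A) \<in> range (\<lambda>k. k *\<^sub>R (1, slope Q A))"
        unfolding QA by (rule image_eqI[of _ _ "k * c"]) simp_all
      show "k *\<^sub>R (1, slope Q A) \<in> range (\<lambda>k. k *\<^sub>R (Q - A))"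
        unfolding QA using \<open>c \<noteq> 0\<close> by (intro image_eqI[of _ _ "k / c"]) simp_all
    qed
    then have "?sp (slope Q A) = direction (affine hull {A, Q})"
      by (simp add: direction_affine_hull span_singleton)
    moreover have "affine hull {A, Q} \<in> connecting_lines H"
      unfolding connecting_lines_def using AQ by blast
    ultimately show ?thesis unfolding directions_def by blast
  qed
  then have "?sp ` ((\<lambda>(A, Q). slope Q A) ` {(A, Q) \<in> H \<times> H. fst A \<noteq> fst Q}) \<subseteq> directions H" by auto
  from card_inj_on_le[OF inj this fin] show ?thesis .
qed

text \<open>Cauchy-Schwarz first groups the non-vertical pairs by slope, then the resulting
  coincidences \<open>E\<close> by curve \<open>(Q, Q')\<close> and cell.
  \<open>card_parallel_blocks\<close> bounds the number of groups in the second step, and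
  \<open>K\<close>, the coincidences of curve and cell, injects into the common pairs counted by the
  sum. Squaring the first estimate to insert it into the second produces the fourth power.\<close>

lemma sum_common_pairs_lower:
  assumes f: "irreducible f" "total_degree f = d" "d \<ge> 2" "degree f > 0"
    and H: "finite H" "H \<subseteq> zero_locus f" "card H = n"
    and \<C>: "finite \<C>" "disjoint \<C>" "\<And>C. C \<in> \<C> \<Longrightarrow> connected C" "\<Union>\<C> \<subseteq> zero_locus f"
      "H \<subseteq> \<Union>\<C>" "\<And>C. C \<in> \<C> \<Longrightarrow> card (C \<inter> H) \<le> t"
  obtains S where "S \<subseteq> H \<times> H" "card S \<le> n * t"
    "(n * n - n * d) ^ 4 \<le> card (directions H) ^ 2 * (n * n * (card \<C> * (4 * d))) *
       (\<Sum>p\<in>S. \<Sum>q\<in>S. card (common_pairs H (fst p) (snd p) (fst q) (snd q)))"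
proof -
  define blk where "blk = (\<lambda>p. SOME C. C \<in> \<C> \<and> p \<in> C)"
  have blk: "blk p \<in> \<C>" "p \<in> blk p" if "p \<in> H" for p
  proof -
    have "\<exists>C. C \<in> \<C> \<and> p \<in> C" using that \<C>(5) by blast
    then have "blk p \<in> \<C> \<and> p \<in> blk p" unfolding blk_def by (rule someI_ex)
    then show "blk p \<in> \<C>" "p \<in> blk p" by auto
  qed
  \<comment> \<open>The pairs in a common block: points \<open>(A, A')\<close> and
    \<open>(B, B')\<close> lie in the same cell exactly when \<open>(A, B)\<close> and
    \<open>(A', B')\<close> belong to \<open>S\<close>.\<close>
  define S where "S = {(A, B) \<in> H \<times> H. blk A = blk B}"
  define E1 where "E1 = {(A, Q) \<in> H \<times> H. fst A \<noteq> fst Q}"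
  define sl where "sl = (\<lambda>(A, Q). slope Q A)"
  define E where "E = {(x, y) \<in> E1 \<times> E1. sl x = sl y}"
  define g where "g = (\<lambda>((A, Q :: real \<times> real), (A', Q' :: real \<times> real)). ((Q, Q'), (blk A, blk A')))"
  define K where "K = {(e, e') \<in> E \<times> E. g e = g e'}"
  let ?W = "\<Sum>p\<in>S. \<Sum>q\<in>S. card (common_pairs H (fst p) (snd p) (fst q) (snd q))"
  have fin: "finite E1" "finite E" "finite S"
  proof -
    have HH: "finite (H \<times> H)" using H(1) by simp
    have "E1 \<subseteq> H \<times> H" unfolding E1_def by blast
    then show "finite E1" using HH by (rule finite_subset)
    then have "finite (E1 \<times> E1)" by simp
    moreover have "E \<subseteq> E1 \<times> E1" unfolding E_def by blast
    ultimately show "finite E" by (rule finite_subset[rotated])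
    have "S \<subseteq> H \<times> H" unfolding S_def by blast
    then show "finite S" using HH by (rule finite_subset)
  qed
  have cardS: "card S \<le> n * t"
  proof -
    have "S \<subseteq> Sigma H (\<lambda>A. blk A \<inter> H)" using blk by (auto simp: S_def)
    moreover have "finite (Sigma H (\<lambda>A. blk A \<inter> H)) \<and> card (Sigma H (\<lambda>A. blk A \<inter> H)) \<le> card H * t"
      using H(1) blk(1) \<C>(6) by (intro card_pairs_le) auto
    ultimately show ?thesis using H(3) by (meson card_mono order.trans)
  qed
  have N: "n * n - n * d \<le> card E1"
  proof -
    let ?V = "Sigma H (\<lambda>A. {Q \<in> H. det2 (0, 1) (Q - A) = 0})"
    have "finite {Q \<in> H. det2 (0, 1) (Q - A) = 0} \<and> card {Q \<in> H. det2 (0, 1) (Q - A) = 0} \<le> d" for A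
      by (rule card_zero_locus_line_le[OF f H(2)]) (simp add: zero_prod_def)
    then have V: "finite ?V \<and> card ?V \<le> card H * d" by (intro card_pairs_le[OF H(1)])
    have "H \<times> H \<subseteq> E1 \<union> ?V" by (auto simp: E1_def det2_def)
    then have "card (H \<times> H) \<le> card (E1 \<union> ?V)" using fin V by (intro card_mono) auto
    also have "\<dots> \<le> card E1 + card ?V" by (rule card_Un_le)
    finally have "n * n \<le> card E1 + card ?V" by (simp add: card_cartesian_product H(3))
    moreover have "card ?V \<le> n * d" using V H(3) by simp
    ultimately show ?thesis by linarith
  qed
  have E: "card E1 ^ 2 \<le> card (directions H) * card E"
  proof -
    have "card E1 ^ 2 \<le> card (sl ` E1) * card E" unfolding E_def by (rule card_squared_le_coincidences[OF fin(1)])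
    also have "\<dots> \<le> card (directions H) * card E"
      using card_slopes_le_card_directions[OF H(1)] unfolding sl_def E1_def by (rule mult_le_mono1)
    finally show ?thesis .
  qed
  have par: "parallel A Q A' Q'" "A \<in> H" "Q \<in> H" "A' \<in> H" "Q' \<in> H" if "((A, Q), (A', Q')) \<in> E" for A Q A' Q'
    using that by (auto simp: E_def E1_def sl_def parallel_slope)
  have gE: "card (g ` E) \<le> n * n * (card \<C> * (4 * d))"
  proof -
    let ?Hit = "\<lambda>q. {(C, C') \<in> \<C> \<times> \<C>. \<exists>A\<in>H \<inter> C. \<exists>A'\<in>H \<inter> C'. parallel A (fst q) A' (snd q)}"
    have "finite (?Hit q) \<and> card (?Hit q) \<le> card \<C> * (4 * d)" for q
      using card_parallel_blocks[OF f H(1) \<C>(1-4), of "fst q" "snd q"] \<C>(1)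
      by (auto intro: finite_subset[of _ "\<C> \<times> \<C>"])
    then have B: "finite (Sigma (H \<times> H) ?Hit) \<and> card (Sigma (H \<times> H) ?Hit) \<le> card (H \<times> H) * (card \<C> * (4 * d))"
      using H(1) by (intro card_pairs_le) auto
    have "g ` E \<subseteq> Sigma (H \<times> H) ?Hit"
    proof (rule image_subsetI)
      fix e assume e: "e \<in> E"
      obtain A Q A' Q' where ee: "e = ((A, Q), (A', Q'))" by (metis prod.collapse)
      note p = par[OF e[unfolded ee]]
      have "A \<in> H \<inter> blk A" "A' \<in> H \<inter> blk A'" using p blk by auto
      then have "(blk A, blk A') \<in> ?Hit (Q, Q')" using p(1) blk(1)[OF p(2)] blk(1)[OF p(4)] by auto
      then show "g e \<in> Sigma (H \<times> H) ?Hit" using p(3,5) by (simp add: g_def ee)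
    qed
    then have "card (g ` E) \<le> card (Sigma (H \<times> H) ?Hit)" using B by (intro card_mono) auto
    then show ?thesis using B H(3) by (simp add: card_cartesian_product)
  qed
  have KW: "card K \<le> ?W"
  proof -
    let ?T = "Sigma (S \<times> S) (\<lambda>pq. common_pairs H (fst (fst pq)) (snd (fst pq)) (fst (snd pq)) (snd (snd pq)))"
    \<comment> \<open>\<open>Q1\<close> and \<open>Q1'\<close> may be forgotten: on \<open>K\<close>
      they equal \<open>Q\<close> and \<open>Q'\<close>.\<close>
    define \<psi> where "\<psi> = (\<lambda>(((A :: real \<times> real, Q :: real \<times> real), (A' :: real \<times> real, Q' :: real \<times> real)),
      ((B :: real \<times> real, Q1 :: real \<times> real), (B' :: real \<times> real, Q1' :: real \<times> real))). (((A, B), (A', B')), (Q, Q')))"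
    have Kform: "\<exists>A Q A' Q' B B'. k = (((A, Q), (A', Q')), ((B, Q), (B', Q'))) \<and> \<psi> k \<in> ?T" if "k \<in> K" for k
    proof -
      obtain e e' where k: "k = (e, e')" "e \<in> E" "e' \<in> E" "g e = g e'" using \<open>k \<in> K\<close> unfolding K_def by blast
      obtain A Q A' Q' where ee: "e = ((A, Q), (A', Q'))" by (metis prod.collapse)
      obtain B Q1 B' Q1' where ee': "e' = ((B, Q1), (B', Q1'))" by (metis prod.collapse)
      have g: "Q = Q1" "Q' = Q1'" "blk A = blk B" "blk A' = blk B'" using k(4) by (simp_all add: ee ee' g_def)
      note p = par[OF k(2)[unfolded ee]] and p' = par[OF k(3)[unfolded ee']]
      have "(A, B) \<in> S" "(A', B') \<in> S" using p p' g by (simp_all add: S_def)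
      moreover have "(Q, Q') \<in> common_pairs H A B A' B'" using p p' g by (simp add: common_pairs_def)
      ultimately have "\<psi> k \<in> ?T" by (simp add: \<psi>_def k(1) ee ee')
      moreover have "k = (((A, Q), (A', Q')), ((B, Q), (B', Q')))" using k(1) ee ee' g(1,2) by simp
      ultimately show ?thesis
        by (intro exI[of _ A] exI[of _ Q] exI[of _ A'] exI[of _ Q'] exI[of _ B] exI[of _ B'] conjI)
    qed
    have "inj_on \<psi> K"
    proof (rule inj_onI)
      fix x y assume "x \<in> K" "y \<in> K" "\<psi> x = \<psi> y"
      moreover obtain A Q A' Q' B B' where "x = (((A, Q), (A', Q')), ((B, Q), (B', Q')))" using Kform[OF \<open>x \<in> K\<close>] by blast
      moreover obtain A Q A' Q' B B' where "y = (((A, Q), (A', Q')), ((B, Q), (B', Q')))" using Kform[OF \<open>y \<in> K\<close>] by blast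
      ultimately show "x = y" by (simp add: \<psi>_def)
    qed
    moreover have "\<psi> ` K \<subseteq> ?T" using Kform by blast
    moreover have "finite ?T" using fin(3) by (intro finite_SigmaI finite_cartesian_product finite_common_pairs H(1))
    ultimately have "card K \<le> card ?T" by (rule card_inj_on_le)
    also have "card ?T = (\<Sum>pq\<in>S \<times> S. card (common_pairs H (fst (fst pq)) (snd (fst pq)) (fst (snd pq)) (snd (snd pq))))"
      using fin(3) by (intro card_SigmaI) (auto intro: finite_common_pairs H(1))
    also have "\<dots> = ?W" by (simp only: sum.cartesian_product split_def)
    finally show ?thesis .
  qed
  have "(n * n - n * d) ^ 4 \<le> (card E1 ^ 2) ^ 2"
    using N by (simp add: power_mono flip: power_mult)
  also have "\<dots> \<le> (card (directions H) * card E) ^ 2" using E by (intro power_mono) auto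
  also have "\<dots> = card (directions H) ^ 2 * card E ^ 2" by (rule power_mult_distrib)
  also have "card E ^ 2 \<le> card (g ` E) * card K" unfolding K_def by (rule card_squared_le_coincidences[OF fin(2)])
  also have "\<dots> \<le> (n * n * (card \<C> * (4 * d))) * ?W" using gE KW by (rule mult_le_mono)
  finally have "(n * n - n * d) ^ 4 \<le> card (directions H) ^ 2 * (n * n * (card \<C> * (4 * d))) * ?W"
    by (simp add: mult.assoc)
  moreover have "S \<subseteq> H \<times> H" by (auto simp: S_def)
  ultimately show ?thesis using that cardS by blast
qed

section \<open>Choice of the constants and the low degrees\<close>

lemma total_degree_mult_le: "total_degree (f * h) \<le> total_degree f + total_degree h"
proof (rule total_degree_le, rule ccontr)
  fix i j assume nz: "coeff (coeff (f * h) i) j \<noteq> 0" and gt: "\<not> i + j \<le> total_degree f + total_degree h"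
  have "coeff (coeff f i1) j1 * coeff (coeff h (i - i1)) (j - j1) = 0" if "i1 \<le> i" "j1 \<le> j" for i1 j1
  proof (rule ccontr)
    assume "\<not> ?thesis"
    then have "i1 + j1 \<le> total_degree f" "(i - i1) + (j - j1) \<le> total_degree h"
      by (auto intro: coeff_le_total_degree)
    then show False using gt that by linarith
  qed
  then have "coeff (coeff (f * h) i) j = 0"
    unfolding coeff_mult coeff_sum by (intro sum.neutral ballI) auto
  then show False using nz by simp
qed

text \<open>In the application \<open>m\<close> is the number of points, \<open>R\<close> of blocks,
  \<open>t\<close> bounds the points of a block, \<open>s\<close> the common pairs in the ordinary
  case, and \<kappa> collects the special cases. After substitution the two summands bounding
  \<open>W\<close> each contribute less than half of m^4: the first once \<open>r\<close> is large,
  the second once \<open>m\<close> is large for that \<open>r\<close>.\<close>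

lemma no_solution_for_large_parameters:
  fixes m C d R W s \<kappa> r t :: real
  assumes pos: "m > 0" "C > 0" "d > 0" "s \<ge> 0" "\<kappa> \<ge> 0" "r > 0" "t \<ge> 0" "W \<ge> 0"
    and "m ^ 4 \<le> 256 * C\<^sup>2 * d * R * W" "W \<le> (m * t)\<^sup>2 * s + \<kappa> * m ^ 3" "t \<le> 2 * d * m / r" "R \<le> 2 * d * r"
    and large: "4096 * C\<^sup>2 * d ^ 4 * s < r" "1024 * C\<^sup>2 * d\<^sup>2 * r * \<kappa> < m"
  shows False
proof -
  have "m ^ 4 \<le> 256 * C\<^sup>2 * d * R * W" by fact
  also have "\<dots> \<le> 256 * C\<^sup>2 * d * (2 * d * r) * W"
    using pos assms(12) by (intro mult_right_mono mult_left_mono) auto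
  also have "\<dots> \<le> 256 * C\<^sup>2 * d * (2 * d * r) * ((m * t)\<^sup>2 * s + \<kappa> * m ^ 3)"
    using pos assms(10) by (intro mult_left_mono) auto
  also have "\<dots> \<le> 256 * C\<^sup>2 * d * (2 * d * r) * ((m * (2 * d * m / r))\<^sup>2 * s + \<kappa> * m ^ 3)"
    using pos assms(11) by (intro mult_left_mono add_mono mult_right_mono power_mono) auto
  also have "\<dots> = (4096 * C\<^sup>2 * d ^ 4 * s) * m ^ 4 / (2 * r) + (1024 * C\<^sup>2 * d\<^sup>2 * r * \<kappa>) * m ^ 3 / 2"
    using pos by (simp add: field_simps power2_eq_square power4_eq_xxxx power3_eq_cube)
  also have "\<dots> < r * m ^ 4 / (2 * r) + m * m ^ 3 / 2"
    using pos large by (intro add_strict_mono divide_strict_right_mono mult_strict_right_mono) auto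
  also have "\<dots> = m ^ 4" using pos by (simp add: field_simps power4_eq_xxxx power3_eq_cube)
  finally show False by simp
qed

lemma few_directions_imp_degree_le_2:
  fixes d :: nat and C :: real
  assumes "d \<ge> 3" "C > 0"
  obtains n0 where "\<And>f H. irreducible f \<Longrightarrow> total_degree f = d \<Longrightarrow> H \<subseteq> zero_locus f \<Longrightarrow> finite H \<Longrightarrow>
    card H > n0 \<Longrightarrow> real (card (directions H)) \<le> C * real (card H) \<Longrightarrow> False"
proof -
  define k where "k = d + 4 * d ^ 3"
  define s where "s = 9 * d ^ 3 + d * d"
  define \<kappa> where "\<kappa> = 2 * d + (d * d + 3 * d + 1) * (d * d)"
  \<comment> \<open>The summand k + 1 turns \<open>d * (k + r + 1)\<close> into at most
    \<open>2 * d * r\<close>; the ceiling secures the first largeness condition of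
    \<open>no_solution_for_large_parameters\<close>.\<close>
  define r where "r = k + 1 + nat \<lceil>4096 * C\<^sup>2 * real d ^ 4 * real s\<rceil> + 1"
  define q where "q = d * (k + r)"
  \<comment> \<open>\<open>q\<close> bounds the points lost on removed vertical lines. In
    \<open>M\<close>, 2 d gives m^2 - m d >= m^2 / 2, q gives card H <= 2 m, k gives m > 4 d^3 + d
    for the upper bound, and the ceiling secures the second largeness condition.\<close>
  define M where "M = 2 * d + q + k + nat \<lceil>1024 * C\<^sup>2 * (real d)\<^sup>2 * real r * real \<kappa>\<rceil>"
  show ?thesis
  proof (rule that[of "q + M"])
    fix f H
    assume f: "irreducible f" "total_degree f = d" and H: "H \<subseteq> zero_locus f" "finite H"
      and big: "card H > q + M" and dirs: "real (card (directions H)) \<le> C * real (card H)"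
    have d2: "d \<ge> 2" using assms(1) by simp
    have "H \<noteq> {}" using big by auto
    then obtain Z where "eval2 f Z = 0" using H(1) by (auto simp: zero_locus_def)
    then have deg: "degree f > 0" using irreducible_degree_pos[OF f(1)] f(2) d2 by blast
    have "r > 0" by (simp add: r_def)
    obtain H' \<C> where H': "H' \<subseteq> H" "card H \<le> card H' + d * (d + 4 * d ^ 3 + r)"
      "\<And>p. p \<in> H' \<Longrightarrow> eval2 (pderiv f) p \<noteq> 0"
      and \<C>: "finite \<C>" "disjoint \<C>" "\<And>C. C \<in> \<C> \<Longrightarrow> connected C" "\<Union>\<C> \<subseteq> zero_locus f" "H' \<subseteq> \<Union>\<C>"
      and R: "card \<C> \<le> d * (d + 4 * d ^ 3 + r + 1)" and t: "\<And>C. C \<in> \<C> \<Longrightarrow> card (C \<inter> H') \<le> d * (card H div r)"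
      using block_decomposition[OF f d2 deg H(2,1) \<open>r > 0\<close>] by metis
    define m where "m = card H'"
    define t where "t = d * (card H div r)"
    have m: "card H \<le> m + q" "m > M" using H'(2) big by (auto simp: m_def q_def k_def)
    have H'2: "finite H'" "H' \<subseteq> zero_locus f" using H' H finite_subset by auto
    have tt: "card (C \<inter> H') \<le> t" if "C \<in> \<C>" for C using t[OF that] by (simp add: t_def)
    obtain S where S: "S \<subseteq> H' \<times> H'" "card S \<le> m * t" and
      low: "(m * m - m * d) ^ 4 \<le> card (directions H') ^ 2 * (m * m * (card \<C> * (4 * d))) *
       (\<Sum>p\<in>S. \<Sum>q\<in>S. card (common_pairs H' (fst p) (snd p) (fst q) (snd q)))"
      by (rule sum_common_pairs_lower[OF f d2 deg H'2 m_def[symmetric] \<C> tt], assumption, assumption, rule that)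
    define W where "W = (\<Sum>p\<in>S. \<Sum>q\<in>S. card (common_pairs H' (fst p) (snd p) (fst q) (snd q)))"
    have up: "W \<le> (m * t)^2 * s + m ^ 3 * \<kappa>"
      unfolding W_def s_def \<kappa>_def
      using sum_common_pairs_upper[OF f assms(1) deg H'2(2,1) H'(3) _ _ S] m(2) by (simp add: m_def M_def k_def)
    have "m > 0" using m(2) by simp
    \<comment> \<open>The directions were counted against \<open>card H\<close>, which is at most 2
      m; hence the factor 2.\<close>
    have D: "real (card (directions H')) \<le> 2 * C * real m"
    proof -
      have "connecting_lines H' \<subseteq> connecting_lines H" using H'(1) unfolding connecting_lines_def by blast
      then have sub: "directions H' \<subseteq> directions H" unfolding directions_def by blast
      moreover have "finite (directions H)" using H(2) by (rule finite_directions)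
      ultimately have "real (card (directions H')) \<le> real (card (directions H))" by (simp add: card_mono)
      also have "\<dots> \<le> C * real (card H)" by (rule dirs)
      also have "\<dots> \<le> C * real (2 * m)" using m assms(2) by (intro mult_left_mono) (auto simp: M_def)
      finally show ?thesis by simp
    qed
    have "2 * d \<le> m" using m(2) by (simp add: M_def)
    then have half: "real m ^ 2 / 2 \<le> real (m * m - m * d)"
    proof -
      have "m * (2 * d) \<le> m * m" using \<open>2 * d \<le> m\<close> by (rule mult_le_mono2)
      moreover have "m * (2 * d) = 2 * (m * d)" by simp
      ultimately have "m * m \<le> 2 * (m * m - m * d)" by linarith
      then have "real (m * m) \<le> real (2 * (m * m - m * d))" by (simp only: of_nat_le_iff)
      then show ?thesis by (simp add: power2_eq_square)
    qed
    have "(real m ^ 2 / 2) ^ 4 \<le> real (m * m - m * d) ^ 4" using half by (intro power_mono) auto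
    also have "\<dots> = real ((m * m - m * d) ^ 4)" by simp
    also have "\<dots> \<le> real (card (directions H') ^ 2 * (m * m * (card \<C> * (4 * d))) * W)"
      using low unfolding W_def by (simp only: of_nat_le_iff)
    also have "\<dots> = real (card (directions H')) ^ 2 * (real m * real m * (real (card \<C>) * (4 * real d)) * real W)" by simp
    also have "\<dots> \<le> (2 * C * real m) ^ 2 * (real m * real m * (real (card \<C>) * (4 * real d)) * real W)"
      using D by (intro mult_right_mono power_mono) auto
    finally have "(real m ^ 2 / 2) ^ 4 \<le> (2 * C * real m) ^ 2 * (real m * real m * (real (card \<C>) * (4 * real d)) * real W)" .
    moreover have "(real m ^ 2 / 2) ^ 4 = real m ^ 4 * (real m ^ 4 / 16)"
      by (simp add: field_simps eval_nat_numeral)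
    moreover have "(2 * C * real m) ^ 2 * (real m * real m * (real (card \<C>) * (4 * real d)) * real W) =
      real m ^ 4 * (16 * C\<^sup>2 * real d * real (card \<C>) * real W)"
      by (simp add: field_simps eval_nat_numeral)
    ultimately have "real m ^ 4 * (real m ^ 4 / 16) \<le> real m ^ 4 * (16 * C\<^sup>2 * real d * real (card \<C>) * real W)"
      by (simp only:)
    then have "real m ^ 4 / 16 \<le> 16 * C\<^sup>2 * real d * real (card \<C>) * real W"
      by (rule mult_left_le_imp_le) (use \<open>m > 0\<close> in simp)
    then have main: "real m ^ 4 \<le> 256 * C\<^sup>2 * real d * real (card \<C>) * real W" by simp
    have up': "real W \<le> (real m * real t)\<^sup>2 * real s + real \<kappa> * real m ^ 3"
    proof -
      have "real W \<le> real ((m * t)^2 * s + m ^ 3 * \<kappa>)" using up by (simp only: of_nat_le_iff)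
      then show ?thesis by (simp add: mult.commute)
    qed
    have t': "real t \<le> 2 * real d * real m / real r"
    proof -
      have "real (card H div r) \<le> real (card H) / real r" by (rule of_nat_div_le_of_nat)
      also have "\<dots> \<le> (2 * real m) / real r" using m by (intro divide_right_mono) (auto simp: M_def)
      finally have "real d * real (card H div r) \<le> real d * (2 * real m / real r)" by (intro mult_left_mono) auto
      then show ?thesis by (simp add: t_def mult_ac)
    qed
    have R': "real (card \<C>) \<le> 2 * real d * real r"
    proof -
      have "k + 1 \<le> r" unfolding r_def by linarith
      have "card \<C> \<le> d * (k + r + 1)" using R by (simp add: k_def)
      also have "\<dots> \<le> d * (2 * r)" using \<open>k + 1 \<le> r\<close> by (intro mult_le_mono2) linarith
      finally have "real (card \<C>) \<le> real (d * (2 * r))" by (simp only: of_nat_le_iff)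
      then show ?thesis by simp
    qed
    have "4096 * C\<^sup>2 * real d ^ 4 * real s < real r"
      using real_nat_ceiling_ge[of "4096 * C\<^sup>2 * real d ^ 4 * real s"] unfolding r_def by linarith
    moreover have "1024 * C\<^sup>2 * (real d)\<^sup>2 * real r * real \<kappa> < real m"
      using real_nat_ceiling_ge[of "1024 * C\<^sup>2 * (real d)\<^sup>2 * real r * real \<kappa>"] m(2) unfolding M_def by linarith
    ultimately show False
      using no_solution_for_large_parameters[OF _ assms(2) _ _ _ _ _ _ main up' t' R'] \<open>m > 0\<close> \<open>r > 0\<close> assms(1)
      by simp
  qed
qed

theorem theorem2p4:
  fixes d :: nat and C :: real
  assumes "d > 0" and "C > 0"
  shows "\<exists>n0 :: nat. \<forall>(\<Gamma> :: (real \<times> real) set) (H :: (real \<times> real) set) (n :: nat).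
           irreducible_curve d \<Gamma> \<and> H \<subseteq> \<Gamma> \<and> finite H \<and> card H = n \<and> n > n0 \<and>
           real (card (directions H)) \<le> C * real n
           \<longrightarrow> conic_curve \<Gamma>"
proof (cases "d \<ge> 3")
  case True
  obtain n0 where "\<And>f H. irreducible f \<Longrightarrow> total_degree f = d \<Longrightarrow> H \<subseteq> zero_locus f \<Longrightarrow> finite H \<Longrightarrow>
    card H > n0 \<Longrightarrow> real (card (directions H)) \<le> C * real (card H) \<Longrightarrow> False"
    using few_directions_imp_degree_le_2[OF True \<open>C > 0\<close>] by blast
  then show ?thesis by (intro exI[of _ n0]) (auto simp: irreducible_curve_def)
next
  case False
  have "conic_curve \<Gamma>" if "irreducible_curve d \<Gamma>" for \<Gamma>
  proof -
    obtain f where f: "irreducible f" "total_degree f = d" "\<Gamma> = zero_locus f"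
      using \<open>irreducible_curve d \<Gamma>\<close> by (auto simp: irreducible_curve_def)
    show ?thesis
    proof (cases "d = 1")
      case True
      \<comment> \<open>The square of the linear equation has the same zeros and total degree
        2.\<close>
      have "f \<noteq> 0" using f(1) by auto
      then have "total_degree (f * f) = 2"
        using total_degree_mult_ge[of f f] total_degree_mult_le[of f f] f(2) True by simp
      moreover have "zero_locus (f * f) = \<Gamma>" by (simp add: f(3) zero_locus_def)
      ultimately show ?thesis unfolding conic_curve_def by blast
    next
      case False
      then have "d = 2" using \<open>\<not> d \<ge> 3\<close> assms(1) by linarith
      then show ?thesis using f unfolding conic_curve_def by blast
    qed
  qed
  then show ?thesis by blast
qed

end
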